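(* The operator $B_\omega\colon \tilde{\mathcal Y}\to(\tilde{\mathcal X}_{0,\{T\}})^*$ is boundedly invertible $\mathbb P$-almost surely, and $\mathbb P$-almost surely $$\sup_{0\neq v\in\tilde{\mathcal Y}}\ \sup_{0\neq w\in\tilde{\mathcal X}_{0,\{T\}}}\frac{|\langle B_\omega v,w\rangle|}{\|v\|_{\tilde{\mathcal Y}}\,|w|_{\tilde{\mathcal X}_\omega}}=1 \qquad\text{and}\qquad \inf_{0\neq v\in\tilde{\mathcal Y}}\ \sup_{0\neq w\in\tilde{\mathcal X}_{0,\{T\}}}\frac{|\langle B_\omega v,w\rangle|}{\|v\|_{\tilde{\mathcal Y}}\,|w|_{\tilde{\mathcal X}_\omega}}=1 .$$
   Context: Let $T\in(0,\infty)$ and let $(\Omega,\Sigma,\mathbb P)$ be a complete probability space. Let $W_+\hookrightarrow W_-$ be nonzero real separable Hilbert spaces (continuous, dense embedding). For $\mathbb P$-a.e. $\omega\in\Omega$ let $A_\omega\in\mathcal L(W_+,W_-)$ be a time-independent operator which is self-adjoint and positive when regarded as an operator in $W_-$ with domain $W_+$, and which satisfies $$A_{\min}(\omega)\|w\|_{W_+}\le\|A_\omega w\|_{W_-}\le A_{\max}(\omega)\|w\|_{W_+}\quad\text{for all } w\in W_+,$$ for random variables with $0<A_{\min}\le A_{\max}<\infty$ $\mathbb P$-a.s. Fractional powers such as $A_\omega^{1/2}$ are those of the self-adjoint positive operator $A_\omega$ in $W_-$. Let $W_-^*$ be the dual of $W_-$ and ${}_{W_-^*}\langle\cdot,\cdot\rangle_{W_-}$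 the duality pairing. Define $$\tilde{\mathcal Y}:=L^2((0,T);W_-^* ),\qquad \tilde{\mathcal X}:=L^2((0,T);W_+)\cap H^1((0,T);W_-),\qquad \tilde{\mathcal X}_{0,\{T\}}:=\{x\in\tilde{\mathcal X}:x(T)=0\},$$ with norms $$\|y\|_{\tilde{\mathcal Y}}^2:=\int_0^T\|y(t)\|_{W_-^*}^2\,dt,\qquad |x|_{\tilde{\mathcal X}_\omega}^2:=\int_0^T\big(\|\dot x(t)\|_{W_-}^2+\|A_\omega x(t)\|_{W_-}^2\big)\,dt+\|A_\omega^{1/2}x(0)\|_{W_-}^2 ,$$ the latter being an ($\omega$-dependent) norm on $\tilde{\mathcal X}_{0,\{T\}}$. The operator $B_\omega$ is defined by $$\langle B_\omega y,x\rangle:=\int_0^T{}_{W_-^*}\langle y(t),A_\omega x(t)-\dot x(t)\rangle_{W_-}\,dt,\qquad y\in\tilde{\mathcal Y},\ x\in\tilde{\mathcal X}_{0,\{T\}} .$$ *)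

theory Defs
  imports "HOL-Probability.Probability"
begin

text \<open>
  An operator is represented by its graph, a set of pairs (argument, value), so that its domain
  is part of the data and composition with natural domains is relational composition.
\<close>

definition adjoint_graph :: "('h::real_inner \<times> 'h) set \<Rightarrow> ('h \<times> 'h) set" where
  "adjoint_graph G = {(v, z). \<forall>(u, w) \<in> G. inner w v = inner u z}"

text \<open>
  An adjoint graph is always a closed linear subspace, and it is single-valued when the domain is
  dense; hence linearity and single-valuedness are consequences of the following definition.
\<close>

definition selfadjoint :: "('h::real_inner \<times> 'h) set \<Rightarrow> bool" where
  "selfadjoint G \<longleftrightarrow> closure (Domain G) = UNIV \<and> adjoint_graph G = G"

definition positive_op :: "('h::real_inner \<times> 'h) set \<Rightarrow> bool" where
  "positive_op G \<longleftrightarrow> (\<forall>(u, w) \<in> G. inner w u \<ge> 0)"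

text \<open>
  The power \<open>1/2\<close> of a self-adjoint positive operator is its unique self-adjoint positive
  square root (as an unbounded operator: the domains agree as well).
\<close>

definition sqrt_op :: "('h::real_inner \<times> 'h) set \<Rightarrow> ('h \<times> 'h) set" where
  "sqrt_op G = (THE S. selfadjoint S \<and> positive_op S \<and> S O S = G)"

definition op_apply :: "('h \<times> 'h) set \<Rightarrow> 'h \<Rightarrow> 'h" where
  "op_apply G u = (THE v. (u, v) \<in> G)"

text \<open>
  \<open>emb\<close> is the embedding of \<open>W\<^sub>+\<close> (type \<open>'p\<close>) into \<open>W\<^sub>-\<close> (type \<open>'m\<close>);
  \<open>A\<close> is regarded as an operator in \<open>W\<^sub>-\<close> with domain (the image of) \<open>W\<^sub>+\<close>.
\<close>

definition op_in ::
  "('p::real_normed_vector \<Rightarrow>\<^sub>L 'm::real_inner) \<Rightarrow> ('p \<Rightarrow>\<^sub>L 'm) \<Rightarrow> ('m \<times> 'm) set" where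
  "op_in emb A = {(blinfun_apply emb w, blinfun_apply A w) | w. True}"

text \<open>
  Elements of these spaces are handled through representatives: equality in the space is equality
  almost everywhere on \<open>(0,T)\<close>, and \<open>ae_zero\<close> says that an element is the zero element.
  The value spaces used below are separable, so Borel measurability is strong measurability.
\<close>

definition ae_zero :: "real \<Rightarrow> (real \<Rightarrow> 'a::real_normed_vector) \<Rightarrow> bool" where
  "ae_zero T f \<longleftrightarrow> (AE t in lebesgue_on {0<..<T}. f t = 0)"

definition L2_space :: "real \<Rightarrow> (real \<Rightarrow> 'a::real_normed_vector) set" where
  "L2_space T = {f. f \<in> borel_measurable (lebesgue_on {0<..<T}) \<and>
     integrable (lebesgue_on {0<..<T}) (\<lambda>t. (norm (f t))\<^sup>2)}"

definition L2_norm :: "real \<Rightarrow> (real \<Rightarrow> 'a::real_normed_vector) \<Rightarrow> real" where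
  "L2_norm T f = sqrt (\<integral>t. (norm (f t))\<^sup>2 \<partial>lebesgue_on {0<..<T})"

definition test_function :: "real \<Rightarrow> (real \<Rightarrow> real) \<Rightarrow> bool" where
  "test_function T \<phi> \<longleftrightarrow>
     (\<forall>k t. (deriv ^^ k) \<phi> field_differentiable (at t)) \<and>
     compact (closure {t. \<phi> t \<noteq> 0}) \<and> closure {t. \<phi> t \<noteq> 0} \<subseteq> {0<..<T}"

definition has_weak_deriv ::
  "real \<Rightarrow> (real \<Rightarrow> 'a::{banach, second_countable_topology}) \<Rightarrow> (real \<Rightarrow> 'a) \<Rightarrow> bool" where
  "has_weak_deriv T u g \<longleftrightarrow> g \<in> L2_space T \<and>
     (\<forall>\<phi>. test_function T \<phi> \<longrightarrow>
        (\<integral>t. deriv \<phi> t *\<^sub>R u t \<partial>lebesgue_on {0<..<T}) =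
        - (\<integral>t. \<phi> t *\<^sub>R g t \<partial>lebesgue_on {0<..<T}))"

definition H1_space :: "real \<Rightarrow> (real \<Rightarrow> 'a::{banach, second_countable_topology}) set" where
  "H1_space T = {u \<in> L2_space T. \<exists>g. has_weak_deriv T u g}"

text \<open>For \<open>u\<close> in \<open>H1_space T\<close> the weak derivative is determined up to null sets.\<close>

definition weak_deriv ::
  "real \<Rightarrow> (real \<Rightarrow> 'a::{banach, second_countable_topology}) \<Rightarrow> real \<Rightarrow> 'a" where
  "weak_deriv T u = (SOME g. has_weak_deriv T u g)"

text \<open>
  Point values such as \<open>u(0)\<close> and \<open>u(T)\<close> are those of the continuous representative on
  \<open>[0,T]\<close>, whose values on \<open>[0,T]\<close> are uniquely determined.
\<close>

definition cont_rep :: "real \<Rightarrow> (real \<Rightarrow> 'a::real_normed_vector) \<Rightarrow> real \<Rightarrow> 'a" where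
  "cont_rep T u = (SOME c. continuous_on {0..T} c \<and> (AE t in lebesgue_on {0<..<T}. c t = u t))"

definition X_space ::
  "('p::real_normed_vector \<Rightarrow>\<^sub>L 'm::{banach, second_countable_topology}) \<Rightarrow> real \<Rightarrow> (real \<Rightarrow> 'p) set" where
  "X_space emb T = {x \<in> L2_space T. (\<lambda>t. blinfun_apply emb (x t)) \<in> H1_space T}"

definition X0_space ::
  "('p::real_normed_vector \<Rightarrow>\<^sub>L 'm::{banach, second_countable_topology}) \<Rightarrow> real \<Rightarrow> (real \<Rightarrow> 'p) set" where
  "X0_space emb T = {x \<in> X_space emb T. cont_rep T (\<lambda>t. blinfun_apply emb (x t)) T = 0}"

definition X_norm ::
  "('p::real_normed_vector \<Rightarrow>\<^sub>L 'm::{real_inner, banach, second_countable_topology}) \<Rightarrow>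
   ('p \<Rightarrow>\<^sub>L 'm) \<Rightarrow> real \<Rightarrow> (real \<Rightarrow> 'p) \<Rightarrow> real" where
  "X_norm emb A T x = sqrt (
     (\<integral>t. (norm (weak_deriv T (\<lambda>s. blinfun_apply emb (x s)) t))\<^sup>2 + (norm (blinfun_apply A (x t)))\<^sup>2
        \<partial>lebesgue_on {0<..<T})
     + (norm (op_apply (sqrt_op (op_in emb A)) (cont_rep T (\<lambda>s. blinfun_apply emb (x s)) 0)))\<^sup>2)"

text \<open>The first function argument takes values in the dual space of \<open>W\<^sub>-\<close> (with operator norm).\<close>

definition B_op ::
  "('p::real_normed_vector \<Rightarrow>\<^sub>L 'm::{banach, second_countable_topology}) \<Rightarrow>
   ('p \<Rightarrow>\<^sub>L 'm) \<Rightarrow> real \<Rightarrow> (real \<Rightarrow> 'm \<Rightarrow>\<^sub>L real) \<Rightarrow> (real \<Rightarrow> 'p) \<Rightarrow> real" where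
  "B_op emb A T y x =
     (\<integral>t. blinfun_apply (y t)
            (blinfun_apply A (x t) - weak_deriv T (\<lambda>s. blinfun_apply emb (x s)) t)
        \<partial>lebesgue_on {0<..<T})"

text \<open>
  Only the values of a functional on \<open>V\<close> matter. The bound forces a functional to vanish on
  elements of zero norm, hence to respect equality almost everywhere.
\<close>

definition dual_space ::
  "(real \<Rightarrow> 'a::real_vector) set \<Rightarrow> ((real \<Rightarrow> 'a) \<Rightarrow> real) \<Rightarrow> ((real \<Rightarrow> 'a) \<Rightarrow> real) set" where
  "dual_space V nrm = {\<psi>.
     (\<forall>x\<in>V. \<forall>z\<in>V. \<forall>a b. \<psi> (\<lambda>t. a *\<^sub>R x t + b *\<^sub>R z t) = a * \<psi> x + b * \<psi> z) \<and>
     (\<exists>C. \<forall>x\<in>V. \<bar>\<psi> x\<bar> \<le> C * nrm x)}"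

definition dual_norm ::
  "real \<Rightarrow> (real \<Rightarrow> 'a::real_normed_vector) set \<Rightarrow> ((real \<Rightarrow> 'a) \<Rightarrow> real) \<Rightarrow>
   ((real \<Rightarrow> 'a) \<Rightarrow> real) \<Rightarrow> ereal" where
  "dual_norm T V nrm \<psi> = (SUP x\<in>{x \<in> V. \<not> ae_zero T x}. ereal (\<bar>\<psi> x\<bar> / nrm x))"

text \<open>
  \<open>B\<close> is a bounded linear bijection, with bounded inverse, from the normed space \<open>Y\<close> onto the
  dual of the normed space \<open>V\<close>, both being spaces of functions on \<open>(0,T)\<close> modulo null sets.
\<close>

definition boundedly_invertible ::
  "real \<Rightarrow> (real \<Rightarrow> 'b::real_normed_vector) set \<Rightarrow> ((real \<Rightarrow> 'b) \<Rightarrow> real) \<Rightarrow>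
   (real \<Rightarrow> 'a::real_normed_vector) set \<Rightarrow> ((real \<Rightarrow> 'a) \<Rightarrow> real) \<Rightarrow>
   ((real \<Rightarrow> 'b) \<Rightarrow> (real \<Rightarrow> 'a) \<Rightarrow> real) \<Rightarrow> bool" where
  "boundedly_invertible T Y nY V nV B \<longleftrightarrow>
     (\<forall>y\<in>Y. B y \<in> dual_space V nV) \<and>
     (\<forall>y\<in>Y. \<forall>z\<in>Y. \<forall>a b. \<forall>x\<in>V. B (\<lambda>t. a *\<^sub>R y t + b *\<^sub>R z t) x = a * B y x + b * B z x) \<and>
     (\<exists>C::real. \<forall>y\<in>Y. dual_norm T V nV (B y) \<le> ereal C * ereal (nY y)) \<and>
     (\<forall>y\<in>Y. (\<forall>x\<in>V. B y x = 0) \<longrightarrow> ae_zero T y) \<and>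
     (\<forall>\<psi>\<in>dual_space V nV. \<exists>y\<in>Y. \<forall>x\<in>V. B y x = \<psi> x) \<and>
     (\<exists>C::real. \<forall>y\<in>Y. ereal (nY y) \<le> ereal C * dual_norm T V nV (B y))"

end

theory Submission imports Defs "HOL-Real_Asymp.Real_Asymp" begin

text \<open>
  Fix \<open>\<omega>\<close> and put \<open>L x = A x - x'\<close>. Since \<open>A\<close> is self-adjoint and \<open>x(T) = 0\<close>,
  \<open>-2 \<integral>\<langle>A x, x'\<rangle> = \<parallel>A\<^sup>1\<^sup>/\<^sup>2 x(0)\<parallel>\<^sup>2\<close>, so \<open>L\<close> is an isometry from the trial space
  into \<open>L\<^sup>2(0,T; W\<^sub>-)\<close>. Its domain is complete, hence a Hilbert space, and its range is dense: if \<open>h\<close> is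
  orthogonal to the range, testing with \<open>x(t) = A\<^sup>-\<^sup>1 \<integral>\<^bsub>t\<^esub>\<^bsup>T\<^esup> h\<close> gives
  \<open>\<parallel>\<integral>h\<parallel>\<^sup>2 / 2 + \<integral>\<langle>h, A\<^sup>-\<^sup>1 h\<rangle> = 0\<close> and so \<open>h = 0\<close>. Thus \<open>L\<close> is unitary, and
  \<open>\<langle>B v, x\<rangle> = \<langle>v, L x\<rangle>\<close> makes \<open>B\<close> an isometric isomorphism onto the dual space.

  No spectral theorem is used: \<open>A\<close> is handled through the bounded inverse \<open>K = A\<^sup>-\<^sup>1\<close>, and the energy
  identity is first proved for bounded approximations of \<open>A\<^sup>1\<^sup>/\<^sup>2\<close>.
\<close>

section \<open>Hilbert spaces and square roots of bounded operators\<close>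

text \<open>
  The operation \<open>lin\<close> stands for linear combinations. Vector space axioms are not required, so the lemma
  applies to functions modulo null sets without forming a quotient.
\<close>

lemma riesz_abstract:
  fixes V :: "'v set" and lin :: "real \<Rightarrow> 'v \<Rightarrow> real \<Rightarrow> 'v \<Rightarrow> 'v" and b :: "'v \<Rightarrow> 'v \<Rightarrow> real"
  assumes ne: "V \<noteq> {}"
    and lin: "\<And>x y r s. x \<in> V \<Longrightarrow> y \<in> V \<Longrightarrow> lin r x s y \<in> V"
    and b_lin: "\<And>x y z r s. x \<in> V \<Longrightarrow> y \<in> V \<Longrightarrow> z \<in> V \<Longrightarrow> b (lin r x s y) z = r * b x z + s * b y z"
    and b_sym: "\<And>x y. x \<in> V \<Longrightarrow> y \<in> V \<Longrightarrow> b x y = b y x"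
    and b_nonneg: "\<And>x. x \<in> V \<Longrightarrow> b x x \<ge> 0"
    and psi_lin: "\<And>x y r s. x \<in> V \<Longrightarrow> y \<in> V \<Longrightarrow> \<psi> (lin r x s y) = r * \<psi> x + s * \<psi> y"
    and psi_bound: "\<And>x. x \<in> V \<Longrightarrow> \<bar>\<psi> x\<bar> \<le> C * sqrt (b x x)"
    and complete: "\<And>X c. (\<And>n. X n \<in> V) \<Longrightarrow>
      (\<And>m n. n \<le> m \<Longrightarrow> b (lin 1 (X m) (-1) (X n)) (lin 1 (X m) (-1) (X n)) \<le> c * (1/4)^n) \<Longrightarrow>
      \<exists>x\<in>V. (\<lambda>n::nat. b (lin 1 (X n) (-1) x) (lin 1 (X n) (-1) x)) \<longlonglongrightarrow> 0"
  shows "\<exists>x0\<in>V. \<forall>x\<in>V. \<psi> x = b x0 x"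
proof -
  have b_lin2: "b z (lin r x s y) = r * b z x + s * b z y" if "x \<in> V" "y \<in> V" "z \<in> V" for x y z r s
    using b_lin[OF that, of r s] b_sym[OF lin[OF that(1,2)] that(3), of r s]
      b_sym[OF that(1,3)] b_sym[OF that(2,3)] by simp
  have b_quad: "b (lin r x s y) (lin r x s y) = r^2 * b x x + 2 * r * s * b x y + s^2 * b y y"
    if "x \<in> V" "y \<in> V" for x y r s
    using that b_sym[of x y]
    by (simp add: b_lin b_lin2 lin power2_eq_square algebra_simps)
  define J where "J x = b x x - 2 * \<psi> x" for x
  have J_quad: "J (lin r x s y) = r^2 * b x x + 2 * r * s * b x y + s^2 * b y y - 2 * (r * \<psi> x + s * \<psi> y)"
    if "x \<in> V" "y \<in> V" for x y r s
    using that by (simp add: J_def b_quad psi_lin)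
  have J_lower: "J x \<ge> - (C^2)" if "x \<in> V" for x
  proof -
    have "0 \<le> (sqrt (b x x) - C)^2" by simp
    also have "\<dots> = b x x - 2 * (C * sqrt (b x x)) + C^2"
      using b_nonneg[OF that] by (simp add: power2_diff)
    also have "\<dots> \<le> J x + C^2" using psi_bound[OF that] unfolding J_def by linarith
    finally show ?thesis by simp
  qed
  define d where "d = Inf (J ` V)"
  have bdd: "bdd_below (J ` V)" using J_lower by (auto intro!: bdd_belowI2)
  have d_le: "d \<le> J x" if "x \<in> V" for x
    unfolding d_def using bdd that by (rule cINF_lower)
  have "\<exists>x\<in>V. J x < d + (1/4)^n" for n :: nat
    using cINF_less_iff[OF ne bdd, of "d + (1/4)^n"] unfolding d_def by auto
  then obtain X where XV: "\<And>n. X n \<in> V" and X: "\<And>n. J (X n) < d + (1/4)^n" by metis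
  have cau: "b (lin 1 (X m) (-1) (X n)) (lin 1 (X m) (-1) (X n)) \<le> 4 * (1/4)^n" if "n \<le> m" for m n
  proof -
    have "d \<le> J (lin (1/2) (X m) (1/2) (X n))" using d_le lin XV by blast
    moreover define e f where "e = (1/4::real)^m" and "f = (1/4::real)^n"
    moreover have "e \<le> f" unfolding e_def f_def using that by (intro power_decreasing) auto
    moreover have "J (X m) < d + e" "J (X n) < d + f" using X by (auto simp: e_def f_def)
    ultimately show ?thesis
      unfolding J_quad[OF XV XV] b_quad[OF XV XV] f_def[symmetric] unfolding J_def
      by (simp add: power2_eq_square)
  qed
  obtain x where xV: "x \<in> V" and x: "(\<lambda>n. b (lin 1 (X n) (-1) x) (lin 1 (X n) (-1) x)) \<longlonglongrightarrow> 0"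
    using complete[OF XV cau] by blast
  have "\<psi> z = b x z" if zV: "z \<in> V" for z
  proof -
    let ?s = "b z z + 1"
    have s: "?s > 0" using b_nonneg[OF zV] by simp
    have "(b (X n) z - \<psi> z)^2 \<le> ?s * (1/4)^n" for n
    proof -
      let ?e = "b (X n) z - \<psi> z"
      have "d \<le> J (lin 1 (X n) (- ?e / ?s) z)" using d_le lin XV zV by blast
      also have "\<dots> = J (X n) - 2 * (?e^2 / ?s) + ?e^2 * b z z / ?s^2"
        unfolding J_quad[OF XV zV] unfolding J_def
        by (simp add: power2_eq_square algebra_simps add_divide_distrib diff_divide_distrib)
      also have "?e^2 * b z z / ?s^2 \<le> ?e^2 / ?s"
        using s b_nonneg[OF zV] by (simp add: power2_eq_square divide_simps mult_mono)
      finally have "?e^2 / ?s \<le> (1/4)^n" using X[of n] by linarith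
      then show ?thesis using s by (simp add: pos_divide_le_eq mult.commute)
    qed
    then have "(\<lambda>n. (b (X n) z - \<psi> z)^2) \<longlonglongrightarrow> 0"
      by (intro Lim_null_comparison[OF _ tendsto_mult_right_zero[OF LIMSEQ_power_zero[of "1/4::real"], of ?s]]) auto
    then have 1: "(\<lambda>n. b (X n) z - \<psi> z) \<longlonglongrightarrow> 0" by simp
    have "(b (X n) z - b x z)^2 \<le> ?s * b (lin 1 (X n) (-1) x) (lin 1 (X n) (-1) x)" for n
    proof -
      let ?y = "lin 1 (X n) (-1) x" let ?e = "b ?y z"
      have yV: "?y \<in> V" using lin XV xV by blast
      have "0 \<le> b (lin ?s ?y (-?e) z) (lin ?s ?y (-?e) z)" using b_nonneg lin yV zV by blast
      also have "\<dots> = ?s * (?s * b ?y ?y - ?e^2) - ?e^2"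
        unfolding b_quad[OF yV zV] by (simp add: power2_eq_square algebra_simps)
      finally have "0 \<le> ?s * (?s * b ?y ?y - ?e^2)" using zero_le_power2[of ?e] by linarith
      then have "?e^2 \<le> ?s * b ?y ?y" using s by (simp add: zero_le_mult_iff)
      then show ?thesis using b_lin[OF XV xV zV, where r = 1 and s = "-1"] by simp
    qed
    then have "(\<lambda>n. (b (X n) z - b x z)^2) \<longlonglongrightarrow> 0"
      by (intro Lim_null_comparison[OF _ tendsto_mult_right_zero[OF x, of ?s]]) auto
    then have "(\<lambda>n. b (X n) z - b x z) \<longlonglongrightarrow> 0" by simp
    from tendsto_diff[OF 1 this] have "(\<lambda>n::nat. b x z - \<psi> z) \<longlonglongrightarrow> 0" by simp
    then show ?thesis by (simp add: LIMSEQ_const_iff)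
  qed
  with xV show ?thesis by blast
qed

lemma convergent_of_geometric:
  fixes X :: "nat \<Rightarrow> 'h::banach"
  assumes "\<And>m n. n \<le> m \<Longrightarrow> (norm (X m - X n))^2 \<le> c * (1/4)^n"
  shows "convergent X"
proof -
  have "norm (X m - X n) \<le> sqrt c * (1/2)^n" if "n \<le> m" for m n
    using real_sqrt_le_mono[OF assms[OF that]]
    by (simp add: real_sqrt_mult real_sqrt_power real_sqrt_divide)
  moreover have "(\<lambda>n. sqrt c * (1/2)^n) \<longlonglongrightarrow> 0"
    by (intro tendsto_mult_right_zero LIMSEQ_power_zero) auto
  ultimately have "Cauchy X"
    unfolding Cauchy_altdef2 dist_norm
  proof (intro allI impI)
    fix e :: real assume "e > 0"
    then obtain N where "\<forall>n\<ge>N. norm (sqrt c * (1/2)^n - 0) < e"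
      using \<open>(\<lambda>n. sqrt c * (1/2)^n) \<longlonglongrightarrow> 0\<close> unfolding LIMSEQ_iff by blast
    then have N: "sqrt c * (1/2)^N < e" using abs_ge_self order_le_less_trans by fastforce
    have "norm (X n - X N) < e" if "n \<ge> N" for n
      using \<open>\<And>m n. n \<le> m \<Longrightarrow> norm (X m - X n) \<le> sqrt c * (1/2)^n\<close>[OF that] N by linarith
    then show "\<exists>N. \<forall>n\<ge>N. norm (X n - X N) < e" by blast
  qed
  then show ?thesis by (rule Cauchy_convergent)
qed

lemma riesz_hilbert:
  fixes \<psi> :: "'h::{real_inner, banach} \<Rightarrow> real"
  assumes "bounded_linear \<psi>"
  shows "\<exists>x0. \<forall>x. \<psi> x = inner x0 x"
proof -
  interpret bounded_linear \<psi> by fact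
  obtain C where "\<And>x. norm (\<psi> x) \<le> norm x * C" using bounded by blast
  then have C: "\<bar>\<psi> x\<bar> \<le> C * sqrt (inner x x)" for x
    by (simp add: norm_eq_sqrt_inner mult.commute)
  have "\<exists>x0\<in>UNIV. \<forall>x\<in>UNIV. \<psi> x = inner x0 x"
  proof (rule riesz_abstract[where lin = "\<lambda>r x s y. r *\<^sub>R x + s *\<^sub>R y" and C = C])
    fix X :: "nat \<Rightarrow> 'h" and c
    assume "\<And>m n. n \<le> m \<Longrightarrow> inner (1 *\<^sub>R X m + (-1) *\<^sub>R X n) (1 *\<^sub>R X m + (-1) *\<^sub>R X n) \<le> c * (1/4)^n"
    then have "(norm (X m - X n))^2 \<le> c * (1/4)^n" if "n \<le> m" for m n
      using that by (simp add: power2_norm_eq_inner)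
    then have "convergent X" by (rule convergent_of_geometric)
    then obtain x where x: "X \<longlonglongrightarrow> x" unfolding convergent_def by blast
    have "(\<lambda>n. inner (1 *\<^sub>R X n + (-1) *\<^sub>R x) (1 *\<^sub>R X n + (-1) *\<^sub>R x)) \<longlonglongrightarrow>
      inner (1 *\<^sub>R x + (-1) *\<^sub>R x) (1 *\<^sub>R x + (-1) *\<^sub>R x)"
      by (intro tendsto_intros x)
    then show "\<exists>x\<in>UNIV. (\<lambda>n. inner (1 *\<^sub>R X n + (-1) *\<^sub>R x) (1 *\<^sub>R X n + (-1) *\<^sub>R x)) \<longlonglongrightarrow> 0"
      by auto
  qed (use C in \<open>auto simp: inner_simps inner_commute add scaleR\<close>)
  then show ?thesis by simp
qed

text \<open>
  The iteration converges to \<open>1 - (1 - C)\<^sup>1\<^sup>/\<^sup>2\<close>. Its increments are dominated in norm by those of the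
  same iteration for the number \<open>1\<close> in place of \<open>C\<close>.
\<close>

primrec sqrt_iter :: "('h::real_normed_vector \<Rightarrow>\<^sub>L 'h) \<Rightarrow> nat \<Rightarrow> 'h \<Rightarrow>\<^sub>L 'h" where
  "sqrt_iter C 0 = 0"
| "sqrt_iter C (Suc n) = (1/2) *\<^sub>R (C + (sqrt_iter C n o\<^sub>L sqrt_iter C n))"

primrec sqrt_iter_bound :: "nat \<Rightarrow> real" where
  "sqrt_iter_bound 0 = 0"
| "sqrt_iter_bound (Suc n) = (1 + (sqrt_iter_bound n)^2) / 2"

lemma sqrt_iter_bound_range: "0 \<le> sqrt_iter_bound n" "sqrt_iter_bound n \<le> 1"
  by (induction n) (auto simp: power_le_one)

lemma sqrt_iter_bound_convergent: "convergent sqrt_iter_bound"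
proof -
  have "sqrt_iter_bound n \<le> sqrt_iter_bound (Suc n)" for n
    using zero_le_power2[of "sqrt_iter_bound n - 1"] by (simp add: power2_diff)
  then have "incseq sqrt_iter_bound" by (intro incseq_SucI)
  then show ?thesis using sqrt_iter_bound_range by (intro Bseq_mono_convergent BseqI'[of _ 1]) (auto dest: incseqD)
qed

lemma sqrt_iter_convergent:
  fixes C :: "'h::banach \<Rightarrow>\<^sub>L 'h"
  assumes C: "norm C \<le> 1"
  shows "convergent (sqrt_iter C)" and "norm (sqrt_iter C n) \<le> 1"
proof -
  let ?Y = "sqrt_iter C" and ?y = sqrt_iter_bound
  have comp: "norm (F o\<^sub>L G) \<le> f * g" if "norm F \<le> f" "norm G \<le> g" for F G :: "'h \<Rightarrow>\<^sub>L 'h" and f g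
    by (rule order_trans[OF norm_blinfun_compose])
      (intro mult_mono that norm_ge_zero order_trans[OF norm_ge_zero that(1)])
  have N: "norm (?Y n) \<le> ?y n" for n
  proof (induction n)
    case (Suc n)
    have "norm (C + (?Y n o\<^sub>L ?Y n)) \<le> 1 + (?y n)^2"
      using comp[OF Suc Suc] C by (intro norm_triangle_le) (simp add: power2_eq_square)
    then show ?case by simp
  qed simp
  then show "norm (?Y n) \<le> 1" using sqrt_iter_bound_range(2) order_trans by blast
  have D: "norm (?Y (Suc n) - ?Y n) \<le> ?y (Suc n) - ?y n" for n
  proof (induction n)
    case 0 then show ?case using C by simp
  next
    case (Suc n)
    let ?F = "?Y (Suc n)" and ?G = "?Y n" and ?f = "?y (Suc n)" and ?g = "?y n"
    have "(1/2) *\<^sub>R (C + (A o\<^sub>L A)) - (1/2) *\<^sub>R (C + (B o\<^sub>L B)) =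
        (1/2) *\<^sub>R ((A o\<^sub>L (A - B)) + ((A - B) o\<^sub>L B))" for A B
      by (intro blinfun_eqI) (simp add: blinfun.bilinear_simps scaleR_add_right scaleR_diff_right)
    from this[of ?F ?G] have "?Y (Suc (Suc n)) - ?F = (1/2) *\<^sub>R ((?F o\<^sub>L (?F - ?G)) + ((?F - ?G) o\<^sub>L ?G))"
      by (simp only: sqrt_iter.simps(2))
    then have "norm (?Y (Suc (Suc n)) - ?F) = (1/2) * norm ((?F o\<^sub>L (?F - ?G)) + ((?F - ?G) o\<^sub>L ?G))"
      by (simp del: sqrt_iter.simps)
    also have "\<dots> \<le> (1/2) * (?f * (?f - ?g) + (?f - ?g) * ?g)"
      by (intro mult_left_mono norm_triangle_le add_mono comp Suc N) auto
    also have "\<dots> = ?y (Suc (Suc n)) - ?f"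
      by (simp add: power2_eq_square algebra_simps)
    finally show ?case .
  qed
  have D': "norm (?Y m - ?Y n) \<le> ?y m - ?y n" if "n \<le> m" for m n
    using that
  proof (induction m rule: dec_induct)
    case (step m)
    have "norm (?Y (Suc m) - ?Y n) \<le> norm (?Y (Suc m) - ?Y m) + norm (?Y m - ?Y n)"
      by (metis diff_add_cancel add_diff_eq norm_triangle_ineq)
    then show ?case using D[of m] step by linarith
  qed simp
  have "Cauchy ?y" using sqrt_iter_bound_convergent by (simp add: Cauchy_convergent_iff)
  have "Cauchy ?Y"
    unfolding Cauchy_altdef2 dist_norm
  proof (intro allI impI)
    fix e :: real assume "e > 0"
    then obtain N where N: "\<forall>n\<ge>N. norm (?y n - ?y N) < e"
      using \<open>Cauchy ?y\<close> unfolding Cauchy_altdef2 dist_norm by blast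
    have "norm (?Y n - ?Y N) < e" if "n \<ge> N" for n
      using D'[OF that] N that by (metis abs_ge_self order_le_less_trans real_norm_def)
    then show "\<exists>N. \<forall>n\<ge>N. norm (?Y n - ?Y N) < e" by blast
  qed
  then show "convergent ?Y" by (rule Cauchy_convergent)
qed

definition symmetric_op :: "('h::real_inner \<Rightarrow>\<^sub>L 'h) \<Rightarrow> bool" where
  "symmetric_op F \<longleftrightarrow> (\<forall>x y. inner (F x) y = inner x (F y))"

lemma symmetric_op_sqrt_iter: "symmetric_op C \<Longrightarrow> symmetric_op (sqrt_iter C n)"
  by (induction n) (auto simp: symmetric_op_def blinfun.bilinear_simps inner_simps)

lemma commute_sqrt_iter:
  "Q o\<^sub>L C = C o\<^sub>L Q \<Longrightarrow> Q o\<^sub>L sqrt_iter C n = sqrt_iter C n o\<^sub>L Q"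
proof (induction n)
  case (Suc n)
  then have "Q (sqrt_iter C n x) = sqrt_iter C n (Q x)" "Q (C x) = C (Q x)" for x
    by (metis blinfun_apply_blinfun_compose)+
  then show ?case by (auto intro!: blinfun_eqI simp: blinfun.bilinear_simps)
qed (auto intro!: blinfun_eqI simp: blinfun.bilinear_simps)

lemma norm_sq_positive_op_le:
  fixes K :: "'h::real_inner \<Rightarrow>\<^sub>L 'h"
  assumes sym: "symmetric_op K" and pos: "\<And>x. inner (K x) x \<ge> 0" and n: "norm K \<le> c"
  shows "(norm (K x))^2 \<le> c * inner (K x) x"
proof (cases "c = 0")
  case True
  then have "K = 0" using n by simp
  then show ?thesis by simp
next
  case False
  then have c: "c > 0" using n norm_ge_zero[of K] by linarith
  define y where "y = K x"
  have "inner (K y) y \<le> norm (K y) * norm y" by (rule norm_cauchy_schwarz)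
  also have "\<dots> \<le> c * norm y * norm y"
    by (intro mult_right_mono order_trans[OF norm_blinfun]) (auto intro: n mult_right_mono)
  finally have Ky: "inner (K y) y \<le> c * (norm y)^2" by (simp add: power2_eq_square)
  have "0 \<le> inner (K (c *\<^sub>R x - y)) (c *\<^sub>R x - y)" by (rule pos)
  also have "\<dots> = c^2 * inner (K x) x - 2 * c * (norm y)^2 + inner (K y) y"
    using sym unfolding symmetric_op_def power2_norm_eq_inner
    by (simp add: blinfun.bilinear_simps inner_simps y_def[symmetric] power2_eq_square algebra_simps inner_commute)
      (simp add: y_def)
  also have "\<dots> \<le> c * (c * inner (K x) x - (norm y)^2)"
    using Ky by (simp add: power2_eq_square algebra_simps)
  finally show ?thesis using c by (simp add: zero_le_mult_iff y_def)
qed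

lemma contraction_id_minus:
  fixes K :: "'h::real_inner \<Rightarrow>\<^sub>L 'h"
  assumes "symmetric_op K" and "\<And>x. inner (K x) x \<ge> 0" and "norm K \<le> 1"
  shows "(norm (x - K x))^2 \<le> (norm x)^2 - (norm (K x))^2"
  using norm_sq_positive_op_le[OF assms, of x]
  by (simp add: power2_norm_eq_inner inner_simps inner_commute)

lemma sqrt_exists_contraction:
  fixes K :: "'h::{real_inner, banach} \<Rightarrow>\<^sub>L 'h"
  assumes K: "symmetric_op K" "\<And>x. inner (K x) x \<ge> 0" "norm K \<le> 1"
  shows "\<exists>R. symmetric_op R \<and> (\<forall>x. inner (R x) x \<ge> 0) \<and> R o\<^sub>L R = K \<and>
    (\<forall>Q. Q o\<^sub>L K = K o\<^sub>L Q \<longrightarrow> Q o\<^sub>L R = R o\<^sub>L Q)"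
proof -
  define C where "C = id_blinfun - K"
  have Cx: "C x = x - K x" for x by (simp add: C_def blinfun.bilinear_simps)
  have C: "symmetric_op C" using K(1) by (simp add: symmetric_op_def Cx inner_simps)
  have "norm (C x) \<le> norm x" for x
    using contraction_id_minus[OF K, of x] power2_le_imp_le[of "norm (C x)" "norm x"]
    by (smt (verit) Cx norm_ge_zero zero_le_power2)
  then have nC: "norm C \<le> 1" by (intro norm_blinfun_bound) auto
  obtain Y where Y: "sqrt_iter C \<longlonglongrightarrow> Y" using sqrt_iter_convergent[OF nC] unfolding convergent_def by blast
  have nY: "norm Y \<le> 1"
    using LIMSEQ_le_const2[OF tendsto_norm[OF Y]] sqrt_iter_convergent(2)[OF nC] by blast
  have Yx: "(\<lambda>n. sqrt_iter C n x) \<longlonglongrightarrow> Y x" for x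
    by (intro blinfun.tendsto Y tendsto_const)
  have "(\<lambda>n. sqrt_iter C (Suc n)) \<longlonglongrightarrow> (1/2) *\<^sub>R (C + (Y o\<^sub>L Y))"
    unfolding sqrt_iter.simps
    by (intro tendsto_intros bounded_bilinear.tendsto[OF bounded_bilinear_blinfun_compose] Y)
  then have fixp: "Y = (1/2) *\<^sub>R (C + (Y o\<^sub>L Y))"
    by (rule LIMSEQ_unique[OF LIMSEQ_Suc[OF Y]])
  have Yfix: "2 *\<^sub>R Y x = C x + Y (Y x)" for x
    by (subst fixp) (simp add: blinfun.bilinear_simps)
  have symY: "symmetric_op Y"
    unfolding symmetric_op_def
  proof (intro allI)
    fix x y
    have "(\<lambda>n. inner (sqrt_iter C n x) y) \<longlonglongrightarrow> inner (Y x) y" by (intro tendsto_intros Yx)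
    moreover have "(\<lambda>n. inner x (sqrt_iter C n y)) \<longlonglongrightarrow> inner x (Y y)" by (intro tendsto_intros Yx)
    ultimately show "inner (Y x) y = inner x (Y y)"
      using symmetric_op_sqrt_iter[OF C] LIMSEQ_unique unfolding symmetric_op_def by simp
  qed
  define R where "R = id_blinfun - Y"
  have Rx: "R x = x - Y x" for x by (simp add: R_def blinfun.bilinear_simps)
  have "symmetric_op R" using symY by (simp add: symmetric_op_def Rx inner_simps)
  moreover have "inner (R x) x \<ge> 0" for x
  proof -
    have "inner (Y x) x \<le> norm (Y x) * norm x" by (rule norm_cauchy_schwarz)
    also have "\<dots> \<le> (1 * norm x) * norm x"
      by (intro mult_right_mono order_trans[OF norm_blinfun]) (auto intro: mult_right_mono nY)
    finally show ?thesis by (simp add: Rx inner_simps power2_norm_eq_inner[symmetric] power2_eq_square)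
  qed
  moreover have "R o\<^sub>L R = K"
  proof (rule blinfun_eqI)
    fix x
    have "R (R x) = x - 2 *\<^sub>R Y x + Y (Y x)" by (simp add: Rx blinfun.bilinear_simps scaleR_2)
    also have "\<dots> = K x" unfolding Yfix by (simp add: Cx)
    finally show "(R o\<^sub>L R) x = K x" by simp
  qed
  moreover have "Q o\<^sub>L R = R o\<^sub>L Q" if "Q o\<^sub>L K = K o\<^sub>L Q" for Q
  proof -
    have "Q (K x) = K (Q x)" for x using that by (metis blinfun_apply_blinfun_compose)
    then have "Q o\<^sub>L C = C o\<^sub>L Q"
      by (intro blinfun_eqI) (simp add: Cx blinfun.bilinear_simps)
    then have "Q o\<^sub>L sqrt_iter C n = sqrt_iter C n o\<^sub>L Q" for n by (rule commute_sqrt_iter)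
    then have "(\<lambda>n. sqrt_iter C n o\<^sub>L Q) \<longlonglongrightarrow> (Q o\<^sub>L Y)"
      using bounded_bilinear.tendsto[OF bounded_bilinear_blinfun_compose tendsto_const Y, of Q] by simp
    moreover have "(\<lambda>n. sqrt_iter C n o\<^sub>L Q) \<longlonglongrightarrow> (Y o\<^sub>L Q)"
      by (rule bounded_bilinear.tendsto[OF bounded_bilinear_blinfun_compose Y tendsto_const])
    ultimately have "Q o\<^sub>L Y = Y o\<^sub>L Q" using LIMSEQ_unique by blast
    then have "Q (Y x) = Y (Q x)" for x by (metis blinfun_apply_blinfun_compose)
    then show ?thesis
      by (intro blinfun_eqI) (simp add: Rx blinfun.bilinear_simps)
  qed
  ultimately show ?thesis by blast
qed

lemma sqrt_exists:
  fixes K :: "'h::{real_inner, banach} \<Rightarrow>\<^sub>L 'h"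
  assumes K: "symmetric_op K" "\<And>x. inner (K x) x \<ge> 0"
  shows "\<exists>R. symmetric_op R \<and> (\<forall>x. inner (R x) x \<ge> 0) \<and> R o\<^sub>L R = K \<and>
    (\<forall>Q. Q o\<^sub>L K = K o\<^sub>L Q \<longrightarrow> Q o\<^sub>L R = R o\<^sub>L Q)"
proof -
  define c where "c = 1 / (norm K + 1)"
  have c: "c > 0" by (simp add: c_def add_nonneg_pos)
  have n: "norm (c *\<^sub>R K) \<le> 1" using c by (simp add: c_def divide_le_eq_1)
  have "symmetric_op (c *\<^sub>R K)" "inner ((c *\<^sub>R K) x) x \<ge> 0" for x
    using K c by (auto simp: symmetric_op_def blinfun.bilinear_simps)
  from sqrt_exists_contraction[OF this n]
  obtain R where R: "symmetric_op R" "\<And>x. inner (R x) x \<ge> 0" "R o\<^sub>L R = c *\<^sub>R K"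
    "\<And>Q. Q o\<^sub>L (c *\<^sub>R K) = (c *\<^sub>R K) o\<^sub>L Q \<Longrightarrow> Q o\<^sub>L R = R o\<^sub>L Q"
    by blast
  define S where "S = (1 / sqrt c) *\<^sub>R R"
  have "S o\<^sub>L S = (1 / c) *\<^sub>R (R o\<^sub>L R)"
    unfolding S_def by (intro blinfun_eqI) (use c in \<open>simp add: blinfun.bilinear_simps field_simps\<close>)
  then have "S o\<^sub>L S = K" using R(3) c by simp
  moreover have "Q o\<^sub>L S = S o\<^sub>L Q" if "Q o\<^sub>L K = K o\<^sub>L Q" for Q
  proof -
    have "Q (K x) = K (Q x)" for x using that by (metis blinfun_apply_blinfun_compose)
    then have "Q o\<^sub>L (c *\<^sub>R K) = (c *\<^sub>R K) o\<^sub>L Q" by (intro blinfun_eqI) (simp add: blinfun.bilinear_simps)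
    then have "Q (R x) = R (Q x)" for x using R(4) by (metis blinfun_apply_blinfun_compose)
    then show ?thesis by (intro blinfun_eqI) (simp add: S_def blinfun.bilinear_simps)
  qed
  moreover have "symmetric_op S" "inner (S x) x \<ge> 0" for x
    using R(1,2) c by (simp_all add: S_def symmetric_op_def blinfun.bilinear_simps)
  ultimately show ?thesis by blast
qed

section \<open>Self-adjoint isomorphisms and their square roots\<close>

locale selfadjoint_iso =
  fixes emb A :: "'p::{real_inner, banach} \<Rightarrow>\<^sub>L 'm::{real_inner, banach}"
    and a :: real
  assumes selfadjoint: "selfadjoint (op_in emb A)"
    and positive: "positive_op (op_in emb A)"
    and a_pos: "0 < a"
    and lower_bound: "\<And>w. a * norm w \<le> norm (A w)"
    and inj_emb: "inj emb"
    and dense_emb: "closure (range emb) = UNIV"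
begin

lemma symmetric: "inner (A w) (emb v) = inner (emb w) (A v)"
proof -
  have "(emb v, A v) \<in> adjoint_graph (op_in emb A)" "(emb w, A w) \<in> op_in emb A"
    using selfadjoint by (auto simp: selfadjoint_def op_in_def)
  then show ?thesis unfolding adjoint_graph_def by auto
qed

lemma nonneg: "inner (A w) (emb w) \<ge> 0"
  using positive by (auto simp: positive_op_def op_in_def)

lemma A_eq_0: "A w = 0 \<Longrightarrow> w = 0"
  using lower_bound[of w] a_pos by (simp add: mult_le_0_iff)

lemma orthogonal_range_A:
  assumes "\<And>w. inner (A w) z = 0"
  shows "z = 0"
proof -
  have "(z, 0) \<in> adjoint_graph (op_in emb A)"
    using assms by (auto simp: adjoint_graph_def op_in_def)
  then have "(z, 0) \<in> op_in emb A" using selfadjoint by (simp add: selfadjoint_def)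
  then obtain w where w: "z = emb w" "0 = A w" by (auto simp: op_in_def)
  then have "w = 0" using A_eq_0 by metis
  then show ?thesis using w by (simp add: blinfun.bilinear_simps)
qed

lemma surj_A: "\<exists>w. A w = h"
proof -
  have "\<exists>w0\<in>UNIV. \<forall>w\<in>UNIV. inner h (A w) = inner (A w0) (A w)"
  proof (rule riesz_abstract[where lin = "\<lambda>r x s y. r *\<^sub>R x + s *\<^sub>R y" and C = "norm h"])
    fix X :: "nat \<Rightarrow> 'p" and c
    assume "\<And>m n. n \<le> m \<Longrightarrow>
      inner (A (1 *\<^sub>R X m + (-1) *\<^sub>R X n)) (A (1 *\<^sub>R X m + (-1) *\<^sub>R X n)) \<le> c * (1/4)^n"
    then have X: "(norm (A (X m - X n)))^2 \<le> c * (1/4)^n" if "n \<le> m" for m n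
      using that by (simp add: power2_norm_eq_inner)
    have "(norm (X m - X n))^2 \<le> (c / a^2) * (1/4)^n" if "n \<le> m" for m n
    proof -
      have "(a * norm (X m - X n))^2 \<le> (norm (A (X m - X n)))^2"
        using lower_bound a_pos by (intro power_mono) auto
      from order_trans[OF this X[OF that]] show ?thesis
        using a_pos by (simp add: power_mult_distrib pos_le_divide_eq mult.commute)
    qed
    then have "convergent X" by (rule convergent_of_geometric)
    then obtain x where x: "X \<longlonglongrightarrow> x" unfolding convergent_def by blast
    have "(\<lambda>n. inner (A (1 *\<^sub>R X n + (-1) *\<^sub>R x)) (A (1 *\<^sub>R X n + (-1) *\<^sub>R x))) \<longlonglongrightarrow>
      inner (A (1 *\<^sub>R x + (-1) *\<^sub>R x)) (A (1 *\<^sub>R x + (-1) *\<^sub>R x))"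
      by (intro tendsto_intros x)
    then show "\<exists>x\<in>UNIV. (\<lambda>n. inner (A (1 *\<^sub>R X n + (-1) *\<^sub>R x)) (A (1 *\<^sub>R X n + (-1) *\<^sub>R x))) \<longlonglongrightarrow> 0"
      by (auto simp: blinfun.bilinear_simps)
  qed (auto simp: inner_simps inner_commute blinfun.bilinear_simps norm_eq_sqrt_inner[symmetric] Cauchy_Schwarz_ineq2)
  then obtain w0 where w0: "\<And>w. inner h (A w) = inner (A w0) (A w)" by auto
  then have "inner (A w) (A w0 - h) = 0" for w
    using w0[of w] by (simp add: inner_diff_right inner_commute)
  then have "A w0 - h = 0" by (rule orthogonal_range_A)
  then show ?thesis by auto
qed

lemma inj_A: "inj A"
proof (rule injI)
  fix v w assume "A v = A w"
  then have "A (v - w) = 0" by (simp add: blinfun.diff_right)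
  then show "v = w" using A_eq_0[of "v - w"] by simp
qed

definition Ainv :: "'m \<Rightarrow>\<^sub>L 'p" where
  "Ainv = Blinfun (inv A)"

lemma Ainv_apply: "Ainv h = inv A h"
proof -
  have s: "A (inv A h) = h" for h using surj_A by (metis f_inv_into_f rangeI)
  have "bounded_linear (inv A)"
  proof (rule bounded_linear_intro)
    show "inv A (x + y) = inv A x + inv A y" for x y
      by (rule injD[OF inj_A]) (simp add: s blinfun.bilinear_simps)
    show "inv A (r *\<^sub>R x) = r *\<^sub>R inv A x" for r x
      by (rule injD[OF inj_A]) (simp add: s blinfun.bilinear_simps)
    show "norm (inv A x) \<le> norm x * (1 / a)" for x
      using lower_bound[of "inv A x"] a_pos by (simp add: s pos_le_divide_eq mult.commute)
  qed
  then show ?thesis by (simp add: Ainv_def bounded_linear_Blinfun_apply)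
qed

lemma A_Ainv [simp]: "A (Ainv h) = h"
  using surj_A by (metis Ainv_apply f_inv_into_f rangeI)

lemma Ainv_A [simp]: "Ainv (A w) = w"
  by (rule injD[OF inj_A]) simp

definition K :: "'m \<Rightarrow>\<^sub>L 'm" where
  "K = emb o\<^sub>L Ainv"

lemma K_A [simp]: "K (A w) = emb w"
  by (simp add: K_def)

lemma emb_Ainv [simp]: "emb (Ainv h) = K h"
  by (simp add: K_def)

lemma K_symmetric: "symmetric_op K"
  unfolding symmetric_op_def using symmetric[of "Ainv _" "Ainv _"] by simp

lemma K_nonneg: "inner (K x) x \<ge> 0"
  using nonneg[of "Ainv x"] by (simp add: inner_commute)

lemma K_eq_0: "K h = 0 \<Longrightarrow> h = 0"
  using inj_emb by (metis A_Ainv blinfun.zero_right emb_Ainv injD)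

lemma inner_K_eq_0:
  assumes "inner (K h) h = 0"
  shows "h = 0"
  using norm_sq_positive_op_le[OF K_symmetric K_nonneg order_refl, of h] assms K_eq_0[of h] by simp

lemma range_K: "range K = range emb"
  by (metis (no_types, opaque_lifting) A_Ainv K_A emb_Ainv rangeE rangeI subsetI subset_antisym)

lemma op_in_eq: "op_in emb A = {(K h, h) | h. True}"
  unfolding op_in_def by (auto; metis A_Ainv K_A emb_Ainv)

definition R :: "'m \<Rightarrow>\<^sub>L 'm" where
  "R = (SOME R. symmetric_op R \<and> (\<forall>x. inner (R x) x \<ge> 0) \<and> R o\<^sub>L R = K \<and>
    (\<forall>Q. Q o\<^sub>L K = K o\<^sub>L Q \<longrightarrow> Q o\<^sub>L R = R o\<^sub>L Q))"

lemma R_props: "symmetric_op R \<and> (\<forall>x. inner (R x) x \<ge> 0) \<and> R o\<^sub>L R = K \<and>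
    (\<forall>Q. Q o\<^sub>L K = K o\<^sub>L Q \<longrightarrow> Q o\<^sub>L R = R o\<^sub>L Q)"
  unfolding R_def by (rule someI_ex[OF sqrt_exists[OF K_symmetric K_nonneg]])

lemma R_sym: "inner (R x) y = inner x (R y)"
  using R_props unfolding symmetric_op_def by blast

lemma R_nonneg: "inner (R x) x \<ge> 0"
  using R_props by blast

lemma R_R [simp]: "R (R x) = K x"
  using R_props by (metis blinfun_apply_blinfun_compose)

lemma R_commute:
  fixes Q :: "'m \<Rightarrow>\<^sub>L 'm"
  assumes "\<And>x. Q (K x) = K (Q x)"
  shows "Q (R x) = R (Q x)"
proof -
  have "Q o\<^sub>L K = K o\<^sub>L Q" using assms by (intro blinfun_eqI) simp
  then have "Q o\<^sub>L R = R o\<^sub>L Q" using R_props by blast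
  then show ?thesis by (metis blinfun_apply_blinfun_compose)
qed

lemma R_eq_0: "R h = 0 \<Longrightarrow> h = 0"
  by (rule K_eq_0) (metis R_R blinfun.zero_right)

lemma R_unique:
  assumes Q: "symmetric_op Q" "\<And>x. inner (Q x) x \<ge> 0" "\<And>x. Q (Q x) = K x"
  shows "Q = R"
proof (rule blinfun_eqI)
  fix x
  define y where "y = R x - Q x"
  have "Q (K z) = K (Q z)" for z by (simp add: Q(3)[symmetric])
  then have QR: "Q (R z) = R (Q z)" for z by (rule R_commute)
  have "R y + Q y = 0" by (simp add: y_def blinfun.bilinear_simps QR Q(3))
  then have "inner (R y) y + inner (Q y) y = 0" by (simp add: inner_add_left[symmetric])
  then have "inner (R y) y = 0" using R_nonneg[of y] Q(2)[of y] by linarith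
  then have "R y = 0"
    using norm_sq_positive_op_le[of R "norm R" y] R_props by simp
  then show "Q x = R x" using R_eq_0[of y] by (simp add: y_def)
qed

lemma selfadjoint_R_graph:
  "selfadjoint {(R h, h) | h. True} \<and> positive_op {(R h, h) | h. True} \<and>
    {(R h, h) | h. True} O {(R h, h) | h. True} = op_in emb A"
proof (intro conjI)
  let ?S = "{(R h, h) | h. True}"
  have "range K \<subseteq> Domain ?S" 
  proof
    fix y assume "y \<in> range K"
    then obtain x where "y = R (R x)" by auto
    then show "y \<in> Domain ?S" by blast
  qed
  from closure_mono[OF this] have "closure (Domain ?S) = UNIV"
    using dense_emb unfolding range_K by blast
  moreover have "adjoint_graph ?S = ?S"
  proof -
    have "(v, z) \<in> adjoint_graph ?S \<longleftrightarrow> v = R z" for v z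
    proof
      assume "(v, z) \<in> adjoint_graph ?S"
      then have "inner h (v - R z) = 0" for h
        by (auto simp: adjoint_graph_def inner_diff_right R_sym)
      from this[of "v - R z"] show "v = R z" by simp
    qed (auto simp: adjoint_graph_def R_sym)
    then show ?thesis by auto
  qed
  ultimately show "selfadjoint ?S" by (simp add: selfadjoint_def)
  show "positive_op ?S" using R_nonneg by (auto simp: positive_op_def inner_commute)
  show "?S O ?S = op_in emb A"
    unfolding op_in_eq relcomp_unfold by (auto simp del: R_R simp: R_R[symmetric])
qed

lemma sqrt_graph_unique:
  assumes S: "selfadjoint S" "positive_op S" "S O S = op_in emb A"
  shows "S = {(R h, h) | h. True}"
proof -
  have S_iff: "(v, z) \<in> S \<longleftrightarrow> (\<forall>(u, w)\<in>S. inner w v = inner u z)" for v z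
  proof -
    have "(v, z) \<in> S \<longleftrightarrow> (v, z) \<in> adjoint_graph S" using S(1) by (simp add: selfadjoint_def)
    then show ?thesis by (simp add: adjoint_graph_def)
  qed
  have S_lin: "(r *\<^sub>R v + s *\<^sub>R v', r *\<^sub>R z + s *\<^sub>R z') \<in> S" if "(v, z) \<in> S" "(v', z') \<in> S" for v z v' z' r s
    using that unfolding S_iff[of v z] S_iff[of v' z'] S_iff[of "_ + _"]
    by (fastforce simp: inner_simps)
  have ran: "\<exists>u. (u, h) \<in> S" for h
  proof -
    have "(K h, h) \<in> S O S" unfolding S(3) op_in_eq by blast
    then show ?thesis by blast
  qed
  then obtain q where q: "\<And>h. (q h, h) \<in> S" by metis
  have uniq: "u = q h" if "(u, h) \<in> S" for u h
  proof -
    have "(1 *\<^sub>R u + (-1) *\<^sub>R q h, 1 *\<^sub>R h + (-1) *\<^sub>R h) \<in> S" by (rule S_lin[OF that q])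
    then have "(u - q h, 0) \<in> S" by simp
    then have "inner z (u - q h) = 0" for z using q[of z] unfolding S_iff[of "u - q h"] by auto
    from this[of "u - q h"] show ?thesis by simp
  qed
  have q_sym: "inner (q x) y = inner x (q y)" for x y
    using q[of y] q[of x] unfolding S_iff[of "q y"] by auto
  have qq: "q (q h) = K h" for h
  proof -
    have "(q (q h), h) \<in> S O S" using q by blast
    then show ?thesis unfolding S(3) op_in_eq by auto
  qed
  have "bounded_linear q"
  proof (rule bounded_linear_intro)
    show "q (x + y) = q x + q y" for x y
      using S_lin[OF q q, of 1 x 1 y] uniq by fastforce
    show "q (r *\<^sub>R x) = r *\<^sub>R q x" for r x
      using S_lin[OF q q, of r x 0 x] uniq by fastforce
    show "norm (q x) \<le> norm x * sqrt (norm K)" for x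
    proof (rule power2_le_imp_le)
      have "(norm (q x))^2 = inner (K x) x"
        by (simp add: power2_norm_eq_inner q_sym qq inner_commute)
      also have "\<dots> \<le> norm (K x) * norm x" by (rule norm_cauchy_schwarz)
      also have "\<dots> \<le> (norm K * norm x) * norm x" by (intro mult_right_mono norm_blinfun) simp
      finally show "(norm (q x))^2 \<le> (norm x * sqrt (norm K))^2"
        by (simp add: power_mult_distrib power2_eq_square mult_ac)
    qed simp
  qed
  then have Q: "Blinfun q x = q x" for x by (simp add: bounded_linear_Blinfun_apply)
  have "Blinfun q = R"
  proof (rule R_unique)
    show "inner (Blinfun q x) x \<ge> 0" for x
      using S(2) q[of x] by (auto simp: positive_op_def Q inner_commute)
  qed (simp_all add: symmetric_op_def Q q_sym qq)
  then have "q = R" using Q by (metis ext)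
  then show ?thesis using q uniq by auto
qed

lemma sqrt_op_eq: "sqrt_op (op_in emb A) = {(R h, h) | h. True}"
  unfolding sqrt_op_def
  using selfadjoint_R_graph by (rule the_equality) (elim conjE, rule sqrt_graph_unique)

lemma op_apply_sqrt: "op_apply (sqrt_op (op_in emb A)) (R h) = h"
  unfolding op_apply_def sqrt_op_eq
proof (rule the_equality)
  fix v assume "(R h, v) \<in> {(R h, h) | h. True}"
  then have "R (h - v) = 0" by (simp add: blinfun.bilinear_simps)
  then show "v = h" using R_eq_0[of "h - v"] by simp
qed blast

text \<open>
  With \<open>C = 1 - scale K\<close>, the powers \<open>Cpow n = C\<^sup>n\<close> tend strongly to \<open>0\<close> and the partial sums \<open>An n\<close> of
  the Neumann series are bounded approximations of \<open>A\<close>, because \<open>K (An n x) = x - Cpow n x\<close>.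
\<close>

definition scale :: real where
  "scale = 1 / (norm K + 1)"

lemma scale_pos: "scale > 0"
  by (simp add: scale_def add_nonneg_pos)

primrec Cpow :: "nat \<Rightarrow> 'm \<Rightarrow>\<^sub>L 'm" where
  "Cpow 0 = id_blinfun"
| "Cpow (Suc n) = Cpow n - scale *\<^sub>R (K o\<^sub>L Cpow n)"

primrec An :: "nat \<Rightarrow> 'm \<Rightarrow>\<^sub>L 'm" where
  "An 0 = 0"
| "An (Suc n) = An n + scale *\<^sub>R Cpow n"

lemma Cpow_K: "Cpow n (K x) = K (Cpow n x)"
  by (induction n) (simp_all add: blinfun.bilinear_simps)

lemma An_K: "An n (K x) = K (An n x)"
  by (induction n) (simp_all add: blinfun.bilinear_simps Cpow_K)

lemma K_An: "K (An n x) = x - Cpow n x"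
  by (induction n) (simp_all add: blinfun.bilinear_simps)

lemma norm_Cpow_Suc: "(norm (Cpow (Suc n) x))^2 \<le> (norm (Cpow n x))^2 - (norm (scale *\<^sub>R K (Cpow n x)))^2"
proof -
  have "symmetric_op (scale *\<^sub>R K)" "inner ((scale *\<^sub>R K) y) y \<ge> 0" for y
    using K_symmetric K_nonneg[of y] scale_pos by (simp_all add: symmetric_op_def blinfun.bilinear_simps)
  moreover have "norm (scale *\<^sub>R K) \<le> 1"
    using scale_pos by (simp add: scale_def divide_le_eq_1)
  ultimately show ?thesis
    using contraction_id_minus[of "scale *\<^sub>R K" "Cpow n x"] by (simp add: blinfun.bilinear_simps)
qed

lemma norm_Cpow_le: "norm (Cpow n x) \<le> norm x"
proof (induction n)
  case (Suc n)
  have "(norm (Cpow (Suc n) x))^2 \<le> (norm (Cpow n x))^2"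
    using norm_Cpow_Suc[of n x] by (smt (verit) zero_le_power2)
  then have "norm (Cpow (Suc n) x) \<le> norm (Cpow n x)" by (rule power2_le_imp_le) simp
  with Suc show ?case by linarith
qed simp

lemma Cpow_K_tendsto: "(\<lambda>n. Cpow n (K x)) \<longlonglongrightarrow> 0"
proof -
  have "(\<Sum>i<n. (norm (scale *\<^sub>R K (Cpow i x)))^2) \<le> (norm x)^2 - (norm (Cpow n x))^2" for n
  proof (induction n)
    case (Suc n)
    then show ?case using norm_Cpow_Suc[of n x] by (simp del: Cpow.simps)
  qed simp
  then have "(\<Sum>i<n. (norm (scale *\<^sub>R K (Cpow i x)))^2) \<le> (norm x)^2" for n
    by (smt (verit) zero_le_power2)
  then have "summable (\<lambda>i. (norm (scale *\<^sub>R K (Cpow i x)))^2)"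
    by (intro summableI_nonneg_bounded) auto
  then have "(\<lambda>i. (norm (scale *\<^sub>R K (Cpow i x)))^2) \<longlonglongrightarrow> 0" by (rule summable_LIMSEQ_zero)
  then have "(\<lambda>i. scale *\<^sub>R K (Cpow i x)) \<longlonglongrightarrow> 0"
    by (simp only: tendsto_norm_zero_iff power_tendsto_0_iff zero_less_numeral)
  from tendsto_scaleR[OF tendsto_const[of "1/scale"] this] show ?thesis
    using scale_pos by (simp add: Cpow_K)
qed

text \<open>Strong convergence on the dense range of \<open>K\<close> extends to the whole space because the powers are contractions.\<close>

lemma Cpow_tendsto: "(\<lambda>n. Cpow n x) \<longlonglongrightarrow> 0"
proof (rule LIMSEQ_I)
  fix e :: real assume e: "e > 0"
  have "x \<in> closure (range K)" using dense_emb range_K by simp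
  then obtain y where y: "dist (K y) x < e / 2"
    using e unfolding closure_approachable by (metis half_gt_zero rangeE)
  obtain N where N: "\<And>n. n \<ge> N \<Longrightarrow> norm (Cpow n (K y)) < e / 2"
    using LIMSEQ_D[OF Cpow_K_tendsto, of "e / 2" y] e by auto
  have "norm (Cpow n x) < e" if "n \<ge> N" for n
  proof -
    have "norm (Cpow n x) \<le> norm (Cpow n (K y)) + norm (Cpow n (x - K y))"
      using norm_triangle_ineq[of "Cpow n (K y)" "Cpow n (x - K y)"] by (simp add: blinfun.bilinear_simps)
    also have "norm (Cpow n (x - K y)) \<le> norm (x - K y)" by (rule norm_Cpow_le)
    finally show ?thesis using N[OF that] y by (simp add: dist_norm norm_minus_commute)
  qed
  then show "\<exists>N. \<forall>n\<ge>N. norm (Cpow n x - 0) < e" by auto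
qed

definition D :: "nat \<Rightarrow> 'm \<Rightarrow>\<^sub>L 'm" where
  "D n = R o\<^sub>L An n"

lemma R_D: "R (D n x) = x - Cpow n x"
  by (simp add: D_def K_An)

lemma inner_D_diff:
  "inner ((D n - D m) (K p)) ((D n - D m) g) = inner (Cpow m p - Cpow n p) (Cpow m g - Cpow n g)"
proof -
  have "inner ((D n - D m) (K p)) ((D n - D m) g) = inner (R (An n (K p) - An m (K p))) (R (An n g - An m g))"
    by (simp add: D_def blinfun.bilinear_simps)
  also have "\<dots> = inner (An n (K p) - An m (K p)) (K (An n g - An m g))"
    by (simp add: R_sym)
  also have "\<dots> = inner (Cpow m p - Cpow n p) (Cpow m g - Cpow n g)"
    by (simp add: An_K K_An blinfun.diff_right)
  finally show ?thesis .
qed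

lemma inner_D: "inner (D n (K p)) (D n g) = inner (p - Cpow n p) (g - Cpow n g)"
proof -
  have "inner (D n (K p)) (D n g) = inner (An n (K p)) (K (An n g))"
    by (simp add: D_def R_sym)
  then show ?thesis by (simp add: An_K K_An)
qed

end

section \<open>Square-integrable functions\<close>

abbreviation I :: "real \<Rightarrow> real measure" where
  "I T \<equiv> lebesgue_on {0<..<T}"

lemma finite_measure_I: "finite_measure (I T)"
  by (rule finite_measure_lebesgue_on) auto

lemma pair_sigma_finite_I: "pair_sigma_finite (I T) (I T)"
  using finite_measure_I by (simp add: pair_sigma_finite_def finite_measure_def)

lemma measure_I: "0 \<le> T \<Longrightarrow> measure (I T) {0<..<T} = T"
  by (simp add: measure_restrict_space)

lemma borel_measurable_I_borel:
  assumes "f \<in> borel_measurable borel"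
  shows "f \<in> borel_measurable (I T)"
  using assms by (intro measurable_restrict_space1 measurable_completion) simp

lemma sets_I_borel [measurable]: "A \<in> sets borel \<Longrightarrow> {0<..<T} \<inter> A \<in> sets (I T)"
  by (subst sets_restrict_space) auto

lemma L2_spaceI:
  fixes f :: "real \<Rightarrow> 'a::real_normed_vector"
  assumes "f \<in> borel_measurable (I T)" "integrable (I T) h" "AE t in I T. (norm (f t))^2 \<le> h t"
  shows "f \<in> L2_space T"
  unfolding L2_space_def
proof (intro CollectI conjI)
  show "integrable (I T) (\<lambda>t. (norm (f t))^2)"
    using assms by (intro Bochner_Integration.integrable_bound[OF assms(2)]) (auto elim!: eventually_mono)
qed fact

lemma L2_spaceD:
  assumes "f \<in> L2_space T"
  shows "f \<in> borel_measurable (I T)" "integrable (I T) (\<lambda>t. (norm (f t))^2)"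
  using assms by (auto simp: L2_space_def)

lemma L2_imp_integrable:
  fixes f :: "real \<Rightarrow> 'a::{banach, second_countable_topology}"
  assumes "f \<in> L2_space T"
  shows "integrable (I T) f"
proof -
  interpret finite_measure "I T" by (rule finite_measure_I)
  have "norm z \<le> 1 + (norm z)^2" for z :: 'a
  proof -
    have "0 \<le> (norm z - 1)^2" "0 \<le> (norm z)^2" by simp_all
    then show ?thesis unfolding power2_diff by (simp del: zero_le_power2) (use zero_le_power2[of "norm z"] in linarith)
  qed
  then show ?thesis using L2_spaceD[OF assms]
    by (intro Bochner_Integration.integrable_bound[of "I T" "\<lambda>t. 1 + (norm (f t))^2" f]) auto
qed

lemma L2_const: "(\<lambda>t. w) \<in> L2_space T"
proof -
  interpret finite_measure "I T" by (rule finite_measure_I)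
  show ?thesis by (simp add: L2_space_def)
qed

lemma L2_bounded:
  assumes "f \<in> borel_measurable (I T)" "\<And>t. norm (f t) \<le> B"
  shows "f \<in> L2_space T"
proof -
  interpret finite_measure "I T" by (rule finite_measure_I)
  show ?thesis
    by (intro L2_spaceI[of f T "\<lambda>t. B^2"]) (auto intro!: AE_I2 power_mono assms)
qed

lemma L2_lin:
  fixes f g :: "real \<Rightarrow> 'a::{real_normed_vector, second_countable_topology}"
  assumes "f \<in> L2_space T" "g \<in> L2_space T"
  shows "(\<lambda>t. r *\<^sub>R f t + s *\<^sub>R g t) \<in> L2_space T"
proof (rule L2_spaceI)
  note [measurable] = L2_spaceD(1)[OF assms(1)] L2_spaceD(1)[OF assms(2)]
  show "(\<lambda>t. r *\<^sub>R f t + s *\<^sub>R g t) \<in> borel_measurable (I T)" by measurable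
  show "integrable (I T) (\<lambda>t. 2 * (r^2 * (norm (f t))^2) + 2 * (s^2 * (norm (g t))^2))"
    using assms by (intro Bochner_Integration.integrable_add integrable_mult_right) (auto simp: L2_space_def)
  show "AE t in I T. (norm (r *\<^sub>R f t + s *\<^sub>R g t))^2 \<le> 2 * (r^2 * (norm (f t))^2) + 2 * (s^2 * (norm (g t))^2)"
  proof (intro AE_I2)
    fix t
    have "(norm (r *\<^sub>R f t + s *\<^sub>R g t))^2 \<le> (\<bar>r\<bar> * norm (f t) + \<bar>s\<bar> * norm (g t))^2"
      using norm_triangle_ineq[of "r *\<^sub>R f t" "s *\<^sub>R g t"] by (intro power_mono) auto
    also have "\<dots> \<le> 2 * (\<bar>r\<bar> * norm (f t))^2 + 2 * (\<bar>s\<bar> * norm (g t))^2"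
      using sum_squares_bound[of "\<bar>r\<bar> * norm (f t)" "\<bar>s\<bar> * norm (g t)"] by (simp add: power2_sum)
    finally show "(norm (r *\<^sub>R f t + s *\<^sub>R g t))^2 \<le> 2 * (r^2 * (norm (f t))^2) + 2 * (s^2 * (norm (g t))^2)"
      by (simp add: power_mult_distrib)
  qed
qed

lemma L2_diff:
  fixes f g :: "real \<Rightarrow> 'a::{real_normed_vector, second_countable_topology}"
  assumes "f \<in> L2_space T" "g \<in> L2_space T"
  shows "(\<lambda>t. f t - g t) \<in> L2_space T"
  using L2_lin[OF assms, of 1 "-1"] by simp

lemma L2_blinfun:
  fixes F :: "'a::real_normed_vector \<Rightarrow>\<^sub>L 'b::real_normed_vector"
  assumes "f \<in> L2_space T"
  shows "(\<lambda>t. F (f t)) \<in> L2_space T"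
proof (rule L2_spaceI)
  show "(\<lambda>t. F (f t)) \<in> borel_measurable (I T)"
    by (rule measurable_compose[OF L2_spaceD(1)[OF assms] borel_measurable_continuous_onI])
      (intro continuous_intros)
  show "integrable (I T) (\<lambda>t. (norm F)^2 * (norm (f t))^2)" using L2_spaceD(2)[OF assms] by simp
  show "AE t in I T. (norm (F (f t)))^2 \<le> (norm F)^2 * (norm (f t))^2"
    using norm_blinfun[of F] by (auto simp: power_mult_distrib[symmetric] intro!: power_mono)
qed

lemma L2_inner:
  fixes f g :: "real \<Rightarrow> 'a::{real_inner, second_countable_topology}"
  assumes "f \<in> L2_space T" "g \<in> L2_space T"
  shows "integrable (I T) (\<lambda>t. inner (f t) (g t))"
proof (rule Bochner_Integration.integrable_bound[of _ "\<lambda>t. (norm (f t))^2 + (norm (g t))^2"])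
  show "integrable (I T) (\<lambda>t. (norm (f t))^2 + (norm (g t))^2)"
    using assms by (auto dest: L2_spaceD)
  show "(\<lambda>t. inner (f t) (g t)) \<in> borel_measurable (I T)"
    using assms[THEN L2_spaceD(1)] by measurable
  show "AE t in I T. norm (inner (f t) (g t)) \<le> norm ((norm (f t))^2 + (norm (g t))^2)"
  proof (intro AE_I2)
    fix t
    have "\<bar>inner (f t) (g t)\<bar> \<le> norm (f t) * norm (g t)" by (rule Cauchy_Schwarz_ineq2)
    also have "\<dots> \<le> (norm (f t))^2 + (norm (g t))^2"
      using sum_squares_bound[of "norm (f t)" "norm (g t)"] mult_nonneg_nonneg[OF norm_ge_zero norm_ge_zero, of "f t" "g t"]
      by linarith
    finally show "norm (inner (f t) (g t)) \<le> norm ((norm (f t))^2 + (norm (g t))^2)" by simp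
  qed
qed

lemma L2_norm_nonneg: "L2_norm T f \<ge> 0"
  by (simp add: L2_norm_def)

lemma L2_norm_sq: "(L2_norm T f)^2 = (\<integral>t. (norm (f t))^2 \<partial>I T)"
  by (simp add: L2_norm_def)

lemma L2_norm_cong:
  assumes "AE t in I T. norm (f t) = norm (g t)" "f \<in> borel_measurable (I T)" "g \<in> borel_measurable (I T)"
  shows "L2_norm T f = L2_norm T g"
  unfolding L2_norm_def using assms by (intro arg_cong[where f = sqrt] integral_cong_AE) auto

lemma L2_norm_eq_0:
  assumes "f \<in> L2_space T"
  shows "L2_norm T f = 0 \<longleftrightarrow> ae_zero T f"
proof -
  have "L2_norm T f = 0 \<longleftrightarrow> (\<integral>t. (norm (f t))^2 \<partial>I T) = 0" by (simp add: L2_norm_def)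
  also have "\<dots> \<longleftrightarrow> (AE t in I T. (norm (f t))^2 = 0)"
    by (rule integral_nonneg_eq_0_iff_AE) (use L2_spaceD[OF assms] in auto)
  finally show ?thesis by (simp add: ae_zero_def)
qed

lemma L2_cauchy_schwarz:
  fixes f g :: "real \<Rightarrow> 'a::{real_inner, second_countable_topology}"
  assumes f: "f \<in> L2_space T" and g: "g \<in> L2_space T"
  shows "\<bar>\<integral>t. inner (f t) (g t) \<partial>I T\<bar> \<le> L2_norm T f * L2_norm T g"
proof -
  define F G p where "F = (\<integral>t. (norm (f t))^2 \<partial>I T)" "G = (\<integral>t. (norm (g t))^2 \<partial>I T)"
    "p = (\<integral>t. inner (f t) (g t) \<partial>I T)"
  note defs = this
  have FG: "F \<ge> 0" "G \<ge> 0" unfolding defs by simp_all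
  have q: "0 \<le> s^2 * F + 2 * s * r * p + r^2 * G" for s r
  proof -
    have "0 \<le> (\<integral>t. (norm (s *\<^sub>R f t + r *\<^sub>R g t))^2 \<partial>I T)" by simp
    also have "\<dots> = (\<integral>t. s^2 * (norm (f t))^2 + 2 * s * r * inner (f t) (g t) + r^2 * (norm (g t))^2 \<partial>I T)"
      by (intro Bochner_Integration.integral_cong refl)
        (simp add: power2_norm_eq_inner inner_simps inner_commute, simp add: power2_eq_square algebra_simps inner_commute)
    also have "\<dots> = s^2 * F + 2 * s * r * p + r^2 * G"
      unfolding defs using L2_spaceD(2)[OF f] L2_spaceD(2)[OF g] L2_inner[OF f g] by simp
    finally show ?thesis .
  qed
  have "p^2 \<le> (F * G)"
  proof (cases "G = 0")
    case True
    have "p = 0"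
    proof (rule ccontr)
      assume "p \<noteq> 0"
      then show False using q[of 1 "- (F + 1) / (2 * p)"] True by (simp add: field_simps)
    qed
    then show ?thesis using FG by simp
  next
    case False
    then have "G > 0" using FG by simp
    have "G^2 * F + 2 * G * (- p) * p + (-p)^2 * G = G * (F * G - p^2)"
      by (simp add: power2_eq_square algebra_simps)
    with q[of G "-p"] have "0 \<le> G * (F * G - p^2)" by simp
    then show ?thesis using \<open>G > 0\<close> by (simp add: zero_le_mult_iff)
  qed
  then have "sqrt (p^2) \<le> sqrt (F * G)" by (rule real_sqrt_le_mono)
  then show ?thesis by (simp add: defs L2_norm_def real_sqrt_mult)
qed

lemma L2_complete:
  fixes X :: "nat \<Rightarrow> real \<Rightarrow> 'a::{banach, second_countable_topology}"
  assumes T: "0 \<le> T" and X: "\<And>n. X n \<in> L2_space T"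
    and cau: "\<And>m n. n \<le> m \<Longrightarrow> (\<integral>t. (norm (X m t - X n t))^2 \<partial>I T) \<le> c * (1/4)^n"
  shows "\<exists>x\<in>L2_space T. \<forall>n. (\<integral>t. (norm (X n t - x t))^2 \<partial>I T) \<le> c * (1/4)^n"
proof -
  interpret finite_measure "I T" by (rule finite_measure_I)
  note [measurable] = X[THEN L2_spaceD(1)]
  note XD = L2_spaceD(2)[OF L2_diff[OF X X]]
  note XI = L2_imp_integrable[OF L2_diff[OF X X]]
  have c: "c \<ge> 0" using order_trans[OF _ cau[of 0 0]] by simp
  have L1: "(\<integral>t. norm (X (Suc n) t - X n t) \<partial>I T) \<le> (c + T) / 2 * (1/2)^n" for n
  proof -
    have "norm z \<le> (2^n * (norm z)^2 + (1/2)^n) / 2" for z :: 'a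
    proof -
      have "0 \<le> (norm z * 2^n - 1)^2 * (1/2)^n" by simp
      also have "\<dots> = 2^n * (norm z)^2 + (1/2)^n - 2 * norm z"
        by (simp add: power2_eq_square field_simps)
      finally show ?thesis by simp
    qed
    then have "(\<integral>t. norm (X (Suc n) t - X n t) \<partial>I T) \<le>
        (\<integral>t. (2^n * (norm (X (Suc n) t - X n t))^2 + (1/2)^n) / 2 \<partial>I T)"
      using XD[of "Suc n" n] XI[of "Suc n" n] by (intro integral_mono) auto
    also have "\<dots> = (2^n * (\<integral>t. (norm (X (Suc n) t - X n t))^2 \<partial>I T) + T * (1/2)^n) / 2"
      using XD[of "Suc n" n] T by (simp add: measure_I)
    also have "\<dots> \<le> (2^n * (c * (1/4)^n) + T * (1/2)^n) / 2"
      using cau[of n "Suc n"] by (intro divide_right_mono add_right_mono mult_left_mono) auto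
    also have "\<dots> = (c + T) / 2 * (1/2)^n"
      by (simp add: power_divide field_simps power_mult_distrib[symmetric])
    finally show ?thesis .
  qed
  have "(\<integral>\<^sup>+t. (\<Sum>n. ennreal (norm (X (Suc n) t - X n t))) \<partial>I T) = (\<Sum>n. \<integral>\<^sup>+t. ennreal (norm (X (Suc n) t - X n t)) \<partial>I T)"
    by (rule nn_integral_suminf) measurable
  also have "\<dots> = (\<Sum>n. ennreal (\<integral>t. norm (X (Suc n) t - X n t) \<partial>I T))"
    using XI by (intro suminf_cong nn_integral_eq_integral) auto
  also have "\<dots> \<le> (\<Sum>n. ennreal ((c + T) / 2 * (1/2)^n))"
    using L1 by (intro suminf_le ennreal_leI) auto
  also have "\<dots> = ennreal (\<Sum>n. (c + T) / 2 * (1/2)^n)"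
    using c T by (intro suminf_ennreal2 summable_mult summable_geometric) auto
  also have "\<dots> < top" by simp
  finally have "(\<integral>\<^sup>+t. (\<Sum>n. ennreal (norm (X (Suc n) t - X n t))) \<partial>I T) \<noteq> \<infinity>" by simp
  then have "AE t in I T. (\<Sum>n. ennreal (norm (X (Suc n) t - X n t))) \<noteq> \<infinity>"
    by (intro nn_integral_noteq_infinite) measurable
  then have conv: "AE t in I T. convergent (\<lambda>n. X n t)"
  proof eventually_elim
    case (elim t)
    then have "summable (\<lambda>n. norm (X (Suc n) t - X n t))"
      by (intro summable_suminf_not_top) auto
    then have "summable (\<lambda>n. X (Suc n) t - X n t)" by (rule summable_norm_cancel)
    then have "convergent (\<lambda>n. \<Sum>i<n. X (Suc i) t - X i t)" by (simp add: summable_iff_convergent)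
    then have "convergent (\<lambda>n. X n t - X 0 t)" by (subst (asm) sum_lessThan_telescope)
    then have "convergent (\<lambda>n. (X n t - X 0 t) + X 0 t)" by (intro convergent_add convergent_const)
    then show ?case by simp
  qed
  define x where "x t = lim (\<lambda>n. X n t)" for t
  have x_meas [measurable]: "x \<in> borel_measurable (I T)" unfolding x_def by measurable
  have nn: "(\<integral>\<^sup>+t. ennreal ((norm (X n t - x t))^2) \<partial>I T) \<le> ennreal (c * (1/4)^n)" for n
  proof -
    have "(\<integral>\<^sup>+t. ennreal ((norm (X n t - x t))^2) \<partial>I T) =
        (\<integral>\<^sup>+t. liminf (\<lambda>m. ennreal ((norm (X m t - X n t))^2)) \<partial>I T)"
    proof (rule nn_integral_cong_AE, use conv in eventually_elim)
      case (elim t)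
      then have "(\<lambda>m. X m t) \<longlonglongrightarrow> x t" by (simp add: x_def convergent_LIMSEQ_iff)
      then have "(\<lambda>m. ennreal ((norm (X m t - X n t))^2)) \<longlonglongrightarrow> ennreal ((norm (x t - X n t))^2)"
        by (intro tendsto_intros)
      then show ?case
        by (subst lim_imp_Liminf[OF sequentially_bot]) (auto simp: norm_minus_commute)
    qed
    also have "\<dots> \<le> liminf (\<lambda>m. \<integral>\<^sup>+t. ennreal ((norm (X m t - X n t))^2) \<partial>I T)"
      by (rule nn_integral_liminf) measurable
    also have "\<dots> = liminf (\<lambda>m. ennreal (\<integral>t. (norm (X m t - X n t))^2 \<partial>I T))"
      using XD by (subst nn_integral_eq_integral) auto
    also have "\<dots> \<le> limsup (\<lambda>m. ennreal (\<integral>t. (norm (X m t - X n t))^2 \<partial>I T))"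
      by (rule Liminf_le_Limsup) simp
    also have "\<dots> \<le> ennreal (c * (1/4)^n)"
      using cau by (intro Limsup_bounded) (auto simp: eventually_sequentially intro!: exI[of _ n] ennreal_leI)
    finally show ?thesis .
  qed
  have Xx: "(\<lambda>t. X n t - x t) \<in> L2_space T" for n
    unfolding L2_space_def
  proof (intro CollectI conjI)
    show "integrable (I T) (\<lambda>t. (norm (X n t - x t))\<^sup>2)"
      using le_less_trans[OF nn[of n]] by (intro integrableI_bounded) auto
  qed measurable
  show ?thesis
  proof (intro bexI allI)
    show "x \<in> L2_space T" using L2_diff[OF X[of 0] Xx[of 0]] by simp
    show "(\<integral>t. (norm (X n t - x t))^2 \<partial>I T) \<le> c * (1/4)^n" for n
      using nn[of n] c nn_integral_eq_integral[OF L2_spaceD(2)[OF Xx[of n]]]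
      by (simp add: ennreal_le_iff)
  qed
qed

section \<open>Primitives and integration by parts\<close>

lemma AE_I_neq: "AE s in I T. s \<noteq> t"
proof -
  have "AE s in lebesgue. s \<noteq> t" using AE_lborel_singleton by (rule AE_completion)
  then show ?thesis by (subst AE_restrict_space_iff) auto
qed

definition prim :: "real \<Rightarrow> (real \<Rightarrow> 'a::{banach, second_countable_topology}) \<Rightarrow> real \<Rightarrow> 'a" where
  "prim T f t = (\<integral>s. indicat_real {..<t} s *\<^sub>R f s \<partial>I T)"

lemma borel_measurable_indicator_I [measurable]:
  "A \<in> sets borel \<Longrightarrow> indicat_real A \<in> borel_measurable (I T)"
  by (intro borel_measurable_I_borel borel_measurable_indicator)

lemma integrable_indicator_I:
  fixes f :: "real \<Rightarrow> 'a::{banach, second_countable_topology}"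
  assumes "integrable (I T) f" "A \<in> sets borel"
  shows "integrable (I T) (\<lambda>s. indicat_real A s *\<^sub>R f s)"
  using assms by (intro Bochner_Integration.integrable_bound[OF assms(1)])
    (auto intro!: borel_measurable_scaleR borel_measurable_indicator_I AE_I2 split: split_indicator)

lemma prim_lin:
  assumes "integrable (I T) f" "integrable (I T) g"
  shows "prim T (\<lambda>s. r *\<^sub>R f s + q *\<^sub>R g s) t = r *\<^sub>R prim T f t + q *\<^sub>R prim T g t"
proof -
  have "prim T (\<lambda>s. r *\<^sub>R f s + q *\<^sub>R g s) t =
      (\<integral>s. r *\<^sub>R (indicat_real {..<t} s *\<^sub>R f s) + q *\<^sub>R (indicat_real {..<t} s *\<^sub>R g s) \<partial>I T)"
    unfolding prim_def by (intro Bochner_Integration.integral_cong) (auto simp: algebra_simps)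
  also have "\<dots> = r *\<^sub>R prim T f t + q *\<^sub>R prim T g t"
    using integrable_indicator_I[OF assms(1), of "{..<t}"] integrable_indicator_I[OF assms(2), of "{..<t}"]
    unfolding prim_def by (simp del: scaleR_scaleR)
  finally show ?thesis .
qed

lemma prim_diff:
  assumes "integrable (I T) f" "integrable (I T) g"
  shows "prim T (\<lambda>s. f s - g s) t = prim T f t - prim T g t"
  using prim_lin[OF assms, of 1 "-1"] by simp

lemma prim_blinfun:
  fixes F :: "'a::{banach, second_countable_topology} \<Rightarrow>\<^sub>L 'b::{banach, second_countable_topology}"
  assumes "integrable (I T) f"
  shows "prim T (\<lambda>s. F (f s)) t = F (prim T f t)"
proof -
  have "F (prim T f t) = (\<integral>s. F (indicat_real {..<t} s *\<^sub>R f s) \<partial>I T)"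
    unfolding prim_def
    by (rule integral_bounded_linear[OF blinfun.bounded_linear_right, symmetric])
      (use integrable_indicator_I[OF assms] in auto)
  then show ?thesis by (simp add: prim_def blinfun.bilinear_simps)
qed

lemma prim_le_0: "t \<le> 0 \<Longrightarrow> prim T f t = 0"
  unfolding prim_def by (subst Bochner_Integration.integral_cong[of _ "I T" _ "\<lambda>s. 0"]) auto

lemma prim_ge_T: "t \<ge> T \<Longrightarrow> prim T f t = (\<integral>s. f s \<partial>I T)"
  unfolding prim_def by (intro Bochner_Integration.integral_cong) auto

lemma norm_prim_le:
  assumes "integrable (I T) f"
  shows "norm (prim T f t) \<le> (\<integral>s. norm (f s) \<partial>I T)"
proof -
  have "norm (prim T f t) \<le> (\<integral>s. norm (indicat_real {..<t} s *\<^sub>R f s) \<partial>I T)"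
    unfolding prim_def by (rule integral_norm_bound)
  also have "\<dots> \<le> (\<integral>s. norm (f s) \<partial>I T)"
    using integrable_norm[OF integrable_indicator_I[OF assms, of "{..<t}"]] integrable_norm[OF assms]
    by (intro integral_mono) (auto simp: indicator_def)
  finally show ?thesis .
qed

lemma norm_prim_sq_le:
  assumes "0 \<le> T" "f \<in> L2_space T"
  shows "(norm (prim T f t))^2 \<le> T * (\<integral>s. (norm (f s))^2 \<partial>I T)"
proof -
  have nf: "(\<lambda>s. norm (f s)) \<in> L2_space T"
    using L2_spaceD[OF assms(2)] by (simp add: L2_space_def)
  have "norm (prim T f t) \<le> (\<integral>s. norm (f s) \<partial>I T)"
    by (rule norm_prim_le[OF L2_imp_integrable[OF assms(2)]])
  also have "\<dots> \<le> L2_norm T (\<lambda>s. norm (f s)) * L2_norm T (\<lambda>s. 1 :: real)"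
    using L2_cauchy_schwarz[OF nf L2_const[of "1::real"]] by simp
  finally have "(norm (prim T f t))^2 \<le> (L2_norm T (\<lambda>s. norm (f s)) * L2_norm T (\<lambda>s. 1 :: real))^2"
    by (rule power_mono) simp
  also have "\<dots> = T * (\<integral>s. (norm (f s))^2 \<partial>I T)"
    using assms(1) by (simp add: power_mult_distrib L2_norm_sq measure_I)
  finally show ?thesis .
qed

lemma continuous_prim:
  assumes "integrable (I T) f"
  shows "continuous_on S (prim T f)"
proof -
  have "isCont (prim T f) t" for t
    unfolding continuous_at_sequentially
  proof (intro allI impI)
    fix u assume u: "u \<longlonglongrightarrow> t"
    have "(\<lambda>n. prim T f (u n)) \<longlonglongrightarrow> prim T f t"
      unfolding prim_def
    proof (rule integral_dominated_convergence[where w = "\<lambda>s. norm (f s)"])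
      show "AE s in I T. (\<lambda>n. indicat_real {..<u n} s *\<^sub>R f s) \<longlonglongrightarrow> indicat_real {..<t} s *\<^sub>R f s"
        using AE_I_neq[of t T]
      proof eventually_elim
        case (elim s)
        have "eventually (\<lambda>n. indicat_real {..<u n} s = indicat_real {..<t} s) sequentially"
        proof (cases "s < t")
          case True
          from order_tendstoD(1)[OF u this] show ?thesis by eventually_elim (use True in auto)
        next
          case False
          then have "t < s" using elim by simp
          from order_tendstoD(2)[OF u this] show ?thesis by eventually_elim (use \<open>t < s\<close> in auto)
        qed
        then have "(\<lambda>n. indicat_real {..<u n} s) \<longlonglongrightarrow> indicat_real {..<t} s" by (rule tendsto_eventually)
        then show ?case by (intro tendsto_intros)
      qed
      show "AE s in I T. norm (indicat_real {..<u n} s *\<^sub>R f s) \<le> norm (f s)" for n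
        by (auto simp: indicator_def)
    qed (use assms in \<open>auto intro!: borel_measurable_scaleR borel_measurable_indicator_I\<close>)
    then show "(prim T f \<circ> u) \<longlonglongrightarrow> prim T f t" by (simp add: o_def)
  qed
  then show ?thesis by (simp add: continuous_at_imp_continuous_on)
qed

lemma borel_measurable_prim [measurable]:
  assumes "integrable (I T) f"
  shows "prim T f \<in> borel_measurable (I T)"
  by (rule borel_measurable_I_borel[OF borel_measurable_continuous_onI[OF continuous_prim[OF assms]]])

lemma L2_prim:
  assumes "integrable (I T) f"
  shows "prim T f \<in> L2_space T"
  by (rule L2_bounded[OF borel_measurable_prim[OF assms] norm_prim_le[OF assms]])

text \<open>Both terms are double integrals, over the two halves of the square \<open>(0,T)\<^sup>2\<close>.\<close>

lemma integration_by_parts: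
  fixes prod :: "'a::{banach, second_countable_topology} \<Rightarrow> 'b::{banach, second_countable_topology} \<Rightarrow>
    'c::{banach, second_countable_topology}"
  assumes bil: "bounded_bilinear prod" and f: "integrable (I T) f" and g: "integrable (I T) g"
  shows "(\<integral>t. prod (f t) (prim T g t) \<partial>I T) + (\<integral>t. prod (prim T f t) (g t) \<partial>I T) =
    prod (\<integral>t. f t \<partial>I T) (\<integral>t. g t \<partial>I T)"
proof -
  interpret bounded_bilinear prod by fact
  interpret P: pair_sigma_finite "I T" "I T" by (rule pair_sigma_finite_I)
  obtain B where B: "\<And>a b. norm (prod a b) \<le> norm a * norm b * B" using bounded by blast
  have [measurable]: "f \<in> borel_measurable (I T)" "g \<in> borel_measurable (I T)" using f g by auto
  have fst_meas [measurable]: "(\<lambda>x. f (fst x)) \<in> borel_measurable (I T \<Otimes>\<^sub>M I T)"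
    and snd_meas [measurable]: "(\<lambda>x. g (snd x)) \<in> borel_measurable (I T \<Otimes>\<^sub>M I T)" by measurable
  have id_meas [measurable]: "(\<lambda>x. x) \<in> borel_measurable (I T)" by (rule borel_measurable_I_borel) simp
  have H_meas [measurable]: "(\<lambda>x. prod (f (fst x)) (g (snd x))) \<in> borel_measurable (I T \<Otimes>\<^sub>M I T)"
    by (rule borel_measurable_continuous_Pair[OF fst_meas snd_meas]) (intro continuous_on continuous_intros)
  have nint: "integrable (I T \<Otimes>\<^sub>M I T) (\<lambda>x. norm (f (fst x)) * norm (g (snd x)))"
    by (rule P.Fubini_integrable) (use f g in \<open>auto simp: norm_mult\<close>)
  have H: "integrable (I T \<Otimes>\<^sub>M I T) (\<lambda>x. prod (f (fst x)) (g (snd x)))"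
  proof (rule Bochner_Integration.integrable_bound[OF integrable_mult_left[OF nint, of B] H_meas], intro AE_I2)
    fix x :: "real \<times> real"
    show "norm (prod (f (fst x)) (g (snd x))) \<le> norm (norm (f (fst x)) * norm (g (snd x)) * B)"
      using B[of "f (fst x)" "g (snd x)"] by (simp add: abs_if)
  qed
  have H1: "integrable (I T \<Otimes>\<^sub>M I T) (\<lambda>(s, t). indicat_real {..<t} s *\<^sub>R prod (f s) (g t))"
    (is "integrable _ ?H1")
  proof (rule Bochner_Integration.integrable_bound[OF H])
    have "(\<lambda>x. indicat_real {x. fst x < snd x} x *\<^sub>R prod (f (fst x)) (g (snd x))) \<in> borel_measurable (I T \<Otimes>\<^sub>M I T)"
      by measurable
    also have "(\<lambda>x. indicat_real {x. fst x < snd x} x *\<^sub>R prod (f (fst x)) (g (snd x))) = ?H1"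
      by (auto simp: fun_eq_iff indicator_def)
    finally show "?H1 \<in> borel_measurable (I T \<Otimes>\<^sub>M I T)" .
  qed (auto simp: indicator_def)
  have pull: "prod a (\<integral>t. h t \<partial>I T) = (\<integral>t. prod a (h t) \<partial>I T)" if "integrable (I T) h" for a h
    by (rule integral_bounded_linear[OF bounded_linear_right that, symmetric])
  have pull': "prod (\<integral>t. h t \<partial>I T) b = (\<integral>t. prod (h t) b \<partial>I T)" if "integrable (I T) h" for b h
    by (rule integral_bounded_linear[OF bounded_linear_left that, symmetric])
  have bint: "integrable (I T) (\<lambda>t. prod a (h t))" if "integrable (I T) h" for a h
    by (rule integrable_bounded_linear[OF bounded_linear_right that])
  have "(\<integral>t. prod (prim T f t) (g t) \<partial>I T) = (\<integral>t. (\<integral>s. indicat_real {..<t} s *\<^sub>R prod (f s) (g t) \<partial>I T) \<partial>I T)"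
    unfolding prim_def by (simp add: pull'[OF integrable_indicator_I[OF f]] scaleR_left)
  also have "\<dots> = (\<integral>s. (\<integral>t. indicat_real {..<t} s *\<^sub>R prod (f s) (g t) \<partial>I T) \<partial>I T)"
    by (rule P.Fubini_integral[OF H1])
  also have "\<dots> = (\<integral>s. (\<integral>t. prod (f s) (g t) \<partial>I T) - prod (f s) (prim T g s) \<partial>I T)"
  proof (rule Bochner_Integration.integral_cong[OF refl])
    fix s
    have "(\<integral>t. indicat_real {..<t} s *\<^sub>R prod (f s) (g t) \<partial>I T) =
      (\<integral>t. prod (f s) (g t) - indicat_real {..<s} t *\<^sub>R prod (f s) (g t) \<partial>I T)"
    proof (rule integral_cong_AE)
      show "AE t in I T. indicat_real {..<t} s *\<^sub>R prod (f s) (g t) =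
          prod (f s) (g t) - indicat_real {..<s} t *\<^sub>R prod (f s) (g t)"
        using AE_I_neq[of s T] by eventually_elim (auto simp: indicator_def)
      have m: "(\<lambda>t. prod (f s) (g t)) \<in> borel_measurable (I T)" using bint[OF g] by auto
      have "(\<lambda>t. indicat_real {s<..} t *\<^sub>R prod (f s) (g t)) \<in> borel_measurable (I T)"
        using m by measurable
      also have "(\<lambda>t. indicat_real {s<..} t *\<^sub>R prod (f s) (g t)) = (\<lambda>t. indicat_real {..<t} s *\<^sub>R prod (f s) (g t))"
        by (auto simp: indicator_def fun_eq_iff)
      finally show "(\<lambda>t. indicat_real {..<t} s *\<^sub>R prod (f s) (g t)) \<in> borel_measurable (I T)" .
      show "(\<lambda>t. prod (f s) (g t) - indicat_real {..<s} t *\<^sub>R prod (f s) (g t)) \<in> borel_measurable (I T)"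
        using m by measurable
    qed
    also have "\<dots> = (\<integral>t. prod (f s) (g t) \<partial>I T) - (\<integral>t. indicat_real {..<s} t *\<^sub>R prod (f s) (g t) \<partial>I T)"
      using bint[OF g] by (intro Bochner_Integration.integral_diff integrable_indicator_I) auto
    also have "(\<integral>t. indicat_real {..<s} t *\<^sub>R prod (f s) (g t) \<partial>I T) = prod (f s) (prim T g s)"
      unfolding prim_def by (simp add: pull[OF integrable_indicator_I[OF g]] scaleR_right)
    finally show "(\<integral>t. indicat_real {..<t} s *\<^sub>R prod (f s) (g t) \<partial>I T) =
      (\<integral>t. prod (f s) (g t) \<partial>I T) - prod (f s) (prim T g s)" .
  qed
  also have "\<dots> = (\<integral>s. prod (f s) (\<integral>t. g t \<partial>I T) - prod (f s) (prim T g s) \<partial>I T)"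
    by (simp add: pull[OF g])
  also have "\<dots> = (\<integral>s. prod (f s) (\<integral>t. g t \<partial>I T) \<partial>I T) - (\<integral>s. prod (f s) (prim T g s) \<partial>I T)"
  proof (rule Bochner_Integration.integral_diff)
    show "integrable (I T) (\<lambda>s. prod (f s) (\<integral>t. g t \<partial>I T))"
      by (rule integrable_bounded_linear[OF bounded_linear_left f])
    have pm: "prim T g \<in> borel_measurable (I T)" by (rule borel_measurable_prim[OF g])
    show "integrable (I T) (\<lambda>s. prod (f s) (prim T g s))"
    proof (rule Bochner_Integration.integrable_bound)
      show "integrable (I T) (\<lambda>s. norm (f s) * ((\<integral>t. norm (g t) \<partial>I T) * \<bar>B\<bar>))" using f by simp
      show "(\<lambda>s. prod (f s) (prim T g s)) \<in> borel_measurable (I T)"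
        by (rule borel_measurable_continuous_Pair[OF _ pm]) (measurable, intro continuous_on continuous_intros)
      show "AE s in I T. norm (prod (f s) (prim T g s)) \<le> norm (norm (f s) * ((\<integral>t. norm (g t) \<partial>I T) * \<bar>B\<bar>))"
      proof (intro AE_I2)
        fix s
        have "norm (prod (f s) (prim T g s)) \<le> norm (f s) * norm (prim T g s) * B" by (rule B)
        also have "\<dots> \<le> norm (f s) * (norm (prim T g s) * \<bar>B\<bar>)"
          by (simp add: mult.assoc mult_left_mono)
        also have "\<dots> \<le> norm (f s) * ((\<integral>t. norm (g t) \<partial>I T) * \<bar>B\<bar>)"
          by (intro mult_left_mono mult_right_mono norm_prim_le g) auto
        also have "\<dots> \<le> norm (norm (f s) * ((\<integral>t. norm (g t) \<partial>I T) * \<bar>B\<bar>))" by simp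
        finally show "norm (prod (f s) (prim T g s)) \<le> norm (norm (f s) * ((\<integral>t. norm (g t) \<partial>I T) * \<bar>B\<bar>))" .
      qed
    qed
  qed
  also have "(\<integral>s. prod (f s) (\<integral>t. g t \<partial>I T) \<partial>I T) = prod (\<integral>t. f t \<partial>I T) (\<integral>t. g t \<partial>I T)"
    by (rule pull'[OF f, symmetric])
  finally show ?thesis by simp
qed

lemma inner_prim_self:
  fixes f :: "real \<Rightarrow> 'a::{real_inner, banach, second_countable_topology}"
  assumes "integrable (I T) f"
  shows "2 * (\<integral>t. inner (f t) (prim T f t) \<partial>I T) = (norm (\<integral>t. f t \<partial>I T))^2"
  using integration_by_parts[OF bounded_bilinear_inner assms assms]
  by (simp add: inner_commute[of "prim T f _"] power2_norm_eq_inner)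

lemma prim_eq_0_imp_AE_0:
  assumes f: "integrable (I T) f" and p: "\<And>t. 0 < t \<Longrightarrow> t \<le> T \<Longrightarrow> prim T f t = 0"
  shows "AE t in I T. f t = 0"
proof (cases "0 < T")
  case False
  then show ?thesis by (intro AE_I2) auto
next
  case True
  let ?\<mu> = "\<lambda>B. set_lebesgue_integral (I T) ({0<..<T} \<inter> B) f"
  have set_int: "set_integrable (I T) A f" if "A \<in> sets (I T)" for A
    unfolding set_integrable_def using that f by (rule integrable_mult_indicator)
  have total: "(\<integral>t. f t \<partial>I T) = 0" using p[of T] True prim_ge_T[of T T f] by simp
  have all: "set_lebesgue_integral (I T) {0<..<T} f = 0"
    using total set_integral_space[OF f] by simp
  have Int_stable_lessThan: "Int_stable (range (lessThan :: real \<Rightarrow> real set))"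
    unfolding Int_stable_def
  proof (intro ballI)
    fix A B :: "real set" assume "A \<in> range lessThan" "B \<in> range lessThan"
    then obtain a b where "A = {..<a}" "B = {..<b}" by auto
    then have "A \<inter> B = {..<min a b}" by auto
    then show "A \<inter> B \<in> range lessThan" by blast
  qed
  have subset_Pow: "range (lessThan :: real \<Rightarrow> real set) \<subseteq> Pow UNIV" by simp
  have "?\<mu> B = 0" if "B \<in> sigma_sets UNIV (range lessThan)" for B :: "real set"
    using Int_stable_lessThan subset_Pow that
  proof (induction rule: sigma_sets_induct_disjoint)
    case (basic A)
    then obtain t where A: "A = {..<t}" by auto
    have "?\<mu> A = prim T f t"
      unfolding set_lebesgue_integral_def prim_def A
      by (intro Bochner_Integration.integral_cong) (auto simp: indicator_def)
    also have "\<dots> = 0"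
      using p[of t] prim_le_0[of t T f] prim_ge_T[of T t f] total by (metis linorder_linear linorder_not_le)
    finally show ?case .
  next
    case empty
    show ?case by (simp add: set_lebesgue_integral_def)
  next
    case (compl A)
    then have "A \<in> sets borel" by (simp add: borel_Iio)
    then have s: "{0<..<T} \<inter> A \<in> sets (I T)" "{0<..<T} \<inter> - A \<in> sets (I T)"
      by (auto intro!: sets_I_borel)
    have "set_lebesgue_integral (I T) (({0<..<T} \<inter> A) \<union> ({0<..<T} \<inter> - A)) f = ?\<mu> A + ?\<mu> (- A)"
      by (rule set_integral_Un) (use s set_int in auto)
    moreover have "({0<..<T} \<inter> A) \<union> ({0<..<T} \<inter> - A) = {0<..<T}" by auto
    ultimately show ?case using compl all by (simp add: Compl_eq_Diff_UNIV)
  next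
    case (union A)
    then have s: "{0<..<T} \<inter> A i \<in> sets (I T)" for i
      by (intro sets_I_borel) (auto simp: borel_Iio)
    then have "(\<Union>i. {0<..<T} \<inter> A i) \<in> sets (I T)" by blast
    have "?\<mu> (\<Union>i. A i) = set_lebesgue_integral (I T) (\<Union>i. {0<..<T} \<inter> A i) f" by simp
    also have "\<dots> = (\<Sum>i. ?\<mu> (A i))"
      using union(1) s set_int[OF \<open>(\<Union>i. {0<..<T} \<inter> A i) \<in> sets (I T)\<close>]
      by (intro lebesgue_integral_countable_add) (auto simp: disjoint_family_on_def)
    also have "\<dots> = 0" using union by simp
    finally show ?case .
  qed
  then have borel: "?\<mu> B = 0" if "B \<in> sets borel" for B
    using that by (simp add: borel_Iio)
  show ?thesis
  proof (rule finite_measure.sigma_finite_measure[OF finite_measure_I, THEN sigma_finite_measure.density_zero, OF f])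
    fix A assume "A \<in> sets (I T)"
    then obtain A' where A': "A' \<in> sets lebesgue" "A = {0<..<T} \<inter> A'" by (auto simp: sets_restrict_space)
    obtain N where N: "N \<in> null_sets lborel" "null_part lborel A' \<subseteq> N" using null_part[OF A'(1)] by blast
    let ?B = "main_part lborel A'"
    have B: "?B \<in> sets borel" using main_part_sets[OF A'(1)] by simp
    have "AE t in lebesgue. t \<notin> N" using AE_not_in[OF N(1)] by (rule AE_completion)
    then have "AE t in I T. t \<notin> N" by (subst AE_restrict_space_iff) auto
    then have "AE t in I T. t \<in> A \<longleftrightarrow> t \<in> {0<..<T} \<inter> ?B"
    proof eventually_elim
      case (elim t)
      then show ?case using A'(2) N(2) main_part_null_part_Un[OF A'(1)] by auto
    qed
    then have "set_lebesgue_integral (I T) A f = ?\<mu> ?B"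
      unfolding set_lebesgue_integral_def
      using integrable_mult_indicator[OF \<open>A \<in> sets (I T)\<close> f] integrable_mult_indicator[OF sets_I_borel[OF B] f]
      by (intro integral_cong_AE) (auto simp: indicator_def elim!: eventually_mono)
    then show "set_lebesgue_integral (I T) A f = 0" using borel[OF B] by simp
  qed
qed

section \<open>Weak derivatives on an interval\<close>

definition bump_e :: "real \<Rightarrow> nat \<Rightarrow> real \<Rightarrow> real" where
  "bump_e c k s = (if s > 0 then (1 / s)^k * exp (- c / s) else 0)"

lemma bump_e_deriv:
  assumes c: "c > 0"
  shows "(bump_e c k has_real_derivative (c * bump_e c (k + 2) s - k * bump_e c (k + 1) s)) (at s)"
proof -
  consider "s > 0" | "s < 0" | "s = 0" by linarith
  then show ?thesis
  proof cases
    case 1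
    have "((\<lambda>s. (1 / s)^k * exp (- c / s)) has_real_derivative (c * bump_e c (k + 2) s - k * bump_e c (k + 1) s)) (at s)"
      using 1 by (cases k; auto intro!: derivative_eq_intros simp: bump_e_def field_simps power2_eq_square)
        (metis One_nat_def power_eq_if)
    then show ?thesis
      by (rule has_field_derivative_transform_within_open[of _ _ _ "{0<..}"]) (use 1 in \<open>auto simp: bump_e_def\<close>)
  next
    case 2
    have "((\<lambda>s. 0) has_real_derivative (c * bump_e c (k + 2) s - k * bump_e c (k + 1) s)) (at s)"
      using 2 by (simp add: bump_e_def)
    then show ?thesis
      by (rule has_field_derivative_transform_within_open[of _ _ _ "{..<0}"]) (use 2 in \<open>auto simp: bump_e_def\<close>)
  next
    case 3
    have "((\<lambda>h::real. (1 / h)^(k + 1) * exp (- c / h)) \<longlongrightarrow> 0) (at_right 0)"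
      using c by real_asymp
    then have r: "((\<lambda>h. bump_e c k h / h) \<longlongrightarrow> 0) (at_right 0)"
      by (rule Lim_transform_eventually) (auto simp: bump_e_def eventually_at_filter)
    have l: "((\<lambda>h. bump_e c k h / h) \<longlongrightarrow> 0) (at_left 0)"
      by (rule Lim_transform_eventually[OF tendsto_const]) (auto simp: bump_e_def eventually_at_filter)
    have "((\<lambda>h. bump_e c k h / h) \<longlongrightarrow> 0) (at 0)"
      using l r by (simp add: filterlim_at_split)
    then show ?thesis using 3 by (simp add: DERIV_def bump_e_def)
  qed
qed

text \<open>A class of functions closed under differentiation, hence consisting of smooth functions.\<close>

inductive bump_alg :: "real \<Rightarrow> (real \<Rightarrow> real) \<Rightarrow> bool" for c where
  const: "bump_alg c (\<lambda>t. r)"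
| bump: "bump_alg c (\<lambda>t. bump_e c k (p * t + q))"
| add: "bump_alg c f \<Longrightarrow> bump_alg c g \<Longrightarrow> bump_alg c (\<lambda>t. f t + g t)"
| mult: "bump_alg c f \<Longrightarrow> bump_alg c g \<Longrightarrow> bump_alg c (\<lambda>t. f t * g t)"

lemma bump_alg_has_deriv:
  assumes c: "c > 0" and "bump_alg c f"
  shows "\<exists>f'. bump_alg c f' \<and> (\<forall>t. (f has_real_derivative f' t) (at t))"
  using assms(2)
proof induction
  case (const r)
  then show ?case by (intro exI[of _ "\<lambda>t. 0"]) (auto intro: bump_alg.const)
next
  case (bump k p q)
  let ?f' = "\<lambda>t. (c * bump_e c (k + 2) (p * t + q) + (- real k) * bump_e c (k + 1) (p * t + q)) * p"
  have "bump_alg c ?f'" by (intro bump_alg.intros)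
  moreover have "((\<lambda>t. bump_e c k (p * t + q)) has_real_derivative ?f' t) (at t)" for t
    by (rule DERIV_chain2[where f = "bump_e c k" and g = "\<lambda>t. p * t + q"])
      (use bump_e_deriv[OF c, of k "p * t + q"] in \<open>auto intro!: derivative_eq_intros\<close>)
  ultimately show ?case by blast
next
  case (add f g)
  then obtain f' g' where "bump_alg c f'" "\<And>t. (f has_real_derivative f' t) (at t)"
    "bump_alg c g'" "\<And>t. (g has_real_derivative g' t) (at t)" by blast
  then show ?case
    by (intro exI[of _ "\<lambda>t. f' t + g' t"]) (auto intro: bump_alg.add DERIV_add)
next
  case (mult f g)
  then obtain f' g' where "bump_alg c f'" "\<And>t. (f has_real_derivative f' t) (at t)"
    "bump_alg c g'" "\<And>t. (g has_real_derivative g' t) (at t)" by blast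
  then show ?case using mult
    by (intro exI[of _ "\<lambda>t. f' t * g t + g' t * f t"])
      (auto intro: bump_alg.add bump_alg.mult DERIV_mult)
qed

lemma bump_alg_deriv:
  assumes "c > 0" "bump_alg c f"
  shows "bump_alg c (deriv f)" "f field_differentiable (at t)"
proof -
  obtain f' where f': "bump_alg c f'" "\<And>t. (f has_real_derivative f' t) (at t)"
    using bump_alg_has_deriv[OF assms] by blast
  then have "deriv f = f'" by (auto intro: DERIV_imp_deriv)
  then show "bump_alg c (deriv f)" using f' by simp
  show "f field_differentiable (at t)" using f' by (auto simp: field_differentiable_def)
qed

lemma bump_alg_smooth:
  assumes "c > 0" "bump_alg c f"
  shows "bump_alg c ((deriv ^^ k) f)"
  by (induction k) (auto intro: bump_alg_deriv assms)

lemma bump_alg_continuous: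
  assumes "c > 0" "bump_alg c f"
  shows "continuous_on S f"
  using bump_alg_deriv(2)[OF assms] field_differentiable_imp_continuous_at
  by (auto intro!: continuous_at_imp_continuous_on)

lemma test_function_antiderivative:
  assumes c: "c > 0" and psi: "bump_alg c \<psi>" and a: "0 < a" and b: "b < T" and T: "0 < T"
    and zero: "\<And>t. t \<le> a \<or> t \<ge> b \<Longrightarrow> \<psi> t = 0" and int: "integral {0..T} \<psi> = 0"
  shows "test_function T (\<lambda>t. integral {0..t} \<psi>)" "deriv (\<lambda>t. integral {0..t} \<psi>) = \<psi>"
proof -
  let ?\<phi> = "\<lambda>t. integral {0..t} \<psi>"
  have left: "?\<phi> t = 0" if "t \<le> a" for t
    using that zero by (subst integral_cong[of _ _ "\<lambda>t. 0"]) auto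
  have right: "?\<phi> t = 0" if "t \<ge> b" for t
  proof (cases "t \<ge> T")
    case True
    have "?\<phi> t = integral {0..T} \<psi> + integral {T..t} \<psi>"
      using True T bump_alg_continuous[OF c psi]
      by (intro Henstock_Kurzweil_Integration.integral_combine[symmetric] integrable_continuous_real) auto
    also have "integral {T..t} \<psi> = 0"
      using zero b by (subst integral_cong[of _ _ "\<lambda>t. 0"]) auto
    finally show ?thesis using int by simp
  next
    case False
    show ?thesis
    proof (cases "t \<ge> 0")
      case True
      have "integral {0..T} \<psi> = ?\<phi> t + integral {t..T} \<psi>"
        using True False bump_alg_continuous[OF c psi]
        by (intro Henstock_Kurzweil_Integration.integral_combine[symmetric] integrable_continuous_real) auto
      also have "integral {t..T} \<psi> = 0"
        using zero that by (subst integral_cong[of _ _ "\<lambda>t. 0"]) auto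
      finally show ?thesis using int by simp
    qed (use left a in auto)
  qed
  have D: "(?\<phi> has_real_derivative \<psi> t) (at t)" for t
  proof (cases "t < a")
    case True
    have "((\<lambda>t. 0) has_real_derivative \<psi> t) (at t)" using zero True by simp
    then show ?thesis
      by (rule has_field_derivative_transform_within_open[of _ _ _ "{..<a}"]) (use True left in auto)
  next
    case False
    have "(?\<phi> has_real_derivative \<psi> t) (at t within {0..t + 1})"
      using False a by (intro integral_has_real_derivative bump_alg_continuous[OF c psi]) auto
    then show ?thesis using False a by (subst (asm) at_within_interior) auto
  qed
  then show d: "deriv ?\<phi> = \<psi>" by (auto intro: DERIV_imp_deriv)
  have smooth: "(deriv ^^ k) ?\<phi> field_differentiable (at t)" for k t
  proof (cases k)
    case 0
    then show ?thesis using D by (auto simp: field_differentiable_def)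
  next
    case (Suc j)
    have "(deriv ^^ k) ?\<phi> = (deriv ^^ j) \<psi>" by (simp add: Suc funpow_Suc_right d del: funpow.simps)
    then show ?thesis using bump_alg_deriv(2)[OF c bump_alg_smooth[OF c psi]] by simp
  qed
  have supp: "closure {t. ?\<phi> t \<noteq> 0} \<subseteq> {a..b}"
  proof (rule closure_minimal)
    show "{t. ?\<phi> t \<noteq> 0} \<subseteq> {a..b}"
    proof
      fix t assume "t \<in> {t. ?\<phi> t \<noteq> 0}"
      then have "\<not> t \<le> a" "\<not> t \<ge> b" using left[of t] right[of t] by blast+
      then show "t \<in> {a..b}" by simp
    qed
  qed simp
  then have "compact (closure {t. ?\<phi> t \<noteq> 0})"
    by (meson bounded_closed_interval bounded_subset closed_closure compact_eq_bounded_closed)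
  with smooth supp a b show "test_function T ?\<phi>" by (auto simp: test_function_def)
qed

text \<open>Smooth functions supported in \<open>[1/(n+1), b - 1/(n+1)]\<close> that converge to the indicator of \<open>(0, b)\<close>.\<close>

definition plateau :: "nat \<Rightarrow> real \<Rightarrow> real \<Rightarrow> real" where
  "plateau n b t = bump_e (1 / Suc n) 0 (t - 1 / Suc n) * bump_e (1 / Suc n) 0 (b - 1 / Suc n - t)"

lemma plateau_bump_alg: "bump_alg (1 / Suc n) (plateau n b)"
  using bump_alg.mult[OF bump_alg.bump[of _ 0 1 "- (1 / Suc n)"] bump_alg.bump[of _ 0 "-1" "b - 1 / Suc n"]]
  by (simp add: plateau_def[abs_def] algebra_simps)

lemma plateau_eq_0: "t \<le> 1 / Suc n \<or> t \<ge> b - 1 / Suc n \<Longrightarrow> plateau n b t = 0"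
  by (auto simp: plateau_def bump_e_def)

lemma abs_plateau_le: "\<bar>plateau n b t\<bar> \<le> 1"
  by (auto simp: plateau_def bump_e_def abs_mult intro!: mult_le_one)

lemma bump_e_tendsto: "s > 0 \<Longrightarrow> (\<lambda>n. bump_e (1 / Suc n) 0 (s - 1 / Suc n)) \<longlonglongrightarrow> 1"
proof -
  assume s: "s > 0"
  have "(\<lambda>n. exp (- (1 / Suc n) / (s - 1 / Suc n))) \<longlonglongrightarrow> 1"
    using s by real_asymp
  moreover have "eventually (\<lambda>n. s - 1 / Suc n > 0) sequentially"
    using s by real_asymp
  ultimately show ?thesis
    by (rule Lim_transform_eventually[OF _ eventually_mono]) (auto simp: bump_e_def)
qed

lemma plateau_tendsto: "(\<lambda>n. plateau n b t) \<longlonglongrightarrow> indicat_real {0<..<b} t"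
proof (cases "0 < t \<and> t < b")
  case True
  have "(\<lambda>n. bump_e (1 / Suc n) 0 (t - 1 / Suc n) * bump_e (1 / Suc n) 0 ((b - t) - 1 / Suc n)) \<longlonglongrightarrow> 1 * 1"
    using True by (intro tendsto_mult bump_e_tendsto) auto
  then show ?thesis using True by (simp add: plateau_def algebra_simps)
next
  case False
  have "plateau n b t = 0" for n
  proof (rule plateau_eq_0)
    have "1 / real (Suc n) > 0" by simp
    then show "t \<le> 1 / Suc n \<or> t \<ge> b - 1 / Suc n" using False by linarith
  qed
  then show ?thesis using False by simp
qed

lemma plateau_continuous: "continuous_on S (plateau n b)"
  by (rule bump_alg_continuous[OF _ plateau_bump_alg]) simp

lemma plateau_measurable: "plateau n b \<in> borel_measurable (I T)"
  by (rule borel_measurable_I_borel[OF borel_measurable_continuous_onI[OF plateau_continuous]])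

lemma plateau_integrable:
  fixes v :: "real \<Rightarrow> 'a::{banach, second_countable_topology}"
  assumes "integrable (I T) v"
  shows "integrable (I T) (\<lambda>t. plateau n b t *\<^sub>R v t)"
proof (rule Bochner_Integration.integrable_bound[OF assms])
  show "(\<lambda>t. plateau n b t *\<^sub>R v t) \<in> borel_measurable (I T)"
    using assms plateau_measurable by (intro borel_measurable_scaleR) auto
  show "AE t in I T. norm (plateau n b t *\<^sub>R v t) \<le> norm (v t)"
    using abs_plateau_le by (intro AE_I2) (auto intro: mult_left_le_one_le)
qed

lemma plateau_integral_tendsto:
  fixes v :: "real \<Rightarrow> 'a::{banach, second_countable_topology}"
  assumes v: "integrable (I T) v"
  shows "(\<lambda>n. \<integral>t. plateau n b t *\<^sub>R v t \<partial>I T) \<longlonglongrightarrow> prim T v b"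
  unfolding prim_def
proof (rule integral_dominated_convergence[where w = "\<lambda>t. norm (v t)"])
  show "AE t in I T. (\<lambda>n. plateau n b t *\<^sub>R v t) \<longlonglongrightarrow> indicat_real {..<b} t *\<^sub>R v t"
  proof (intro AE_I2)
    fix t assume "t \<in> space (I T)"
    then have "indicat_real {0<..<b} t = indicat_real {..<b} t" by (auto simp: indicator_def)
    with plateau_tendsto[of b t] show "(\<lambda>n. plateau n b t *\<^sub>R v t) \<longlonglongrightarrow> indicat_real {..<b} t *\<^sub>R v t"
      by (intro tendsto_intros) simp
  qed
  show "AE t in I T. norm (plateau n b t *\<^sub>R v t) \<le> norm (v t)" for n
    using abs_plateau_le by (intro AE_I2) (auto intro: mult_left_le_one_le)
  show "(\<lambda>t. indicat_real {..<b} t *\<^sub>R v t) \<in> borel_measurable (I T)"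
    using integrable_indicator_I[OF v] by auto
  show "(\<lambda>t. plateau n b t *\<^sub>R v t) \<in> borel_measurable (I T)" for n
    using plateau_integrable[OF v] by auto
qed (use v in auto)

lemma integrable_I_continuous:
  fixes f :: "real \<Rightarrow> real"
  assumes "continuous_on UNIV f"
  shows "integrable (I T) f"
proof -
  have "compact (f ` {0..T})"
    by (intro compact_continuous_image continuous_on_subset[OF assms]) auto
  then obtain B where B: "\<And>t. t \<in> {0..T} \<Longrightarrow> norm (f t) \<le> B"
    using compact_imp_bounded[of "f ` {0..T}"] unfolding bounded_iff by fastforce
  interpret finite_measure "I T" by (rule finite_measure_I)
  show ?thesis
  proof (rule integrable_const_bound)
    show "f \<in> borel_measurable (I T)" by (rule borel_measurable_I_borel[OF borel_measurable_continuous_onI[OF assms]])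
    show "AE t in I T. norm (f t) \<le> B" using B by (intro AE_I2) auto
  qed
qed

lemma prim_eq_integral:
  fixes f :: "real \<Rightarrow> real"
  assumes f: "continuous_on UNIV f" and t: "0 \<le> t" "t \<le> T"
  shows "prim T f t = integral {0..t} f"
proof -
  have "prim T f t = (\<integral>s. indicat_real {0<..<T} s *\<^sub>R indicat_real {..<t} s *\<^sub>R f s \<partial>lebesgue)"
    unfolding prim_def by (rule integral_restrict_space) auto
  also have "\<dots> = (\<integral>s. indicat_real {0<..<t} s *\<^sub>R f s \<partial>lebesgue)"
    using t by (intro Bochner_Integration.integral_cong) (auto simp: indicator_def)
  also have "\<dots> = (\<integral>s. f s \<partial>I t)"
    by (rule integral_restrict_space[symmetric]) auto
  also have "\<dots> = integral {0<..<t} f"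
    by (rule lebesgue_integral_eq_integral[OF integrable_I_continuous[OF f]]) auto
  also have "\<dots> = integral {0..t} f" by (rule integral_open_interval_real[symmetric])
  finally show ?thesis .
qed

lemma AE_const_if_weak_deriv_0:
  fixes v :: "real \<Rightarrow> 'a::{banach, second_countable_topology}"
  assumes T: "0 < T" and v: "integrable (I T) v"
    and weak: "\<And>\<phi>. test_function T \<phi> \<Longrightarrow> (\<integral>t. deriv \<phi> t *\<^sub>R v t \<partial>I T) = 0"
  shows "\<exists>m. AE t in I T. v t = m"
proof -
  define P where "P n b = (\<integral>t. plateau n b t *\<^sub>R v t \<partial>I T)" for n b
  define Q where "Q n b = (\<integral>t. plateau n b t *\<^sub>R (1::real) \<partial>I T)" for n b
  have one: "integrable (I T) (\<lambda>t. 1 :: real)" by (rule integrable_I_continuous) auto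
  have scaled: "T *\<^sub>R prim T v b = b *\<^sub>R prim T v T" if b: "0 < b" "b \<le> T" for b
  proof -
    have "Q n T *\<^sub>R P n b = Q n b *\<^sub>R P n T" for n
    proof -
      define \<psi> where "\<psi> t = Q n T * plateau n b t + (- Q n b) * plateau n T t" for t
      have alg: "bump_alg (1 / Suc n) \<psi>"
        unfolding \<psi>_def[abs_def] by (intro bump_alg.intros plateau_bump_alg)
      have cont: "continuous_on S \<psi>" for S by (rule bump_alg_continuous[OF _ alg]) simp
      have zero: "\<psi> t = 0" if "t \<le> 1 / Suc n \<or> t \<ge> T - 1 / Suc n" for t
        using that b plateau_eq_0[of t n b] plateau_eq_0[of t n T] unfolding \<psi>_def by auto
      have "(\<integral>t. \<psi> t \<partial>I T) = 0"
        unfolding \<psi>_def using plateau_integrable[OF one] by (simp add: Q_def)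
      then have int: "integral {0..T} \<psi> = 0"
        using prim_eq_integral[OF cont, of T T] prim_ge_T[of T T \<psi>] T by simp
      have s: "0 < 1 / real (Suc n)" by simp
      have t: "test_function T (\<lambda>t. integral {0..t} \<psi>)" "deriv (\<lambda>t. integral {0..t} \<psi>) = \<psi>"
        using test_function_antiderivative[where a = "1 / Suc n" and b = "T - 1 / Suc n" and T = T and \<psi> = \<psi>,
            OF s alg s _ T zero int] s by simp_all
      have "0 = (\<integral>t. \<psi> t *\<^sub>R v t \<partial>I T)" using weak[OF t(1)] by (simp add: t(2))
      also have "\<dots> = (\<integral>t. Q n T *\<^sub>R (plateau n b t *\<^sub>R v t) - Q n b *\<^sub>R (plateau n T t *\<^sub>R v t) \<partial>I T)"
        by (simp add: \<psi>_def algebra_simps)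
      also have "\<dots> = Q n T *\<^sub>R P n b - Q n b *\<^sub>R P n T"
        unfolding P_def using plateau_integrable[OF v] by (simp del: scaleR_scaleR)
      finally show ?thesis by simp
    qed
    moreover have "(\<lambda>n. Q n T *\<^sub>R P n b) \<longlonglongrightarrow> prim T (\<lambda>t. 1) T *\<^sub>R prim T v b"
      and "(\<lambda>n. Q n b *\<^sub>R P n T) \<longlonglongrightarrow> prim T (\<lambda>t. 1) b *\<^sub>R prim T v T"
      unfolding P_def Q_def by (intro tendsto_intros plateau_integral_tendsto v one)+
    ultimately have "prim T (\<lambda>t. 1::real) T *\<^sub>R prim T v b = prim T (\<lambda>t. 1) b *\<^sub>R prim T v T"
      using LIMSEQ_unique by simp
    moreover have "prim T (\<lambda>t. 1::real) s = s" if "0 \<le> s" "s \<le> T" for s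
      using that by (subst prim_eq_integral) auto
    ultimately show ?thesis using b T by simp
  qed
  define m where "m = (1 / T) *\<^sub>R prim T v T"
  have cint: "integrable (I T) (\<lambda>t. m)"
  proof -
    interpret finite_measure "I T" by (rule finite_measure_I)
    show ?thesis by simp
  qed
  have "AE t in I T. v t - m = 0"
  proof (rule prim_eq_0_imp_AE_0)
    show "integrable (I T) (\<lambda>t. v t - m)" using v cint by simp
    fix b assume b: "0 < b" "b \<le> T"
    have "prim T (\<lambda>t. m) b = prim T (\<lambda>t. 1 :: real) b *\<^sub>R m"
    proof -
      have "prim T (\<lambda>t. m) b = (\<integral>s. (indicat_real {..<b} s *\<^sub>R 1) *\<^sub>R m \<partial>I T)" by (simp add: prim_def)
      also have "\<dots> = prim T (\<lambda>t. 1 :: real) b *\<^sub>R m"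
        unfolding prim_def using integrable_indicator_I[OF one, of "{..<b}"] by (intro integral_scaleR_left) auto
      finally show ?thesis .
    qed
    also have "prim T (\<lambda>t. 1::real) b = b" using b by (subst prim_eq_integral) auto
    also have "b *\<^sub>R m = (1 / T) *\<^sub>R (b *\<^sub>R prim T v T)" by (simp add: m_def)
    also have "\<dots> = prim T v b" unfolding scaled[OF b, symmetric] using T by simp
    finally show "prim T (\<lambda>t. v t - m) b = 0" using prim_diff[OF v cint] by simp
  qed
  then show ?thesis by auto
qed

lemma weak_deriv_of_prim:
  fixes g :: "real \<Rightarrow> 'a::{banach, second_countable_topology}"
  assumes T: "0 < T" and g: "integrable (I T) g" and phi: "test_function T \<phi>"
  shows "(\<integral>t. deriv \<phi> t *\<^sub>R (m + prim T g t) \<partial>I T) = - (\<integral>t. \<phi> t *\<^sub>R g t \<partial>I T)"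
    and "integrable (I T) (deriv \<phi>)"
proof -
  have diff: "(deriv ^^ k) \<phi> field_differentiable (at t)" for k t
    using phi by (auto simp: test_function_def)
  have cont: "continuous_on UNIV (deriv \<phi>)"
    using diff[of 1] by (auto intro!: continuous_at_imp_continuous_on field_differentiable_imp_continuous_at)
  show di: "integrable (I T) (deriv \<phi>)" by (rule integrable_I_continuous[OF cont])
  have "\<phi> t = 0" if "t \<notin> {0<..<T}" for t
    using phi that closure_subset[of "{t. \<phi> t \<noteq> 0}"] unfolding test_function_def by auto
  then have z: "\<phi> 0 = 0" "\<phi> T = 0" by auto
  have D: "(\<phi> has_real_derivative deriv \<phi> t) (at t)" for t
    using diff[of 0 t] by (simp add: field_differentiable_derivI)
  have prim_phi: "prim T (deriv \<phi>) t = \<phi> t" if "0 \<le> t" "t \<le> T" for t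
  proof -
    have "(deriv \<phi> has_integral (\<phi> t - \<phi> 0)) {0..t}"
      using that D by (intro fundamental_theorem_of_calculus)
        (auto intro: has_field_derivative_at_within simp flip: has_real_derivative_iff_has_vector_derivative)
    then show ?thesis using prim_eq_integral[OF cont that] z by (simp add: integral_unique)
  qed
  have tot: "(\<integral>t. deriv \<phi> t \<partial>I T) = 0" using prim_phi[of T] prim_ge_T[of T T "deriv \<phi>"] T z by simp
  have parts: "(\<integral>t. deriv \<phi> t *\<^sub>R prim T g t \<partial>I T) + (\<integral>t. prim T (deriv \<phi>) t *\<^sub>R g t \<partial>I T) = 0"
    using integration_by_parts[OF bounded_bilinear_scaleR di g] tot by simp
  have "(\<integral>t. prim T (deriv \<phi>) t *\<^sub>R g t \<partial>I T) = (\<integral>t. \<phi> t *\<^sub>R g t \<partial>I T)"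
    by (intro Bochner_Integration.integral_cong) (auto simp: prim_phi)
  moreover have "(\<integral>t. deriv \<phi> t *\<^sub>R (m + prim T g t) \<partial>I T) =
      (\<integral>t. deriv \<phi> t *\<^sub>R m \<partial>I T) + (\<integral>t. deriv \<phi> t *\<^sub>R prim T g t \<partial>I T)"
  proof -
    have "integrable (I T) (\<lambda>t. deriv \<phi> t *\<^sub>R prim T g t)"
    proof (rule Bochner_Integration.integrable_bound)
      show "integrable (I T) (\<lambda>t. deriv \<phi> t * (\<integral>s. norm (g s) \<partial>I T))" using di by simp
      show "(\<lambda>t. deriv \<phi> t *\<^sub>R prim T g t) \<in> borel_measurable (I T)"
        using di borel_measurable_prim[OF g] by (intro borel_measurable_scaleR) auto
      show "AE t in I T. norm (deriv \<phi> t *\<^sub>R prim T g t) \<le> norm (deriv \<phi> t * (\<integral>s. norm (g s) \<partial>I T))"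
        using norm_prim_le[OF g] by (intro AE_I2) (auto simp: abs_mult abs_of_nonneg[OF Bochner_Integration.integral_nonneg] intro!: mult_left_mono)
    qed
    moreover have "integrable (I T) (\<lambda>t. deriv \<phi> t *\<^sub>R m)" using di by (rule integrable_scaleR_left)
    ultimately show ?thesis by (simp add: scaleR_add_right)
  qed
  moreover have "(\<integral>t. deriv \<phi> t *\<^sub>R m \<partial>I T) = 0"
    using tot integral_scaleR_left[of m "I T" "deriv \<phi>"] di by simp
  ultimately show "(\<integral>t. deriv \<phi> t *\<^sub>R (m + prim T g t) \<partial>I T) = - (\<integral>t. \<phi> t *\<^sub>R g t \<partial>I T)"
    using parts by (simp add: eq_neg_iff_add_eq_0)
qed

lemma has_weak_deriv_iff:
  fixes u :: "real \<Rightarrow> 'a::{banach, second_countable_topology}"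
  assumes T: "0 < T" and u: "u \<in> L2_space T"
  shows "has_weak_deriv T u g \<longleftrightarrow> g \<in> L2_space T \<and> (\<exists>m. AE t in I T. u t = m + prim T g t)"
proof
  assume L: "has_weak_deriv T u g"
  then have g: "g \<in> L2_space T" by (simp add: has_weak_deriv_def)
  note gi = L2_imp_integrable[OF g] and ui = L2_imp_integrable[OF u]
  have pi: "integrable (I T) (prim T g)" by (rule L2_imp_integrable[OF L2_prim[OF gi]])
  have "\<exists>m. AE t in I T. u t - prim T g t = m"
  proof (rule AE_const_if_weak_deriv_0[OF T])
    show "integrable (I T) (\<lambda>t. u t - prim T g t)" using ui pi by simp
    fix \<phi> assume phi: "test_function T \<phi>"
    note W = weak_deriv_of_prim[OF T gi phi]
    obtain B where B: "\<And>t. t \<in> {0..T} \<Longrightarrow> norm (deriv \<phi> t) \<le> B"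
    proof -
      have "continuous_on {0..T} (deriv \<phi>)"
        using phi unfolding test_function_def
        by (intro continuous_at_imp_continuous_on ballI field_differentiable_imp_continuous_at)
          (metis funpow_0 funpow.simps(2) o_apply)
      then have "compact (deriv \<phi> ` {0..T})" by (intro compact_continuous_image) auto
      then show ?thesis
        using that compact_imp_bounded[of "deriv \<phi> ` {0..T}"] unfolding bounded_iff by fastforce
    qed
    have mult_int: "integrable (I T) (\<lambda>t. deriv \<phi> t *\<^sub>R v t)" if "integrable (I T) v" for v :: "real \<Rightarrow> 'a"
    proof (rule Bochner_Integration.integrable_bound)
      show "integrable (I T) (\<lambda>t. B *\<^sub>R v t)" using that by simp
      show "(\<lambda>t. deriv \<phi> t *\<^sub>R v t) \<in> borel_measurable (I T)"
        using W(2) that by (intro borel_measurable_scaleR) auto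
      show "AE t in I T. norm (deriv \<phi> t *\<^sub>R v t) \<le> norm (B *\<^sub>R v t)"
        using B by (intro AE_I2) (auto intro!: mult_right_mono order_trans[OF _ abs_ge_self])
    qed
    have "(\<integral>t. deriv \<phi> t *\<^sub>R (u t - prim T g t) \<partial>I T) =
        (\<integral>t. deriv \<phi> t *\<^sub>R u t \<partial>I T) - (\<integral>t. deriv \<phi> t *\<^sub>R (0 + prim T g t) \<partial>I T)"
      using mult_int[OF ui] mult_int[OF pi] by (simp add: scaleR_diff_right)
    also have "\<dots> = 0" using L phi unfolding W(1) by (simp add: has_weak_deriv_def)
    finally show "(\<integral>t. deriv \<phi> t *\<^sub>R (u t - prim T g t) \<partial>I T) = 0" .
  qed
  then show "g \<in> L2_space T \<and> (\<exists>m. AE t in I T. u t = m + prim T g t)"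
    using g by (auto simp: diff_eq_eq)
next
  assume R: "g \<in> L2_space T \<and> (\<exists>m. AE t in I T. u t = m + prim T g t)"
  then obtain m where g: "g \<in> L2_space T" and m: "AE t in I T. u t = m + prim T g t" by blast
  note gi = L2_imp_integrable[OF g]
  show "has_weak_deriv T u g"
    unfolding has_weak_deriv_def
  proof (intro conjI allI impI g)
    fix \<phi> assume phi: "test_function T \<phi>"
    note W = weak_deriv_of_prim[OF T gi phi]
    have "(\<integral>t. deriv \<phi> t *\<^sub>R u t \<partial>I T) = (\<integral>t. deriv \<phi> t *\<^sub>R (m + prim T g t) \<partial>I T)"
      using m W(2) L2_spaceD(1)[OF u] borel_measurable_prim[OF gi]
      by (intro integral_cong_AE borel_measurable_scaleR borel_measurable_add) (auto elim!: eventually_mono)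
    then show "(\<integral>t. deriv \<phi> t *\<^sub>R u t \<partial>I T) = - (\<integral>t. \<phi> t *\<^sub>R g t \<partial>I T)" by (simp add: W(1))
  qed
qed

lemma continuous_AE_0:
  fixes d :: "real \<Rightarrow> 'a::real_normed_vector"
  assumes T: "0 < T" and d: "continuous_on {0..T} d" and ae: "AE t in I T. d t = 0" and t: "t \<in> {0..T}"
  shows "d t = 0"
proof -
  let ?U = "{t \<in> {0<..<T}. d t \<noteq> 0}"
  have "continuous_on {0<..<T} d" using d by (rule continuous_on_subset) auto
  then have "open ({0<..<T} \<inter> d -` (- {0}))" by (intro continuous_open_preimage) auto
  also have "{0<..<T} \<inter> d -` (- {0}) = ?U" by auto
  finally have o: "open ?U" .
  have "AE t in lebesgue. t \<notin> ?U"
    using ae by (subst (asm) AE_restrict_space_iff) (auto elim!: eventually_mono)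
  moreover have "?U \<in> sets lebesgue" using borel_open[OF o] by (intro sets_completionI_sets) simp
  ultimately have "?U \<in> null_sets lebesgue" using AE_iff_null_sets[of ?U lebesgue] by blast
  then have "?U = {}" using o open_not_negligible negligible_iff_null_sets by blast
  then have z: "\<And>s. s \<in> {0<..<T} \<Longrightarrow> d s = 0" by auto
  show ?thesis
    by (rule continuous_constant_on_closure[of "{0<..<T}"]) (use d z t T in auto)
qed

lemma cont_rep_eq:
  assumes T: "0 < T" and c: "continuous_on {0..T} c" "AE t in I T. c t = u t" and t: "t \<in> {0..T}"
  shows "cont_rep T u t = c t"
proof -
  have "continuous_on {0..T} (cont_rep T u) \<and> (AE t in I T. cont_rep T u t = u t)"
    unfolding cont_rep_def by (rule someI[of _ c]) (use c in blast)
  then have r: "continuous_on {0..T} (cont_rep T u)" "AE t in I T. cont_rep T u t = u t" by auto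
  have "AE t in I T. cont_rep T u t - c t = 0" using r(2) c(2) by eventually_elim simp
  from continuous_AE_0[OF T _ this t] show ?thesis using r(1) c(1) by (simp add: continuous_on_diff)
qed

lemma weak_deriv_props:
  fixes u :: "real \<Rightarrow> 'a::{banach, second_countable_topology}"
  assumes T: "0 < T" and u: "u \<in> L2_space T" and g: "g \<in> L2_space T"
    and eq: "AE t in I T. u t = m + prim T g t"
  shows "weak_deriv T u \<in> L2_space T" "AE t in I T. weak_deriv T u t = g t"
    "\<And>t. t \<in> {0..T} \<Longrightarrow> cont_rep T u t = m + prim T g t"
proof -
  note gi = L2_imp_integrable[OF g]
  have "has_weak_deriv T u g" using has_weak_deriv_iff[OF T u] g eq by blast
  then have "has_weak_deriv T u (weak_deriv T u)" unfolding weak_deriv_def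
    by (rule someI[of "\<lambda>g. has_weak_deriv T u g"])
  then obtain m' where w: "weak_deriv T u \<in> L2_space T" and
    m': "AE t in I T. u t = m' + prim T (weak_deriv T u) t"
    using has_weak_deriv_iff[OF T u] by blast
  note wi = L2_imp_integrable[OF w]
  show "weak_deriv T u \<in> L2_space T" by (rule w)
  show rep: "cont_rep T u t = m + prim T g t" if "t \<in> {0..T}" for t
    using eq by (intro cont_rep_eq[OF T _ _ that] continuous_intros continuous_prim gi) (auto elim!: eventually_mono)
  have rep': "cont_rep T u t = m' + prim T (weak_deriv T u) t" if "t \<in> {0..T}" for t
    using m' by (intro cont_rep_eq[OF T _ _ that] continuous_intros continuous_prim wi) (auto elim!: eventually_mono)
  have "m = m'" using rep[of 0] rep'[of 0] T by (simp add: prim_le_0)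
  have "AE t in I T. weak_deriv T u t - g t = 0"
    using rep rep' \<open>m = m'\<close> by (intro prim_eq_0_imp_AE_0) (auto simp: prim_diff wi gi)
  then show "AE t in I T. weak_deriv T u t = g t" by simp
qed

section \<open>The backward parabolic operator\<close>

locale parabolic = selfadjoint_iso emb A a
  for emb A :: "'p::{real_inner, banach, second_countable_topology} \<Rightarrow>\<^sub>L
      'm::{real_inner, banach, second_countable_topology}" and a :: real +
  fixes T :: real
  assumes T_pos: "0 < T"
begin

abbreviation X0 :: "(real \<Rightarrow> 'p) set" where
  "X0 \<equiv> X0_space emb T"

definition dx :: "(real \<Rightarrow> 'p) \<Rightarrow> real \<Rightarrow> 'm" where
  "dx x = weak_deriv T (\<lambda>s. emb (x s))"

definition L :: "(real \<Rightarrow> 'p) \<Rightarrow> real \<Rightarrow> 'm" where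
  "L x t = A (x t) - dx x t"

lemma X0_I:
  assumes x: "x \<in> L2_space T" and g: "g \<in> L2_space T"
    and eq: "AE t in I T. emb (x t) = prim T g t - prim T g T"
  shows "x \<in> X0" "AE t in I T. dx x t = g t"
proof -
  have ex: "(\<lambda>t. emb (x t)) \<in> L2_space T" using x by (rule L2_blinfun)
  have eq': "AE t in I T. emb (x t) = - prim T g T + prim T g t" using eq by eventually_elim simp
  note W = weak_deriv_props[OF T_pos ex g eq']
  show "AE t in I T. dx x t = g t" unfolding dx_def by (rule W(2))
  have "has_weak_deriv T (\<lambda>t. emb (x t)) g"
    using has_weak_deriv_iff[OF T_pos ex] g eq' by blast
  moreover have "cont_rep T (\<lambda>t. emb (x t)) T = 0" using W(3)[of T] T_pos by simp
  ultimately show "x \<in> X0" using x ex by (auto simp: X0_space_def X_space_def H1_space_def)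
qed

lemma X0_D:
  assumes x: "x \<in> X0"
  shows "x \<in> L2_space T" "dx x \<in> L2_space T"
    "AE t in I T. emb (x t) = prim T (dx x) t - prim T (dx x) T"
    "cont_rep T (\<lambda>t. emb (x t)) 0 = - prim T (dx x) T"
proof -
  show xL: "x \<in> L2_space T" using x by (simp add: X0_space_def X_space_def)
  have ex: "(\<lambda>t. emb (x t)) \<in> L2_space T" using xL by (rule L2_blinfun)
  obtain g where "has_weak_deriv T (\<lambda>t. emb (x t)) g"
    using x by (auto simp: X0_space_def X_space_def H1_space_def)
  then have "has_weak_deriv T (\<lambda>t. emb (x t)) (dx x)"
    unfolding dx_def weak_deriv_def by (rule someI[of "\<lambda>g. has_weak_deriv T (\<lambda>t. emb (x t)) g"])
  then obtain m where d: "dx x \<in> L2_space T" and m: "AE t in I T. emb (x t) = m + prim T (dx x) t"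
    using has_weak_deriv_iff[OF T_pos ex] by blast
  show "dx x \<in> L2_space T" by (rule d)
  note W = weak_deriv_props(3)[OF T_pos ex d m]
  have "m = - prim T (dx x) T"
    using W[of T] T_pos x by (simp add: X0_space_def eq_neg_iff_add_eq_0)
  with m W[of 0] T_pos show "AE t in I T. emb (x t) = prim T (dx x) t - prim T (dx x) T"
    "cont_rep T (\<lambda>t. emb (x t)) 0 = - prim T (dx x) T"
    by (auto simp: prim_le_0)
qed

lemma L_L2:
  assumes "x \<in> X0"
  shows "L x \<in> L2_space T"
  unfolding L_def[abs_def] using X0_D[OF assms] by (intro L2_diff L2_blinfun)

lemma X0_lin:
  assumes x: "x \<in> X0" and z: "z \<in> X0"
  shows "(\<lambda>t. r *\<^sub>R x t + s *\<^sub>R z t) \<in> X0"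
    "AE t in I T. dx (\<lambda>t. r *\<^sub>R x t + s *\<^sub>R z t) t = r *\<^sub>R dx x t + s *\<^sub>R dx z t"
    "AE t in I T. L (\<lambda>t. r *\<^sub>R x t + s *\<^sub>R z t) t = r *\<^sub>R L x t + s *\<^sub>R L z t"
proof -
  note X = X0_D[OF x] and Z = X0_D[OF z]
  note i = L2_imp_integrable[OF X(2)] L2_imp_integrable[OF Z(2)]
  have eq: "AE t in I T. emb (r *\<^sub>R x t + s *\<^sub>R z t) =
      prim T (\<lambda>t. r *\<^sub>R dx x t + s *\<^sub>R dx z t) t - prim T (\<lambda>t. r *\<^sub>R dx x t + s *\<^sub>R dx z t) T"
    using X(3) Z(3)
  proof eventually_elim
    case (elim t)
    have "emb (r *\<^sub>R x t + s *\<^sub>R z t) = r *\<^sub>R emb (x t) + s *\<^sub>R emb (z t)"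
      by (simp add: blinfun.bilinear_simps)
    then show ?case unfolding elim prim_lin[OF i] by (simp add: scaleR_diff_right)
  qed
  note I = X0_I[OF L2_lin[OF X(1) Z(1)] L2_lin[OF X(2) Z(2)] eq]
  show "(\<lambda>t. r *\<^sub>R x t + s *\<^sub>R z t) \<in> X0" by (rule I(1))
  show d: "AE t in I T. dx (\<lambda>t. r *\<^sub>R x t + s *\<^sub>R z t) t = r *\<^sub>R dx x t + s *\<^sub>R dx z t" by (rule I(2))
  then show "AE t in I T. L (\<lambda>t. r *\<^sub>R x t + s *\<^sub>R z t) t = r *\<^sub>R L x t + s *\<^sub>R L z t"
    by eventually_elim (simp add: L_def blinfun.bilinear_simps algebra_simps)
qed

lemma Cpow_L2_tendsto:
  assumes f: "f \<in> L2_space T"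
  shows "(\<lambda>n. \<integral>t. (norm (Cpow n (f t)))^2 \<partial>I T) \<longlonglongrightarrow> 0"
proof -
  have "(\<lambda>n. \<integral>t. (norm (Cpow n (f t)))^2 \<partial>I T) \<longlonglongrightarrow> (\<integral>t. 0 \<partial>I T)"
  proof (rule integral_dominated_convergence[where w = "\<lambda>t. (norm (f t))^2"])
    show "AE t in I T. (\<lambda>n. (norm (Cpow n (f t)))^2) \<longlonglongrightarrow> 0"
    proof (intro AE_I2)
      fix t
      have "(\<lambda>n. (norm (Cpow n (f t)))^2) \<longlonglongrightarrow> (norm (0 :: 'm))^2"
        by (intro tendsto_intros Cpow_tendsto)
      then show "(\<lambda>n. (norm (Cpow n (f t)))^2) \<longlonglongrightarrow> 0" by simp
    qed
    show "AE t in I T. norm ((norm (Cpow n (f t)))^2) \<le> (norm (f t))^2" for n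
      using norm_Cpow_le by (intro AE_I2) (auto intro: power_mono)
  qed (use L2_spaceD[OF f] L2_spaceD[OF L2_blinfun[OF f]] in auto)
  then show ?thesis by simp
qed

lemma energy_blinfun:
  fixes F :: "'m \<Rightarrow>\<^sub>L 'm"
  assumes p: "p \<in> L2_space T" and g: "g \<in> L2_space T"
    and eq: "AE t in I T. K (p t) = prim T g t - prim T g T"
  shows "(norm (F (prim T g T)))^2 = -2 * (\<integral>t. inner (F (K (p t))) (F (g t)) \<partial>I T)"
proof -
  let ?g = "\<lambda>t. F (g t)"
  note gi = L2_imp_integrable[OF g]
  have Fg: "?g \<in> L2_space T" using g by (rule L2_blinfun)
  note Fgi = L2_imp_integrable[OF Fg]
  have P: "prim T ?g t = F (prim T g t)" for t by (rule prim_blinfun[OF gi])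
  have tot: "(\<integral>t. ?g t \<partial>I T) = F (prim T g T)" using prim_ge_T[of T T ?g] P[of T] by simp
  have "(\<integral>t. inner (F (K (p t))) (F (g t)) \<partial>I T) =
      (\<integral>t. inner (?g t) (prim T ?g t) - inner (F (prim T g T)) (?g t) \<partial>I T)"
  proof (rule integral_cong_AE)
    show "AE t in I T. inner (F (K (p t))) (F (g t)) = inner (?g t) (prim T ?g t) - inner (F (prim T g T)) (?g t)"
      using eq by eventually_elim (simp add: P blinfun.diff_right inner_diff_left inner_diff_right inner_commute)
    show "(\<lambda>t. inner (F (K (p t))) (F (g t))) \<in> borel_measurable (I T)"
      using L2_inner[OF L2_blinfun[OF L2_blinfun[OF p]] Fg] by blast
    show "(\<lambda>t. inner (?g t) (prim T ?g t) - inner (F (prim T g T)) (?g t)) \<in> borel_measurable (I T)"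
      using L2_inner[OF Fg L2_prim[OF Fgi]] L2_inner[OF L2_const Fg] by (intro borel_measurable_diff) auto
  qed
  also have "\<dots> = (\<integral>t. inner (?g t) (prim T ?g t) \<partial>I T) - (\<integral>t. inner (F (prim T g T)) (?g t) \<partial>I T)"
    using L2_inner[OF Fg L2_prim[OF Fgi]] L2_inner[OF L2_const Fg]
    by (rule Bochner_Integration.integral_diff)
  also have "(\<integral>t. inner (F (prim T g T)) (?g t) \<partial>I T) = inner (F (prim T g T)) (F (prim T g T))"
    using Fgi by (simp add: tot)
  finally show ?thesis
    using inner_prim_self[OF Fgi] unfolding tot by (simp add: power2_norm_eq_inner)
qed

text \<open>
  The regularised square roots \<open>D n\<close> are bounded, so the energy identity holds for them; applied to
  their differences it makes \<open>D n (u(0))\<close> Cauchy, whose limit is \<open>A\<^sup>1\<^sup>/\<^sup>2 u(0)\<close>.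
\<close>

lemma energy:
  assumes p: "p \<in> L2_space T" and g: "g \<in> L2_space T"
    and eq: "AE t in I T. K (p t) = prim T g t - prim T g T"
  shows "\<exists>q. R q = - prim T g T \<and> (norm q)^2 = -2 * (\<integral>t. inner (p t) (g t) \<partial>I T)"
proof -
  define u0 where "u0 = - prim T g T"
  have En: "(norm (F u0))^2 = -2 * (\<integral>t. inner (F (K (p t))) (F (g t)) \<partial>I T)" for F :: "'m \<Rightarrow>\<^sub>L 'm"
    using energy_blinfun[OF p g eq, of F] by (simp add: u0_def blinfun.minus_right)
  have C2: "integrable (I T) (\<lambda>t. (norm (Cpow n (f t)))^2)" if "f \<in> L2_space T" for f n
    using L2_spaceD(2)[OF L2_blinfun[OF that]] .
  define E where "E n = (\<integral>t. (norm (Cpow n (p t)))^2 \<partial>I T) + (\<integral>t. (norm (Cpow n (g t)))^2 \<partial>I T)" for n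
  have E0: "E \<longlonglongrightarrow> 0"
    unfolding E_def using tendsto_add[OF Cpow_L2_tendsto[OF p] Cpow_L2_tendsto[OF g]] by simp
  have diff: "(norm (D n u0 - D m u0))^2 \<le> 2 * (E n + E m)" for n m
  proof -
    have sq: "(norm (x - y))^2 \<le> 2 * (norm x)^2 + 2 * (norm y)^2" for x y :: 'm
    proof -
      have "(norm (x - y))^2 \<le> (norm x + norm y)^2"
        using norm_triangle_ineq4 by (rule power_mono) simp
      also have "\<dots> \<le> 2 * (norm x)^2 + 2 * (norm y)^2"
        using sum_squares_bound[of "norm x" "norm y"] by (simp add: power2_sum)
      finally show ?thesis .
    qed
    have bd: "-2 * inner x y \<le> (norm x)^2 + (norm y)^2" for x y :: 'm
      using zero_le_power2[of "norm (x + y)"] unfolding power2_norm_eq_inner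
      by (simp add: inner_simps inner_commute)
    have "(norm (D n u0 - D m u0))^2 =
        (\<integral>t. -2 * inner (Cpow m (p t) - Cpow n (p t)) (Cpow m (g t) - Cpow n (g t)) \<partial>I T)"
      using En[of "D n - D m"] by (simp add: inner_D_diff blinfun.diff_left[of "D n" "D m" u0])
    also have "\<dots> \<le> (\<integral>t. 2 * (norm (Cpow n (p t)))^2 + 2 * (norm (Cpow m (p t)))^2 +
        (2 * (norm (Cpow n (g t)))^2 + 2 * (norm (Cpow m (g t)))^2) \<partial>I T)"
    proof (rule integral_mono)
      show "integrable (I T) (\<lambda>t. - 2 * inner (Cpow m (p t) - Cpow n (p t)) (Cpow m (g t) - Cpow n (g t)))"
        by (intro integrable_mult_right L2_inner L2_diff L2_blinfun p g)
      show "integrable (I T) (\<lambda>t. 2 * (norm (Cpow n (p t)))^2 + 2 * (norm (Cpow m (p t)))^2 +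
        (2 * (norm (Cpow n (g t)))^2 + 2 * (norm (Cpow m (g t)))^2))"
        using C2[OF p] C2[OF g] by simp
      show "- 2 * inner (Cpow m (p t) - Cpow n (p t)) (Cpow m (g t) - Cpow n (g t)) \<le>
        2 * (norm (Cpow n (p t)))^2 + 2 * (norm (Cpow m (p t)))^2 +
        (2 * (norm (Cpow n (g t)))^2 + 2 * (norm (Cpow m (g t)))^2)" for t
        using bd[of "Cpow m (p t) - Cpow n (p t)" "Cpow m (g t) - Cpow n (g t)"]
          sq[of "Cpow m (p t)" "Cpow n (p t)"] sq[of "Cpow m (g t)" "Cpow n (g t)"] by linarith
    qed
    also have "\<dots> = 2 * (E n + E m)"
      using C2[OF p] C2[OF g] by (simp add: E_def)
    finally show ?thesis .
  qed
  have "Cauchy (\<lambda>n. D n u0)"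
  proof (rule CauchyI)
    fix e :: real assume e: "e > 0"
    then have "e^2 / 4 > 0" by simp
    from order_tendstoD(2)[OF E0 this] obtain N where N: "\<And>n. n \<ge> N \<Longrightarrow> E n < e^2 / 4"
      by (auto simp: eventually_sequentially)
    have "norm (D m u0 - D n u0) < e" if "m \<ge> N" "n \<ge> N" for m n
    proof -
      have "2 * (E m + E n) < e^2" using N[OF that(1)] N[OF that(2)] by simp
      with diff[of m n] have "(norm (D m u0 - D n u0))^2 < e^2" by (rule le_less_trans)
      then show ?thesis by (rule power2_less_imp_less) (use e in simp)
    qed
    then show "\<exists>N. \<forall>m\<ge>N. \<forall>n\<ge>N. norm (D m u0 - D n u0) < e" by blast
  qed
  then obtain q where q: "(\<lambda>n. D n u0) \<longlonglongrightarrow> q" using Cauchy_convergent unfolding convergent_def by blast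
  have "(\<lambda>n. R (D n u0)) \<longlonglongrightarrow> R q" by (intro blinfun.tendsto tendsto_const q)
  moreover have "(\<lambda>n. R (D n u0)) \<longlonglongrightarrow> u0 - 0"
    unfolding R_D by (intro tendsto_diff tendsto_const Cpow_tendsto)
  ultimately have Rq: "R q = u0" using LIMSEQ_unique by fastforce
  have "(\<lambda>n. \<integral>t. inner (p t - Cpow n (p t)) (g t - Cpow n (g t)) \<partial>I T) \<longlonglongrightarrow> (\<integral>t. inner (p t) (g t) \<partial>I T)"
  proof (rule integral_dominated_convergence[where w = "\<lambda>t. 4 * (norm (p t))^2 + 4 * (norm (g t))^2"])
    show "integrable (I T) (\<lambda>t. 4 * (norm (p t))^2 + 4 * (norm (g t))^2)"
      using L2_spaceD(2)[OF p] L2_spaceD(2)[OF g] by simp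
    show "AE t in I T. (\<lambda>n. inner (p t - Cpow n (p t)) (g t - Cpow n (g t))) \<longlonglongrightarrow> inner (p t) (g t)"
    proof (intro AE_I2)
      fix t
      have "(\<lambda>n. inner (p t - Cpow n (p t)) (g t - Cpow n (g t))) \<longlonglongrightarrow> inner (p t - 0) (g t - 0)"
        by (intro tendsto_intros Cpow_tendsto)
      then show "(\<lambda>n. inner (p t - Cpow n (p t)) (g t - Cpow n (g t))) \<longlonglongrightarrow> inner (p t) (g t)" by simp
    qed
    show "AE t in I T. norm (inner (p t - Cpow n (p t)) (g t - Cpow n (g t))) \<le> 4 * (norm (p t))^2 + 4 * (norm (g t))^2" for n
    proof (intro AE_I2)
      fix t
      have n2: "norm (z - Cpow n z) \<le> 2 * norm z" for z
        using norm_triangle_ineq4[of z "Cpow n z"] norm_Cpow_le[of n z] by linarith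
      have "norm (inner (p t - Cpow n (p t)) (g t - Cpow n (g t))) \<le> norm (p t - Cpow n (p t)) * norm (g t - Cpow n (g t))"
        by (simp add: Cauchy_Schwarz_ineq2)
      also have "\<dots> \<le> (2 * norm (p t)) * (2 * norm (g t))" by (intro mult_mono n2) auto
      also have "\<dots> \<le> 4 * (norm (p t))^2 + 4 * (norm (g t))^2"
      proof -
        have "2 * norm (p t) * norm (g t) \<le> (norm (p t))^2 + (norm (g t))^2" by (rule sum_squares_bound)
        moreover have "0 \<le> (norm (p t))^2 + (norm (g t))^2" by simp
        ultimately show ?thesis by linarith
      qed
      finally show "norm (inner (p t - Cpow n (p t)) (g t - Cpow n (g t))) \<le> 4 * (norm (p t))^2 + 4 * (norm (g t))^2" .
    qed
    show "(\<lambda>t. inner (p t) (g t)) \<in> borel_measurable (I T)" using L2_inner[OF p g] by blast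
    show "(\<lambda>t. inner (p t - Cpow n (p t)) (g t - Cpow n (g t))) \<in> borel_measurable (I T)" for n
      using L2_inner[OF L2_diff[OF p L2_blinfun[OF p, of "Cpow n"]] L2_diff[OF g L2_blinfun[OF g, of "Cpow n"]]] by blast
  qed
  then have "(\<lambda>n. (norm (D n u0))^2) \<longlonglongrightarrow> -2 * (\<integral>t. inner (p t) (g t) \<partial>I T)"
    unfolding En inner_D by (intro tendsto_intros)
  moreover have "(\<lambda>n. (norm (D n u0))^2) \<longlonglongrightarrow> (norm q)^2" by (intro tendsto_intros q)
  ultimately have "(norm q)^2 = -2 * (\<integral>t. inner (p t) (g t) \<partial>I T)" using LIMSEQ_unique by blast
  with Rq show ?thesis unfolding u0_def by blast
qed

lemma
  assumes x: "x \<in> X0"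
  shows X_norm_eq: "X_norm emb A T x = L2_norm T (L x)"
    and L2_norms_le: "(\<integral>t. (norm (dx x t))^2 \<partial>I T) + (\<integral>t. (norm (A (x t)))^2 \<partial>I T) \<le> (\<integral>t. (norm (L x t))^2 \<partial>I T)"
proof -
  note X = X0_D[OF x]
  have p: "(\<lambda>t. A (x t)) \<in> L2_space T" using X(1) by (rule L2_blinfun)
  have "AE t in I T. K (A (x t)) = prim T (dx x) t - prim T (dx x) T" using X(3) by simp
  from energy[OF p X(2) this] obtain q where q: "R q = - prim T (dx x) T"
    "(norm q)^2 = -2 * (\<integral>t. inner (A (x t)) (dx x t) \<partial>I T)" by blast
  have o: "op_apply (sqrt_op (op_in emb A)) (cont_rep T (\<lambda>s. emb (x s)) 0) = q"
    unfolding X(4) q(1)[symmetric] by (rule op_apply_sqrt)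
  note ints = L2_spaceD(2)[OF X(2)] L2_spaceD(2)[OF p] L2_inner[OF p X(2)]
  have "(\<integral>t. (norm (L x t))^2 \<partial>I T) =
      (\<integral>t. (norm (dx x t))^2 + (norm (A (x t)))^2 + -2 * inner (A (x t)) (dx x t) \<partial>I T)"
    unfolding L_def power2_norm_eq_inner
    by (intro Bochner_Integration.integral_cong) (auto simp: inner_simps inner_commute)
  also have "\<dots> = (\<integral>t. (norm (dx x t))^2 \<partial>I T) + (\<integral>t. (norm (A (x t)))^2 \<partial>I T) + (norm q)^2"
    using ints by (simp add: q(2))
  finally have e: "(\<integral>t. (norm (L x t))^2 \<partial>I T) =
      (\<integral>t. (norm (dx x t))^2 \<partial>I T) + (\<integral>t. (norm (A (x t)))^2 \<partial>I T) + (norm q)^2" .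
  show "(\<integral>t. (norm (dx x t))^2 \<partial>I T) + (\<integral>t. (norm (A (x t)))^2 \<partial>I T) \<le> (\<integral>t. (norm (L x t))^2 \<partial>I T)"
    unfolding e by simp
  have "X_norm emb A T x = sqrt ((\<integral>t. (norm (dx x t))^2 + (norm (A (x t)))^2 \<partial>I T) + (norm q)^2)"
    by (simp add: X_norm_def o dx_def)
  also have "\<dots> = sqrt (\<integral>t. (norm (L x t))^2 \<partial>I T)" using ints by (simp add: e)
  finally show "X_norm emb A T x = L2_norm T (L x)" by (simp add: L2_norm_def)
qed

lemma X_norm_pos:
  assumes x: "x \<in> X0" and nz: "\<not> ae_zero T x"
  shows "X_norm emb A T x > 0"
proof (rule ccontr)
  note X = X0_D[OF x]
  have p: "(\<lambda>t. A (x t)) \<in> L2_space T" using X(1) by (rule L2_blinfun)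
  assume "\<not> X_norm emb A T x > 0"
  then have "L2_norm T (L x) = 0" using X_norm_eq[OF x] L2_norm_nonneg[of T "L x"] by simp
  then have "(\<integral>t. (norm (L x t))^2 \<partial>I T) = 0" by (simp add: L2_norm_def)
  moreover have "(\<integral>t. (norm (dx x t))^2 \<partial>I T) \<ge> 0" "(\<integral>t. (norm (A (x t)))^2 \<partial>I T) \<ge> 0" by simp_all
  ultimately have "(\<integral>t. (norm (A (x t)))^2 \<partial>I T) = 0" using L2_norms_le[OF x] by linarith
  then have "ae_zero T (\<lambda>t. A (x t))" using L2_norm_eq_0[OF p] by (simp add: L2_norm_def)
  then have "ae_zero T x" unfolding ae_zero_def by (rule eventually_mono) (rule A_eq_0)
  with nz show False by simp
qed

lemma X0_complete:
  assumes X: "\<And>n. X n \<in> X0"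
    and cau: "\<And>m n. n \<le> m \<Longrightarrow>
      (\<integral>t. (norm (L (\<lambda>t. 1 *\<^sub>R X m t + (-1) *\<^sub>R X n t) t))^2 \<partial>I T) \<le> c * (1/4)^n"
  shows "\<exists>x\<in>X0. (\<lambda>n. \<integral>t. (norm (L (\<lambda>t. 1 *\<^sub>R X n t + (-1) *\<^sub>R x t) t))^2 \<partial>I T) \<longlonglongrightarrow> 0"
proof -
  note XD = X0_D[OF X]
  have XA: "(\<lambda>t. A (X n t)) \<in> L2_space T" for n using XD(1) by (rule L2_blinfun)
  have cau': "(\<integral>t. (norm (dx (X m) t - dx (X n) t))^2 \<partial>I T) \<le> c * (1/4)^n"
    "(\<integral>t. (norm (A (X m t) - A (X n t)))^2 \<partial>I T) \<le> c * (1/4)^n" if "n \<le> m" for m n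
  proof -
    let ?d = "\<lambda>t. 1 *\<^sub>R X m t + (-1) *\<^sub>R X n t"
    have d: "?d \<in> X0" by (rule X0_lin(1)[OF X X])
    have "(\<integral>t. (norm (dx ?d t))^2 \<partial>I T) = (\<integral>t. (norm (dx (X m) t - dx (X n) t))^2 \<partial>I T)"
      using X0_lin(2)[OF X X, of 1 m "-1" n] L2_spaceD(2)[OF X0_D(2)[OF d]] L2_spaceD(2)[OF L2_diff[OF XD(2) XD(2)]]
      by (intro integral_cong_AE) auto
    moreover have "(\<integral>t. (norm (A (?d t)))^2 \<partial>I T) = (\<integral>t. (norm (A (X m t) - A (X n t)))^2 \<partial>I T)"
      by (simp add: blinfun.bilinear_simps)
    moreover have "(\<integral>t. (norm (dx ?d t))^2 \<partial>I T) \<ge> 0" "(\<integral>t. (norm (A (?d t)))^2 \<partial>I T) \<ge> 0" by simp_all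
    ultimately show "(\<integral>t. (norm (dx (X m) t - dx (X n) t))^2 \<partial>I T) \<le> c * (1/4)^n"
      "(\<integral>t. (norm (A (X m t) - A (X n t)))^2 \<partial>I T) \<le> c * (1/4)^n"
      using L2_norms_le[OF d] cau[OF that] by linarith+
  qed
  have T0: "0 \<le> T" using T_pos by simp
  obtain g where g: "g \<in> L2_space T" and gX: "\<And>n. (\<integral>t. (norm (dx (X n) t - g t))^2 \<partial>I T) \<le> c * (1/4)^n"
    using L2_complete[OF T0 XD(2) cau'(1)] by blast
  obtain p where p: "p \<in> L2_space T" and pX: "\<And>n. (\<integral>t. (norm (A (X n t) - p t))^2 \<partial>I T) \<le> c * (1/4)^n"
    using L2_complete[OF T0 XA cau'(2)] by blast
  define x where "x t = Ainv (p t)" for t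
  have xL: "x \<in> L2_space T" unfolding x_def[abs_def] using p by (rule L2_blinfun)
  note gi = L2_imp_integrable[OF g]
  have pg: "(\<lambda>t. prim T g t - prim T g T) \<in> L2_space T" by (rule L2_diff[OF L2_prim[OF gi] L2_const])
  define w where "w t = K (p t) - (prim T g t - prim T g T)" for t
  have wL: "w \<in> L2_space T" unfolding w_def[abs_def] by (rule L2_diff[OF L2_blinfun[OF p] pg])
  have three: "(norm (u + v + z))^2 \<le> 3 * ((norm u)^2 + (norm v)^2 + (norm z)^2)" for u v z :: 'm
  proof -
    have "(norm (u + v + z))^2 \<le> (norm u + norm v + norm z)^2"
      by (intro power_mono norm_triangle_le add_mono norm_triangle_ineq) auto
    also have "\<dots> \<le> 3 * ((norm u)^2 + (norm v)^2 + (norm z)^2)"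
      using sum_squares_bound[of "norm u" "norm v"] sum_squares_bound[of "norm v" "norm z"]
        sum_squares_bound[of "norm u" "norm z"]
      by (simp add: power2_eq_square algebra_simps)
    finally show ?thesis .
  qed
  define B where "B = 3 * ((norm K)^2 * c + 2 * T^2 * c)"
  have wn: "(\<integral>t. (norm (w t))^2 \<partial>I T) \<le> B * (1/4)^n" for n
  proof -
    interpret finite_measure "I T" by (rule finite_measure_I)
    let ?e = "\<lambda>t. dx (X n) t - g t" and ?d = "\<lambda>t. A (X n t) - p t"
    have eL: "?e \<in> L2_space T" and dL: "?d \<in> L2_space T"
      by (rule L2_diff[OF XD(2) g], rule L2_diff[OF XA p])
    have pe: "(norm (prim T ?e t))^2 \<le> T * (c * (1/4)^n)" for t
      using norm_prim_sq_le[OF T0 eL, of t] mult_left_mono[OF gX T0] by (rule order_trans)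
    have "(\<integral>t. (norm (w t))^2 \<partial>I T) \<le> (\<integral>t. 3 * ((norm K)^2 * (norm (?d t))^2 + 2 * (T * (c * (1/4)^n))) \<partial>I T)"
    proof (rule integral_mono_AE)
      show "integrable (I T) (\<lambda>t. (norm (w t))^2)" by (rule L2_spaceD(2)[OF wL])
      show "integrable (I T) (\<lambda>t. 3 * ((norm K)^2 * (norm (?d t))^2 + 2 * (T * (c * (1/4)^n))))"
        using L2_spaceD(2)[OF dL] by simp
      show "AE t in I T. (norm (w t))^2 \<le> 3 * ((norm K)^2 * (norm (?d t))^2 + 2 * (T * (c * (1/4)^n)))"
        using XD(3)[of n]
      proof eventually_elim
        case (elim t)
        have "w t = K (- ?d t) + prim T ?e t + (- prim T ?e T)"
          using elim by (simp add: w_def prim_diff[OF L2_imp_integrable[OF XD(2)] gi] blinfun.bilinear_simps)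
        then have "(norm (w t))^2 \<le> 3 * ((norm (K (- ?d t)))^2 + (norm (prim T ?e t))^2 + (norm (prim T ?e T))^2)"
          using three[of "K (- ?d t)" "prim T ?e t" "- prim T ?e T"] by simp
        moreover have "(norm (K (- ?d t)))^2 \<le> (norm K)^2 * (norm (?d t))^2"
          using power_mono[OF norm_blinfun[of K "- ?d t"], of 2] by (simp add: power_mult_distrib norm_minus_commute)
        moreover have "u \<le> 3 * (k + 2 * b)" if "u \<le> 3 * (x + y + z)" "x \<le> k" "y \<le> b" "z \<le> b" for u x y z k b :: real
          using that by argo
        ultimately show ?case using pe[of t] pe[of T] by blast
      qed
    qed
    also have "\<dots> = 3 * ((norm K)^2 * (\<integral>t. (norm (?d t))^2 \<partial>I T) + T * (2 * (T * (c * (1/4)^n))))"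
      using L2_spaceD(2)[OF dL] T0 by (simp add: measure_I)
    also have "\<dots> \<le> 3 * ((norm K)^2 * (c * (1/4)^n) + T * (2 * (T * (c * (1/4)^n))))"
      by (intro mult_left_mono add_right_mono pX) auto
    also have "\<dots> = B * (1/4)^n" by (simp add: B_def power2_eq_square algebra_simps)
    finally show ?thesis .
  qed
  have "(\<lambda>n. B * (1/4)^n) \<longlonglongrightarrow> 0" by (intro tendsto_mult_right_zero LIMSEQ_power_zero) auto
  then have "(\<integral>t. (norm (w t))^2 \<partial>I T) \<le> 0" by (rule LIMSEQ_le_const) (use wn in auto)
  then have "L2_norm T w = 0" by (simp add: L2_norm_def order_antisym)
  then have "AE t in I T. w t = 0" using L2_norm_eq_0[OF wL] by (simp add: ae_zero_def)
  then have eq: "AE t in I T. emb (x t) = prim T g t - prim T g T"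
    by eventually_elim (simp add: w_def x_def)
  note x = X0_I[OF xL g eq]
  have "(\<integral>t. (norm (L (\<lambda>t. 1 *\<^sub>R X n t + (-1) *\<^sub>R x t) t))^2 \<partial>I T) \<le> 4 * c * (1/4)^n" for n
  proof -
    let ?d = "\<lambda>t. 1 *\<^sub>R X n t + (-1) *\<^sub>R x t"
    have d: "?d \<in> X0" by (rule X0_lin(1)[OF X x(1)])
    note i = L2_spaceD(2)[OF L2_diff[OF XD(2)[of n] g]] L2_spaceD(2)[OF L2_diff[OF XA[of n] p]]
    have "(\<integral>t. (norm (L ?d t))^2 \<partial>I T) \<le>
        (\<integral>t. 2 * (norm (A (X n t) - p t))^2 + 2 * (norm (dx (X n) t - g t))^2 \<partial>I T)"
    proof (rule integral_mono_AE)
      show "AE t in I T. (norm (L ?d t))^2 \<le> 2 * (norm (A (X n t) - p t))^2 + 2 * (norm (dx (X n) t - g t))^2"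
        using X0_lin(2)[OF X x(1), of 1 n "-1"] x(2)
      proof eventually_elim
        case (elim t)
        then have "L ?d t = (A (X n t) - p t) - (dx (X n) t - g t)"
          by (simp add: L_def x_def blinfun.bilinear_simps)
        then have "norm (L ?d t) \<le> norm (A (X n t) - p t) + norm (dx (X n) t - g t)"
          using norm_triangle_ineq4 by metis
        then have "(norm (L ?d t))^2 \<le> (norm (A (X n t) - p t) + norm (dx (X n) t - g t))^2"
          by (rule power_mono) simp
        then show ?case
          using sum_squares_bound[of "norm (A (X n t) - p t)" "norm (dx (X n) t - g t)"]
          by (simp add: power2_sum)
      qed
    qed (use i L2_spaceD(2)[OF L_L2[OF d]] in auto)
    also have "\<dots> = 2 * (\<integral>t. (norm (A (X n t) - p t))^2 \<partial>I T) + 2 * (\<integral>t. (norm (dx (X n) t - g t))^2 \<partial>I T)"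
      using i by simp
    also have "\<dots> \<le> 4 * c * (1/4)^n" using gX[of n] pX[of n] by simp
    finally show ?thesis .
  qed
  note bound = this
  have lim: "(\<lambda>n. 4 * c * (1/4)^n) \<longlonglongrightarrow> 0"
    by (intro tendsto_mult_right_zero LIMSEQ_power_zero) auto
  have "(\<lambda>n. \<integral>t. (norm (L (\<lambda>t. 1 *\<^sub>R X n t + (-1) *\<^sub>R x t) t))^2 \<partial>I T) \<longlonglongrightarrow> 0"
    by (rule Lim_null_comparison[OF _ lim]) (use bound in simp)
  with x(1) show ?thesis by blast
qed

lemma zero_in_X0: "(\<lambda>t. 0) \<in> X0"
proof (rule X0_I(1))
  show "AE t in I T. emb ((\<lambda>t. 0) t) = prim T (\<lambda>t. 0) t - prim T (\<lambda>t. 0) T"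
    by (simp add: prim_def blinfun.zero_right)
qed (rule L2_const)+

lemma riesz_X0:
  assumes psi: "\<psi> \<in> dual_space X0 (X_norm emb A T)"
  shows "\<exists>x0\<in>X0. \<forall>x\<in>X0. \<psi> x = (\<integral>t. inner (L x0 t) (L x t) \<partial>I T)"
proof -
  obtain C where C: "\<And>x. x \<in> X0 \<Longrightarrow> \<bar>\<psi> x\<bar> \<le> C * X_norm emb A T x"
    using psi unfolding dual_space_def by blast
  show ?thesis
  proof (rule riesz_abstract[where lin = "\<lambda>r x s z t. r *\<^sub>R x t + s *\<^sub>R z t" and C = C])
    show "X0 \<noteq> {}" using zero_in_X0 by blast
    fix x y z :: "real \<Rightarrow> 'p" and r s :: real
    assume x: "x \<in> X0" and y: "y \<in> X0"
    show "(\<lambda>t. r *\<^sub>R x t + s *\<^sub>R y t) \<in> X0" by (rule X0_lin(1)[OF x y])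
    show "\<psi> (\<lambda>t. r *\<^sub>R x t + s *\<^sub>R y t) = r * \<psi> x + s * \<psi> y"
      using psi x y unfolding dual_space_def by blast
    assume z: "z \<in> X0"
    have "(\<integral>t. inner (L (\<lambda>t. r *\<^sub>R x t + s *\<^sub>R y t) t) (L z t) \<partial>I T) =
        (\<integral>t. r * inner (L x t) (L z t) + s * inner (L y t) (L z t) \<partial>I T)"
    proof (rule integral_cong_AE)
      show "AE t in I T. inner (L (\<lambda>t. r *\<^sub>R x t + s *\<^sub>R y t) t) (L z t) = r * inner (L x t) (L z t) + s * inner (L y t) (L z t)"
        using X0_lin(3)[OF x y, of r s] by eventually_elim (simp add: inner_simps)
      show "(\<lambda>t. inner (L (\<lambda>t. r *\<^sub>R x t + s *\<^sub>R y t) t) (L z t)) \<in> borel_measurable (I T)"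
        using L2_inner[OF L_L2[OF X0_lin(1)[OF x y]] L_L2[OF z]] by blast
      show "(\<lambda>t. r * inner (L x t) (L z t) + s * inner (L y t) (L z t)) \<in> borel_measurable (I T)"
        using L2_inner[OF L_L2[OF x] L_L2[OF z]] L2_inner[OF L_L2[OF y] L_L2[OF z]] by auto
    qed
    also have "\<dots> = r * (\<integral>t. inner (L x t) (L z t) \<partial>I T) + s * (\<integral>t. inner (L y t) (L z t) \<partial>I T)"
      using L2_inner[OF L_L2[OF x] L_L2[OF z]] L2_inner[OF L_L2[OF y] L_L2[OF z]] by simp
    finally show "(\<integral>t. inner (L (\<lambda>t. r *\<^sub>R x t + s *\<^sub>R y t) t) (L z t) \<partial>I T) =
      r * (\<integral>t. inner (L x t) (L z t) \<partial>I T) + s * (\<integral>t. inner (L y t) (L z t) \<partial>I T)" .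
  next
    fix x y :: "real \<Rightarrow> 'p" assume x: "x \<in> X0"
    show "(\<integral>t. inner (L x t) (L y t) \<partial>I T) = (\<integral>t. inner (L y t) (L x t) \<partial>I T)"
      by (simp add: inner_commute)
    show "0 \<le> (\<integral>t. inner (L x t) (L x t) \<partial>I T)" by simp
    show "\<bar>\<psi> x\<bar> \<le> C * sqrt (\<integral>t. inner (L x t) (L x t) \<partial>I T)"
      using C[OF x] unfolding X_norm_eq[OF x] L2_norm_def power2_norm_eq_inner .
  next
    fix X :: "nat \<Rightarrow> real \<Rightarrow> 'p" and c
    assume 1: "\<And>n. X n \<in> X0" and 2: "\<And>m n. n \<le> m \<Longrightarrow>
      (\<integral>t. inner (L (\<lambda>t. 1 *\<^sub>R X m t + (-1) *\<^sub>R X n t) t) (L (\<lambda>t. 1 *\<^sub>R X m t + (-1) *\<^sub>R X n t) t) \<partial>I T) \<le> c * (1/4)^n"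
    show "\<exists>x\<in>X0. (\<lambda>n. \<integral>t. inner (L (\<lambda>t. 1 *\<^sub>R X n t + (-1) *\<^sub>R x t) t) (L (\<lambda>t. 1 *\<^sub>R X n t + (-1) *\<^sub>R x t) t) \<partial>I T) \<longlonglongrightarrow> 0"
      using X0_complete[where X = X and c = c, OF 1] 2 unfolding power2_norm_eq_inner by blast
  qed
qed

lemma orthogonal_range_L:
  assumes h: "h \<in> L2_space T" and orth: "\<And>x. x \<in> X0 \<Longrightarrow> (\<integral>t. inner (h t) (L x t) \<partial>I T) = 0"
  shows "AE t in I T. h t = 0"
proof -
  note hi = L2_imp_integrable[OF h]
  define p where "p t = prim T h T - prim T h t" for t
  define x where "x t = Ainv (p t)" for t
  have Ax: "A (x t) = p t" for t by (simp add: x_def)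
  have pL: "p \<in> L2_space T" unfolding p_def[abs_def] by (rule L2_diff[OF L2_const L2_prim[OF hi]])
  have xL: "x \<in> L2_space T" unfolding x_def[abs_def] using pL by (rule L2_blinfun)
  have Kh: "(\<lambda>t. K (h t)) \<in> L2_space T" using h by (rule L2_blinfun)
  have gL: "(\<lambda>t. (- K) (h t)) \<in> L2_space T" using h by (rule L2_blinfun)
  have "emb (x t) = prim T (\<lambda>t. (- K) (h t)) t - prim T (\<lambda>t. (- K) (h t)) T" for t
    unfolding prim_blinfun[OF hi] by (simp add: x_def p_def blinfun.bilinear_simps)
  then have eq: "AE t in I T. emb (x t) = prim T (\<lambda>t. (- K) (h t)) t - prim T (\<lambda>t. (- K) (h t)) T" by simp
  note x = X0_I[OF xL gL eq]
  have "0 = (\<integral>t. inner (h t) (L x t) \<partial>I T)" using orth[OF x(1)] by simp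
  also have "\<dots> = (\<integral>t. inner (prim T h T) (h t) - inner (h t) (prim T h t) + inner (h t) (K (h t)) \<partial>I T)"
  proof (rule integral_cong_AE)
    show "AE t in I T. inner (h t) (L x t) = inner (prim T h T) (h t) - inner (h t) (prim T h t) + inner (h t) (K (h t))"
      using x(2) by eventually_elim
        (simp add: L_def Ax p_def blinfun.minus_left inner_simps inner_commute[of "prim T h T"])
    show "(\<lambda>t. inner (h t) (L x t)) \<in> borel_measurable (I T)"
      using L2_inner[OF h L_L2[OF x(1)]] by blast
    show "(\<lambda>t. inner (prim T h T) (h t) - inner (h t) (prim T h t) + inner (h t) (K (h t))) \<in> borel_measurable (I T)"
      using L2_inner[OF L2_const h] L2_inner[OF h L2_prim[OF hi]] L2_inner[OF h Kh] by auto
  qed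
  also have "\<dots> = (\<integral>t. inner (prim T h T) (h t) \<partial>I T) - (\<integral>t. inner (h t) (prim T h t) \<partial>I T) + (\<integral>t. inner (h t) (K (h t)) \<partial>I T)"
    using L2_inner[OF L2_const h] L2_inner[OF h L2_prim[OF hi]] L2_inner[OF h Kh] by simp
  also have "(\<integral>t. inner (prim T h T) (h t) \<partial>I T) = (norm (prim T h T))^2"
    using hi by (simp add: prim_ge_T power2_norm_eq_inner)
  finally have "(norm (prim T h T))^2 / 2 + (\<integral>t. inner (h t) (K (h t)) \<partial>I T) = 0"
    using inner_prim_self[OF hi] by (simp add: prim_ge_T)
  moreover have "0 \<le> inner (h t) (K (h t))" for t using K_nonneg[of "h t"] by (simp add: inner_commute)
  then have "(\<integral>t. inner (h t) (K (h t)) \<partial>I T) \<ge> 0" by simp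
  moreover have "(norm (prim T h T))^2 / 2 \<ge> 0" by simp
  ultimately have "(\<integral>t. inner (h t) (K (h t)) \<partial>I T) = 0" by linarith
  then have "AE t in I T. inner (h t) (K (h t)) = 0"
    using integral_nonneg_eq_0_iff_AE[OF L2_inner[OF h Kh]] \<open>\<And>t. 0 \<le> inner (h t) (K (h t))\<close> by simp
  then show ?thesis by eventually_elim (metis inner_K_eq_0 inner_commute)
qed

lemma L_surj:
  assumes v: "v \<in> L2_space T"
  shows "\<exists>x\<in>X0. AE t in I T. L x t = v t"
proof -
  let ?\<psi> = "\<lambda>x. \<integral>t. inner (v t) (L x t) \<partial>I T"
  have "?\<psi> \<in> dual_space X0 (X_norm emb A T)"
    unfolding dual_space_def
  proof (intro CollectI conjI ballI allI exI)
    fix x z :: "real \<Rightarrow> 'p" and r s :: real assume x: "x \<in> X0" and z: "z \<in> X0"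
    note i = L2_inner[OF v L_L2[OF x]] L2_inner[OF v L_L2[OF z]]
    have "?\<psi> (\<lambda>t. r *\<^sub>R x t + s *\<^sub>R z t) = (\<integral>t. r * inner (v t) (L x t) + s * inner (v t) (L z t) \<partial>I T)"
    proof (rule integral_cong_AE)
      show "AE t in I T. inner (v t) (L (\<lambda>t. r *\<^sub>R x t + s *\<^sub>R z t) t) = r * inner (v t) (L x t) + s * inner (v t) (L z t)"
        using X0_lin(3)[OF x z, of r s] by eventually_elim (simp add: inner_simps)
    qed (use i L2_inner[OF v L_L2[OF X0_lin(1)[OF x z]]] in auto)
    also have "\<dots> = r * ?\<psi> x + s * ?\<psi> z" using i by simp
    finally show "?\<psi> (\<lambda>t. r *\<^sub>R x t + s *\<^sub>R z t) = r * ?\<psi> x + s * ?\<psi> z" .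
  next
    fix x assume x: "x \<in> X0"
    show "\<bar>?\<psi> x\<bar> \<le> L2_norm T v * X_norm emb A T x"
      unfolding X_norm_eq[OF x] by (rule L2_cauchy_schwarz[OF v L_L2[OF x]])
  qed
  from riesz_X0[OF this] obtain x0 where x0: "x0 \<in> X0"
    and eq: "\<And>x. x \<in> X0 \<Longrightarrow> ?\<psi> x = (\<integral>t. inner (L x0 t) (L x t) \<partial>I T)" by blast
  have "AE t in I T. v t - L x0 t = 0"
  proof (rule orthogonal_range_L[OF L2_diff[OF v L_L2[OF x0]]])
    fix x assume x: "x \<in> X0"
    show "(\<integral>t. inner (v t - L x0 t) (L x t) \<partial>I T) = 0"
      using eq[OF x] L2_inner[OF v L_L2[OF x]] L2_inner[OF L_L2[OF x0] L_L2[OF x]]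
      by (simp add: inner_diff_left)
  qed
  then show ?thesis using x0 by (intro bexI[of _ x0]) (auto elim!: eventually_mono)
qed

end

section \<open>Inf-sup constants\<close>

definition riesz_rep :: "('h::{real_inner, banach} \<Rightarrow>\<^sub>L real) \<Rightarrow> 'h" where
  "riesz_rep F = (SOME h. \<forall>x. F x = inner h x)"

lemma riesz_rep:
  fixes F :: "'h::{real_inner, banach} \<Rightarrow>\<^sub>L real"
  shows "F x = inner (riesz_rep F) x"
proof -
  have "\<exists>h. \<forall>x. F x = inner h x" by (rule riesz_hilbert) (rule blinfun.bounded_linear_right)
  then show ?thesis unfolding riesz_rep_def by (rule someI2_ex) blast
qed

lemma riesz_rep_unique:
  fixes F :: "'h::{real_inner, banach} \<Rightarrow>\<^sub>L real"
  shows "(\<And>x. F x = inner h x) \<Longrightarrow> riesz_rep F = h"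
  by (metis inner_diff_left inner_eq_zero_iff right_minus_eq riesz_rep)

lemma norm_riesz_rep: "norm (riesz_rep F) = norm F"
proof (rule antisym)
  let ?h = "riesz_rep F"
  have "norm ?h * norm ?h = F ?h" unfolding riesz_rep by (simp add: power2_norm_eq_inner[symmetric] power2_eq_square)
  also have "\<dots> \<le> norm F * norm ?h" using norm_blinfun[of F ?h] by simp
  finally show "norm ?h \<le> norm F" by (cases "?h = 0") (simp_all add: mult_le_cancel_right)
  show "norm F \<le> norm ?h"
    by (rule norm_blinfun_bound) (simp_all add: riesz_rep Cauchy_Schwarz_ineq2)
qed

lemma bounded_linear_riesz_rep: "bounded_linear riesz_rep"
proof (rule bounded_linear_intro)
  show "riesz_rep (F + G) = riesz_rep F + riesz_rep G" for F G :: "'a \<Rightarrow>\<^sub>L real"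
    by (rule riesz_rep_unique) (simp add: blinfun.add_left inner_add_left flip: riesz_rep)
  show "riesz_rep (r *\<^sub>R F) = r *\<^sub>R riesz_rep F" for r and F :: "'a \<Rightarrow>\<^sub>L real"
    by (rule riesz_rep_unique) (simp add: blinfun.scaleR_left flip: riesz_rep)
  show "norm (riesz_rep F) \<le> norm F * 1" for F :: "'a \<Rightarrow>\<^sub>L real" by (simp add: norm_riesz_rep)
qed

lemma L2_riesz_rep:
  fixes y :: "real \<Rightarrow> 'h::{real_inner, banach} \<Rightarrow>\<^sub>L real"
  assumes "y \<in> L2_space T"
  shows "(\<lambda>t. riesz_rep (y t)) \<in> L2_space T"
  unfolding L2_space_def
proof (intro CollectI conjI)
  show "integrable (I T) (\<lambda>t. (norm (riesz_rep (y t)))\<^sup>2)"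
    using L2_spaceD(2)[OF assms] by (simp add: norm_riesz_rep)
  show "(\<lambda>t. riesz_rep (y t)) \<in> borel_measurable (I T)"
    by (rule measurable_compose[OF L2_spaceD(1)[OF assms] borel_measurable_continuous_onI])
      (rule linear_continuous_on[OF bounded_linear_riesz_rep])
qed

lemma L2_norm_riesz_rep: "L2_norm T (\<lambda>t. riesz_rep (y t)) = L2_norm T y"
  by (simp add: L2_norm_def norm_riesz_rep)

lemma riesz_rep_inner: "riesz_rep (blinfun_inner_right h) = h"
  by (rule riesz_rep_unique) simp

lemma L2_blinfun_inner_right:
  fixes h :: "real \<Rightarrow> 'h::{real_inner, banach}"
  assumes "h \<in> L2_space T"
  shows "(\<lambda>t. blinfun_inner_right (h t)) \<in> L2_space T"
proof -
  have n: "norm (blinfun_inner_right k) = norm k" for k :: 'h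
    using norm_riesz_rep[of "blinfun_inner_right k"] by (simp add: riesz_rep_inner)
  show ?thesis
    unfolding L2_space_def
  proof (intro CollectI conjI)
    show "integrable (I T) (\<lambda>t. (norm (blinfun_inner_right (h t)))\<^sup>2)"
      using L2_spaceD(2)[OF assms] by (simp add: n)
    show "(\<lambda>t. blinfun_inner_right (h t)) \<in> borel_measurable (I T)"
      by (rule measurable_compose[OF L2_spaceD(1)[OF assms] borel_measurable_continuous_onI])
        (rule linear_continuous_on[OF bounded_linear_blinfun_inner_right])
  qed
qed

context parabolic
begin

abbreviation Y :: "(real \<Rightarrow> 'm \<Rightarrow>\<^sub>L real) set" where
  "Y \<equiv> L2_space T"

abbreviation B :: "(real \<Rightarrow> 'm \<Rightarrow>\<^sub>L real) \<Rightarrow> (real \<Rightarrow> 'p) \<Rightarrow> real" where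
  "B \<equiv> B_op emb A T"

lemma B_eq: "B y x = (\<integral>t. inner (riesz_rep (y t)) (L x t) \<partial>I T)"
  by (simp add: B_op_def L_def dx_def riesz_rep)

lemma abs_B_le:
  assumes "y \<in> Y" "x \<in> X0"
  shows "\<bar>B y x\<bar> \<le> L2_norm T y * X_norm emb A T x"
  using L2_cauchy_schwarz[OF L2_riesz_rep[OF assms(1)] L_L2[OF assms(2)]]
  by (simp add: B_eq X_norm_eq[OF assms(2)] L2_norm_riesz_rep)

lemma B_dual:
  assumes y: "y \<in> Y"
  shows "B y \<in> dual_space X0 (X_norm emb A T)"
  unfolding dual_space_def
proof (intro CollectI conjI ballI allI)
  note h = L2_riesz_rep[OF y]
  fix x z :: "real \<Rightarrow> 'p" and r s :: real assume x: "x \<in> X0" and z: "z \<in> X0"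
  note i = L2_inner[OF h L_L2[OF x]] L2_inner[OF h L_L2[OF z]]
  have "B y (\<lambda>t. r *\<^sub>R x t + s *\<^sub>R z t) =
      (\<integral>t. r * inner (riesz_rep (y t)) (L x t) + s * inner (riesz_rep (y t)) (L z t) \<partial>I T)"
    unfolding B_eq
  proof (rule integral_cong_AE)
    show "AE t in I T. inner (riesz_rep (y t)) (L (\<lambda>t. r *\<^sub>R x t + s *\<^sub>R z t) t) =
        r * inner (riesz_rep (y t)) (L x t) + s * inner (riesz_rep (y t)) (L z t)"
      using X0_lin(3)[OF x z, of r s] by eventually_elim (simp add: inner_simps)
  qed (use i L2_inner[OF h L_L2[OF X0_lin(1)[OF x z]]] in auto)
  also have "\<dots> = r * B y x + s * B y z" using i by (simp add: B_eq)
  finally show "B y (\<lambda>t. r *\<^sub>R x t + s *\<^sub>R z t) = r * B y x + s * B y z" .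
next
  show "\<exists>C. \<forall>x\<in>X0. \<bar>B y x\<bar> \<le> C * X_norm emb A T x" using abs_B_le[OF y] by blast
qed

lemma B_maximizer:
  assumes y: "y \<in> Y"
  shows "\<exists>x\<in>X0. X_norm emb A T x = L2_norm T y \<and> B y x = (L2_norm T y)^2"
proof -
  note h = L2_riesz_rep[OF y]
  obtain x where x: "x \<in> X0" and eq: "AE t in I T. L x t = riesz_rep (y t)" using L_surj[OF h] by blast
  have "X_norm emb A T x = L2_norm T y"
    unfolding X_norm_eq[OF x] L2_norm_riesz_rep[of T y, symmetric]
    using eq L2_spaceD(1)[OF L_L2[OF x]] L2_spaceD(1)[OF h]
    by (intro L2_norm_cong) (auto elim!: eventually_mono)
  moreover have "B y x = (\<integral>t. (norm (riesz_rep (y t)))^2 \<partial>I T)"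
    unfolding B_eq
  proof (rule integral_cong_AE)
    show "AE t in I T. inner (riesz_rep (y t)) (L x t) = (norm (riesz_rep (y t)))^2"
      using eq by eventually_elim (simp add: power2_norm_eq_inner)
  qed (use L2_inner[OF h L_L2[OF x]] L2_spaceD(2)[OF h] in auto)
  then have "B y x = (L2_norm T y)^2" by (simp add: L2_norm_sq norm_riesz_rep)
  ultimately show ?thesis using x by blast
qed

lemma X_norm_zero:
  assumes x: "x \<in> X0" and z: "ae_zero T x"
  shows "X_norm emb A T x = 0"
proof -
  have 0: "AE t in I T. emb (x t) = prim T (\<lambda>t. 0) t - prim T (\<lambda>t. 0) T"
    using z unfolding ae_zero_def by eventually_elim (simp add: prim_def blinfun.zero_right)
  have "AE t in I T. L x t = 0"
    using X0_I(2)[OF X0_D(1)[OF x] L2_const 0] z unfolding ae_zero_def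
    by eventually_elim (simp add: L_def blinfun.zero_right)
  then show ?thesis
    using L2_norm_eq_0[OF L_L2[OF x]] by (simp add: X_norm_eq[OF x] ae_zero_def)
qed

lemma quotient_le_1:
  assumes y: "y \<in> Y" and x: "x \<in> X0"
  shows "\<bar>B y x\<bar> / (L2_norm T y * X_norm emb A T x) \<le> 1"
proof -
  have "0 \<le> L2_norm T y * X_norm emb A T x"
    unfolding X_norm_eq[OF x] by (intro mult_nonneg_nonneg L2_norm_nonneg)
  then show ?thesis using abs_B_le[OF y x] by (auto simp: divide_le_eq_1 order_le_less)
qed

lemma sup_quotient:
  assumes y: "y \<in> Y" and nz: "\<not> ae_zero T y"
  shows "(SUP x\<in>{x \<in> X0. \<not> ae_zero T x}. ereal (\<bar>B y x\<bar> / (L2_norm T y * X_norm emb A T x))) = 1"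
proof (rule antisym)
  show "(SUP x\<in>{x \<in> X0. \<not> ae_zero T x}. ereal (\<bar>B y x\<bar> / (L2_norm T y * X_norm emb A T x))) \<le> 1"
    using quotient_le_1[OF y] by (intro SUP_least) auto
  have n: "L2_norm T y \<noteq> 0" using L2_norm_eq_0[OF y] nz by simp
  obtain x where x: "x \<in> X0" and xn: "X_norm emb A T x = L2_norm T y" "B y x = (L2_norm T y)^2"
    using B_maximizer[OF y] by blast
  have "\<not> ae_zero T x" using X_norm_zero[OF x] xn n by auto
  moreover have "\<bar>B y x\<bar> / (L2_norm T y * X_norm emb A T x) = 1"
    unfolding xn using n by (simp add: power2_eq_square)
  ultimately show "1 \<le> (SUP x\<in>{x \<in> X0. \<not> ae_zero T x}. ereal (\<bar>B y x\<bar> / (L2_norm T y * X_norm emb A T x)))"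
    using x by (intro SUP_upper2[of x]) auto
qed

lemma exists_nonzero_Y:
  assumes "\<exists>w::'m. w \<noteq> 0"
  shows "\<exists>y. y \<in> Y \<and> \<not> ae_zero T y"
proof -
  obtain w :: 'm where w: "w \<noteq> 0" using assms by blast
  let ?F = "blinfun_inner_right w"
  have F: "?F \<noteq> 0"
  proof
    assume "?F = 0"
    then have "inner w w = 0" by (metis blinfun_inner_right.rep_eq blinfun.zero_left)
    then show False using w by simp
  qed
  have "(L2_norm T (\<lambda>t. ?F))^2 = T * (norm ?F)^2"
    unfolding L2_norm_sq using T_pos by (simp add: measure_I)
  then have "L2_norm T (\<lambda>t. ?F) \<noteq> 0" using F T_pos by auto
  then show ?thesis using L2_norm_eq_0[OF L2_const[of ?F T]] L2_const by blast
qed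

lemma dual_norm_B_le:
  assumes y: "y \<in> Y"
  shows "dual_norm T X0 (X_norm emb A T) (B y) \<le> ereal 1 * ereal (L2_norm T y)"
  unfolding dual_norm_def
proof (rule SUP_least)
  fix x assume "x \<in> {x \<in> X0. \<not> ae_zero T x}"
  then have x: "x \<in> X0" "X_norm emb A T x > 0" using X_norm_pos by auto
  then show "ereal (\<bar>B y x\<bar> / X_norm emb A T x) \<le> ereal 1 * ereal (L2_norm T y)"
    using abs_B_le[OF y x(1)] by (simp add: pos_divide_le_eq)
qed

lemma dual_norm_B_ge:
  assumes y: "y \<in> Y" and ex: "\<exists>w::'m. w \<noteq> 0"
  shows "ereal (L2_norm T y) \<le> ereal 1 * dual_norm T X0 (X_norm emb A T) (B y)"
proof -
  have up: "\<bar>B y x\<bar> / X_norm emb A T x \<le> dual_norm T X0 (X_norm emb A T) (B y)"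
    if "x \<in> X0" "\<not> ae_zero T x" for x
    unfolding dual_norm_def using that by (intro SUP_upper2[of x]) auto
  have "ereal (L2_norm T y) \<le> dual_norm T X0 (X_norm emb A T) (B y)"
  proof (cases "L2_norm T y = 0")
    case True
    obtain y1 where y1: "y1 \<in> Y" "\<not> ae_zero T y1" using exists_nonzero_Y[OF ex] by blast
    obtain x where x: "x \<in> X0" "X_norm emb A T x = L2_norm T y1" using B_maximizer[OF y1(1)] by blast
    then have "\<not> ae_zero T x" using X_norm_zero[OF x(1)] L2_norm_eq_0[OF y1(1)] y1(2) by auto
    from up[OF x(1) this] have "ereal (\<bar>B y x\<bar> / X_norm emb A T x) \<le> dual_norm T X0 (X_norm emb A T) (B y)" .
    moreover have "ereal (L2_norm T y) \<le> ereal (\<bar>B y x\<bar> / X_norm emb A T x)"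
      using x(2) L2_norm_nonneg[of T y1] by (simp add: True)
    ultimately show ?thesis by (rule order_trans[rotated])
  next
    case False
    obtain x where x: "x \<in> X0" "X_norm emb A T x = L2_norm T y" "B y x = (L2_norm T y)^2"
      using B_maximizer[OF y] by blast
    then have "\<not> ae_zero T x" using X_norm_zero[OF x(1)] False by auto
    moreover have "\<bar>B y x\<bar> / X_norm emb A T x = L2_norm T y"
      unfolding x(2,3) using False by (simp add: power2_eq_square)
    ultimately show ?thesis using up[OF x(1)] by simp
  qed
  then show ?thesis by (simp flip: one_ereal_def)
qed

lemma boundedly_invertible_B:
  assumes ex: "\<exists>w::'m. w \<noteq> 0"
  shows "boundedly_invertible T Y (L2_norm T) X0 (X_norm emb A T) B"
  unfolding boundedly_invertible_def
proof (intro conjI ballI allI impI)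
  show "B y \<in> dual_space X0 (X_norm emb A T)" if "y \<in> Y" for y by (rule B_dual[OF that])
  show "B (\<lambda>t. r *\<^sub>R y t + s *\<^sub>R z t) x = r * B y x + s * B z x"
    if y: "y \<in> Y" and z: "z \<in> Y" and x: "x \<in> X0" for y z r s x
  proof -
    note i = L2_inner[OF L2_riesz_rep[OF y] L_L2[OF x]] L2_inner[OF L2_riesz_rep[OF z] L_L2[OF x]]
    interpret bounded_linear "riesz_rep :: ('m \<Rightarrow>\<^sub>L real) \<Rightarrow> 'm" by (rule bounded_linear_riesz_rep)
    show ?thesis using i by (simp add: B_eq add scaleR inner_simps)
  qed
  show "\<exists>C::real. \<forall>y\<in>Y. dual_norm T X0 (X_norm emb A T) (B y) \<le> ereal C * ereal (L2_norm T y)"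
    using dual_norm_B_le by blast
  show "\<exists>C::real. \<forall>y\<in>Y. ereal (L2_norm T y) \<le> ereal C * dual_norm T X0 (X_norm emb A T) (B y)"
    using dual_norm_B_ge[OF _ ex] by blast
  show "ae_zero T y" if y: "y \<in> Y" and z: "\<forall>x\<in>X0. B y x = 0" for y
  proof -
    have "(L2_norm T y)^2 = 0" using B_maximizer[OF y] z by metis
    then show ?thesis using L2_norm_eq_0[OF y] by simp
  qed
  show "\<exists>y\<in>Y. \<forall>x\<in>X0. B y x = \<psi> x" if psi: "\<psi> \<in> dual_space X0 (X_norm emb A T)" for \<psi>
  proof -
    obtain x0 where x0: "x0 \<in> X0" "\<And>x. x \<in> X0 \<Longrightarrow> \<psi> x = (\<integral>t. inner (L x0 t) (L x t) \<partial>I T)"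
      using riesz_X0[OF psi] by blast
    let ?y = "\<lambda>t. blinfun_inner_right (L x0 t)"
    have "?y \<in> Y" by (rule L2_blinfun_inner_right[OF L_L2[OF x0(1)]])
    moreover have "B ?y x = \<psi> x" if "x \<in> X0" for x
      using x0(2)[OF that] by (simp add: B_eq riesz_rep_inner)
    ultimately show ?thesis by blast
  qed
qed

lemma sup_sup_quotient:
  assumes ex: "\<exists>w::'m. w \<noteq> 0"
  shows "(SUP v\<in>{v \<in> Y. \<not> ae_zero T v}. SUP w\<in>{w \<in> X0. \<not> ae_zero T w}.
      ereal (\<bar>B v w\<bar> / (L2_norm T v * X_norm emb A T w))) = 1"
    and "(INF v\<in>{v \<in> Y. \<not> ae_zero T v}. SUP w\<in>{w \<in> X0. \<not> ae_zero T w}.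
      ereal (\<bar>B v w\<bar> / (L2_norm T v * X_norm emb A T w))) = 1"
proof -
  have ne: "{v \<in> Y. \<not> ae_zero T v} \<noteq> {}" using exists_nonzero_Y[OF ex] by blast
  have "(SUP v\<in>{v \<in> Y. \<not> ae_zero T v}. SUP w\<in>{w \<in> X0. \<not> ae_zero T w}.
      ereal (\<bar>B v w\<bar> / (L2_norm T v * X_norm emb A T w))) = (SUP v\<in>{v \<in> Y. \<not> ae_zero T v}. 1)"
    by (intro SUP_cong refl sup_quotient) auto
  also have "\<dots> = 1" using ne by (rule SUP_const)
  finally show "(SUP v\<in>{v \<in> Y. \<not> ae_zero T v}. SUP w\<in>{w \<in> X0. \<not> ae_zero T w}.
      ereal (\<bar>B v w\<bar> / (L2_norm T v * X_norm emb A T w))) = 1" .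
  have "(INF v\<in>{v \<in> Y. \<not> ae_zero T v}. SUP w\<in>{w \<in> X0. \<not> ae_zero T w}.
      ereal (\<bar>B v w\<bar> / (L2_norm T v * X_norm emb A T w))) = (INF v\<in>{v \<in> Y. \<not> ae_zero T v}. 1)"
    by (intro INF_cong refl sup_quotient) auto
  also have "\<dots> = 1" using ne by (rule INF_const)
  finally show "(INF v\<in>{v \<in> Y. \<not> ae_zero T v}. SUP w\<in>{w \<in> X0. \<not> ae_zero T w}.
      ereal (\<bar>B v w\<bar> / (L2_norm T v * X_norm emb A T w))) = 1" .
qed

end

theorem theorem4:
  fixes T :: real
    and M :: "'w measure"
    and emb :: "'p::{real_inner, banach, second_countable_topology} \<Rightarrow>\<^sub>L
                'm::{real_inner, banach, second_countable_topology}"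
    and A :: "'w \<Rightarrow> 'p \<Rightarrow>\<^sub>L 'm"
    and Amin Amax :: "'w \<Rightarrow> real"
  assumes "0 < T"
    and "prob_space M" and "complete_measure M"
    and "\<exists>w::'p. w \<noteq> 0" and "\<exists>w::'m. w \<noteq> 0"
    and "inj (blinfun_apply emb)" and "closure (range (blinfun_apply emb)) = UNIV"
    and "Amin \<in> borel_measurable M" and "Amax \<in> borel_measurable M"
    and "AE \<omega> in M. 0 < Amin \<omega> \<and> Amin \<omega> \<le> Amax \<omega>"
    and "AE \<omega> in M. selfadjoint (op_in emb (A \<omega>)) \<and> positive_op (op_in emb (A \<omega>))"
    and "AE \<omega> in M. \<forall>w. Amin \<omega> * norm w \<le> norm (blinfun_apply (A \<omega>) w) \<and>
                        norm (blinfun_apply (A \<omega>) w) \<le> Amax \<omega> * norm w"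
  shows "(AE \<omega> in M. boundedly_invertible T
            (L2_space T :: (real \<Rightarrow> 'm \<Rightarrow>\<^sub>L real) set) (L2_norm T)
            (X0_space emb T) (X_norm emb (A \<omega>) T) (B_op emb (A \<omega>) T)) \<and>
         (AE \<omega> in M.
            (SUP v\<in>{v \<in> (L2_space T :: (real \<Rightarrow> 'm \<Rightarrow>\<^sub>L real) set). \<not> ae_zero T v}.
             SUP w\<in>{w \<in> X0_space emb T. \<not> ae_zero T w}.
               ereal (\<bar>B_op emb (A \<omega>) T v w\<bar> / (L2_norm T v * X_norm emb (A \<omega>) T w))) = 1) \<and>
         (AE \<omega> in M.
            (INF v\<in>{v \<in> (L2_space T :: (real \<Rightarrow> 'm \<Rightarrow>\<^sub>L real) set). \<not> ae_zero T v}.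
             SUP w\<in>{w \<in> X0_space emb T. \<not> ae_zero T w}.
               ereal (\<bar>B_op emb (A \<omega>) T v w\<bar> / (L2_norm T v * X_norm emb (A \<omega>) T w))) = 1)"
proof -
  have "AE \<omega> in M. parabolic emb (A \<omega>) (Amin \<omega>) T"
    using assms(10-12)
  proof eventually_elim
    case (elim \<omega>)
    then show ?case
      using assms(1,6,7) by unfold_locales auto
  qed
  then show ?thesis
    using parabolic.boundedly_invertible_B[OF _ assms(5)]
      parabolic.sup_sup_quotient[OF _ assms(5)]
    by (auto elim!: eventually_mono)
qed

end
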